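(* Let $(G_n)$ be a sequence of finite random graphs such that $(G_n,o_n)$ converges locally weakly to a random rooted graph $(G,o)$, where, conditionally on $G_n$, $o_n$ is chosen uniformly from $V(G_n)$. Conditionally on the graphs, let the edge weights $(w_e)_{e\in E(G_n)}$ and $(w_e)_{e\in E(G)}$ be i.i.d. nonnegative random variables with a common continuous distribution $F$. Suppose that, almost surely under the law of $(G,o)$, $G$ satisfies the correlation decay assumption (for weight distribution $F$): for each $e\in E(G)$, $\varrho_r(G,e)\to0$ as $r\to\infty$. Then the sequence $$\bigl(G_n,o_n,(w_e)_{e\in E(G_n)},(\mathbf{1}_{\{e\in\mathsf{M}_{G_n}\}})_{e\in E(G_n)}\bigr)$$ converges locally weakly to $$\bigl(G,o,(w_e)_{e\in E(G)},(\mathbf{1}_{\{e\in\mathsf{M}_{G}\}})_{e\in E(G)}\bigr).$$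
   Context: A graph $G=(V(G),E(G))$ is undirected, with edges $(uv)$ being unordered pairs of distinct vertices. For $u,v\in V(G)$, $u\sim_G v$ means $(uv)\in E(G)$. **Matchings.** A matching of a graph is a set of edges no two of which share a vertex. For a finite graph $H$ with edge weights $(w_e)$, the weight of a matching $M$ is $w_M=\sum_{e\in M}w_e$, and $\mathsf{M}_H$ denotes the maximum weight matching (the matching of $H$ maximizing $w_M$), almost surely unique for i.i.d. weights from a continuous distribution (one without atoms). Subgraphs inherit edge weights. **Correlation decay.** For an edge $e=(uv)$ of $G$ and $r\ge 0$, $\mathbb{B}_e^r(G)$ is the subgraph of $G$ induced by all vertices at graph distance at most $r$ from $u$ or from $v$. For a subgraph $H$ of $G$, $\partial H=\{v\in V(H): v\sim_G u \text{ for some } u\in V(G)\setminus V(H)\}$. For $A\subseteq V(H)$, $H\setminus A$ is the induced subgraph of $H$ on $V(H)\setminus A$. For a locally finite connected (non-random) graph $G$ with i.i.d. weights of law $F$, $$\varrho_r(G,e)=\mathbf{E}\sup_{A\subseteq \partial \mathbb{B}_e^r(G)}\bigl|\mathbf{1}_{\{e\in \mathsf{M}_{\mathbb{B}_e^r(G)}\}}-\mathbf{1}_{\{e\in \mathsf{M}_{\mathbb{B}_e^r(G)\setminus A}\}}\bigr|,$$ the expectation being over the edge weights. **MWM on an infinite graph.** If $G$ is an infinite locally finite connected graph with $\varrho_r(G,e)\to0$ for every $e\in E(G)$, then for any sequence $(H_n)$ of finite subgraphs increasing to $G$ and any $e\in E(G)$, $\lim_n\mathbf{1}_{\{e\in\mathsf{M}_{H_n}\}}$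 exists almost surely and is almost surely independent of the choice of $(H_n)$; $\mathsf{M}_G$ is the set of edges $e$ for which this limit is $1$ (almost surely a matching). If $G$ is finite, $\mathsf{M}_G$ is the usual maximum weight matching. **Local weak convergence.** A rooted graph $(G,o)$ is a locally finite graph with a vertex $o$; $\mathbb{B}_o^r(G)$ is the subgraph induced by the vertices at distance at most $r$ from $o$. Let $\mathcal{G}^*$ be the space of isomorphism classes of rooted connected graphs (a possibly disconnected rooted graph is identified with the component of its root), with the metric $d_{\mathrm{loc}}((G_1,o_1),(G_2,o_2))=1/(R+1)$, where $R$ is the supremum of $r\ge0$ such that $(\mathbb{B}_{o_1}^r(G_1),o_1)$ and $(\mathbb{B}_{o_2}^r(G_2),o_2)$ are isomorphic as rooted graphs. Similarly let $\mathcal{G}^*_{\mathbb{R}^k}$ be the space of isomorphism classes of rooted connected graphs with edge marks in $\mathbb{R}^k$, with the Polish topology in which $(G_n,o_n,(w^n_e))\to(G,o,(w_e))$ iff for every $r\geq 0$ and all large $n$ there is a rooted isomorphism $\phi_n$ from $\mathbb{B}_{o}^r(G)$ to $\mathbb{B}_{o_n}^r(G_n)$ with $\sum_{e\in E(\mathbb{B}_o^r(G))}\|w^n_{\phi_n(e)}-w_e\|_2^2\to0$. Local weak convergence of random rooted (marked) graphs means convergence in distribution (convergence of expectations of bounded continuous functions) in $\mathcal{G}^*$ (respectively $\mathcal{G}^*_{\mathbb{R}^k}$). In the conclusion the marks are the pairs $(w_e,\mathbf{1}_{\{e\in\mathsf{M}\}})\in\mathbb{R}^2$, and expectations are over both the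 graph and the weights. *)

theory Defs
  imports "HOL-Probability.Probability"
begin

section \<open>Graphs\<close>

datatype 'v graph = Graph (verts: "'v set") (edges: "'v set set")

definition ugraph :: "'v graph \<Rightarrow> bool" where
  "ugraph G \<longleftrightarrow> (\<forall>e\<in>edges G. \<exists>u\<in>verts G. \<exists>v\<in>verts G. u \<noteq> v \<and> e = {u, v})"

definition adj :: "'v graph \<Rightarrow> ('v \<times> 'v) set" where
  "adj G = {(u, v). {u, v} \<in> edges G}"

definition gdist :: "'v graph \<Rightarrow> 'v \<Rightarrow> 'v \<Rightarrow> enat" where
  "gdist G u v = (INF k\<in>{k. (u, v) \<in> adj G ^^ k}. enat k)"

definition connected_graph :: "'v graph \<Rightarrow> bool" where
  "connected_graph G \<longleftrightarrow> (\<forall>u\<in>verts G. \<forall>v\<in>verts G. gdist G u v < \<infinity>)"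

definition locally_finite :: "'v graph \<Rightarrow> bool" where
  "locally_finite G \<longleftrightarrow> (\<forall>u\<in>verts G. finite {v. {u, v} \<in> edges G})"

definition subgraph :: "'v graph \<Rightarrow> 'v graph \<Rightarrow> bool" where
  "subgraph H G \<longleftrightarrow> ugraph H \<and> verts H \<subseteq> verts G \<and> edges H \<subseteq> edges G"

definition induced :: "'v graph \<Rightarrow> 'v set \<Rightarrow> 'v graph" where
  "induced G S = Graph (verts G \<inter> S) {e \<in> edges G. e \<subseteq> S}"

definition delete_verts :: "'v graph \<Rightarrow> 'v set \<Rightarrow> 'v graph" where
  "delete_verts H A = induced H (verts H - A)"

text \<open>The ball of radius \<open>r\<close> about a set of vertices: about \<open>{x}\<close> it is the ball of a vertex, and
  about an edge \<open>e\<close>, being the set of its two endpoints, it is the ball of that edge.\<close>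

definition gball :: "'v graph \<Rightarrow> 'v set \<Rightarrow> nat \<Rightarrow> 'v graph" where
  "gball G S r = induced G {v. \<exists>u\<in>S. gdist G u v \<le> enat r}"

definition boundary :: "'v graph \<Rightarrow> 'v graph \<Rightarrow> 'v set" where
  "boundary G H = {v \<in> verts H. \<exists>u \<in> verts G - verts H. {u, v} \<in> edges G}"

definition component :: "'v graph \<Rightarrow> 'v \<Rightarrow> 'v graph" where
  "component G x = induced G {v. gdist G x v < \<infinity>}"


section \<open>Maximum weight matchings\<close>

definition matching :: "'v graph \<Rightarrow> 'v set set \<Rightarrow> bool" where
  "matching G M \<longleftrightarrow> M \<subseteq> edges G \<and> pairwise disjnt M"

text \<open>Ties are broken by choice; under i.i.d. weights without atoms they have probability zero.\<close>

definition finite_mwm :: "'v graph \<Rightarrow> ('v set \<Rightarrow> real) \<Rightarrow> 'v set set" where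
  "finite_mwm H w = arg_max (\<lambda>M. \<Sum>e\<in>M. w e) (matching H)"

definition exhaustion :: "(nat \<Rightarrow> 'v graph) \<Rightarrow> 'v graph \<Rightarrow> bool" where
  "exhaustion H G \<longleftrightarrow>
     (\<forall>n. finite (verts (H n)) \<and> subgraph (H n) G \<and> subgraph (H n) (H (Suc n))) \<and>
     (\<Union>n. verts (H n)) = verts G \<and> (\<Union>n. edges (H n)) = edges G"

text \<open>Under correlation decay, almost surely the limit along an exhaustion exists and is the same for
  all exhaustions simultaneously: if the supremum in the definition of \<open>corr_decay_coeff\<close> below is
  zero at some radius \<open>r\<close>, then all finite subgraphs containing the ball of radius \<open>r\<close> about \<open>e\<close> agree
  on whether \<open>e\<close> is in their maximum weight matching. Quantifying over all exhaustions
  for fixed weights therefore gives the same matching, up to a null set, as any single exhaustion.\<close>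

definition mwm :: "'v graph \<Rightarrow> ('v set \<Rightarrow> real) \<Rightarrow> 'v set set" where
  "mwm G w =
     (if finite (verts G) then finite_mwm G w
      else {e \<in> edges G. \<forall>H. exhaustion H G \<longrightarrow>
              (\<lambda>n. of_bool (e \<in> finite_mwm (H n) w) :: real) \<longlonglongrightarrow> 1})"

definition corr_decay_coeff :: "real measure \<Rightarrow> 'v graph \<Rightarrow> 'v set \<Rightarrow> nat \<Rightarrow> real" where
  "corr_decay_coeff F G e r =
     (let B = gball G e r in
      \<integral>w. (SUP A\<in>Pow (boundary G B).
              \<bar>of_bool (e \<in> finite_mwm B w) - of_bool (e \<in> finite_mwm (delete_verts B A) w)\<bar>)
        \<partial>(\<Pi>\<^sub>M e\<in>edges G. F))"

definition correlation_decay :: "real measure \<Rightarrow> 'v graph \<Rightarrow> bool" where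
  "correlation_decay F G \<longleftrightarrow> (\<forall>e\<in>edges G. corr_decay_coeff F G e \<longlonglongrightarrow> 0)"


section \<open>Isomorphism of rooted graphs\<close>

definition graph_iso :: "('v \<Rightarrow> 'u) \<Rightarrow> 'v graph \<Rightarrow> 'u graph \<Rightarrow> bool" where
  "graph_iso \<phi> G H \<longleftrightarrow> bij_betw \<phi> (verts G) (verts H) \<and> edges H = (\<lambda>e. \<phi> ` e) ` edges G"

definition rooted_graph :: "'v graph \<Rightarrow> 'v \<Rightarrow> bool" where
  "rooted_graph G x \<longleftrightarrow> ugraph G \<and> locally_finite G \<and> connected_graph G \<and> x \<in> verts G"

definition rooted_iso :: "('v \<Rightarrow> 'u) \<Rightarrow> 'v graph \<times> 'v \<Rightarrow> 'u graph \<times> 'u \<Rightarrow> bool" where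
  "rooted_iso \<phi> = (\<lambda>(G, x) (H, y). graph_iso \<phi> G H \<and> \<phi> x = y)"

definition marked_iso :: "('v \<Rightarrow> 'u) \<Rightarrow> 'v graph \<times> 'v \<times> ('v set \<Rightarrow> 'm) \<Rightarrow>
    'u graph \<times> 'u \<times> ('u set \<Rightarrow> 'm) \<Rightarrow> bool" where
  "marked_iso \<phi> = (\<lambda>(G, x, a) (H, y, b).
     rooted_iso \<phi> (G, x) (H, y) \<and> (\<forall>e\<in>edges G. b (\<phi> ` e) = a e))"

lemma edge_subset_verts: "ugraph G \<Longrightarrow> e \<in> edges G \<Longrightarrow> e \<subseteq> verts G"
  by (auto simp: ugraph_def)

lemma graph_iso_id: "graph_iso (\<lambda>v. v) G G"
  by (auto simp: graph_iso_def bij_betw_def)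

lemma graph_iso_comp:
  "graph_iso \<phi> G H \<Longrightarrow> graph_iso \<psi> H K \<Longrightarrow> graph_iso (\<lambda>v. \<psi> (\<phi> v)) G K"
  unfolding graph_iso_def
  using bij_betw_trans[of \<phi> "verts G" "verts H" \<psi> "verts K"]
  by (auto simp: image_image o_def)

lemma inv_into_edge:
  assumes "graph_iso \<phi> G H" "ugraph G" "e \<in> edges G"
  shows "inv_into (verts G) \<phi> ` \<phi> ` e = e"
  using assms edge_subset_verts[of G e] unfolding graph_iso_def bij_betw_def
  by (simp add: inv_into_image_cancel)

lemma graph_iso_inv:
  assumes "graph_iso \<phi> G H" "ugraph G"
  shows "graph_iso (inv_into (verts G) \<phi>) H G"
proof -
  have "(\<lambda>e. inv_into (verts G) \<phi> ` e) ` edges H = (\<lambda>e. inv_into (verts G) \<phi> ` \<phi> ` e) ` edges G"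
    using assms(1) by (auto simp: graph_iso_def image_image)
  also have "\<dots> = edges G"
    using inv_into_edge[OF assms] by (auto simp: image_iff)
  finally show ?thesis
    using assms(1) by (simp add: graph_iso_def bij_betw_inv_into)
qed

lemma adj_pow_iso:
  assumes "graph_iso \<phi> G H" "(u, v) \<in> adj G ^^ k"
  shows "(\<phi> u, \<phi> v) \<in> adj H ^^ k"
  using assms(2)
proof (induction k arbitrary: v)
  case (Suc k)
  then obtain w where w: "(u, w) \<in> adj G ^^ k" "(w, v) \<in> adj G" by auto
  then have "{w, v} \<in> edges G" by (simp add: adj_def)
  then have "\<phi> ` {w, v} \<in> edges H"
    using assms(1) unfolding graph_iso_def by blast
  then have "(\<phi> w, \<phi> v) \<in> adj H" by (simp add: adj_def)
  then show ?case using Suc.IH[OF w(1)] by auto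
qed auto

lemma gdist_iso:
  assumes "graph_iso \<phi> G H" "ugraph G" "u \<in> verts G" "v \<in> verts G"
  shows "gdist H (\<phi> u) (\<phi> v) = gdist G u v"
proof -
  let ?\<psi> = "inv_into (verts G) \<phi>"
  have "?\<psi> (\<phi> u) = u" "?\<psi> (\<phi> v) = v"
    using assms by (auto simp: graph_iso_def bij_betw_def inv_into_f_f)
  then have "(u, v) \<in> adj G ^^ k \<longleftrightarrow> (\<phi> u, \<phi> v) \<in> adj H ^^ k" for k
    using adj_pow_iso[OF assms(1), of u v k]
      adj_pow_iso[OF graph_iso_inv[OF assms(1,2)], of "\<phi> u" "\<phi> v" k] by auto
  then show ?thesis by (simp add: gdist_def)
qed

lemma gball_iso:
  assumes "graph_iso \<phi> G H" "ugraph G" "x \<in> verts G"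
  shows "graph_iso \<phi> (gball G {x} r) (gball H {\<phi> x} r)"
proof -
  let ?V = "{v. gdist G x v \<le> enat r}" and ?W = "{v. gdist H (\<phi> x) v \<le> enat r}"
  have inj: "inj_on \<phi> (verts G)" and im: "\<phi> ` verts G = verts H"
    and E: "edges H = (\<lambda>e. \<phi> ` e) ` edges G"
    using assms(1) by (auto simp: graph_iso_def bij_betw_def)
  have iff: "\<phi> v \<in> ?W \<longleftrightarrow> v \<in> ?V" if "v \<in> verts G" for v
    using gdist_iso[OF assms(1,2,3) that] by simp
  have "\<phi> ` (verts G \<inter> ?V) = verts H \<inter> ?W"
    using iff unfolding im[symmetric] by auto
  moreover have "\<phi> ` e \<subseteq> ?W \<longleftrightarrow> e \<subseteq> ?V" if "e \<in> edges G" for e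
    using iff edge_subset_verts[OF assms(2) that] by blast
  then have "{e \<in> edges H. e \<subseteq> ?W} = (\<lambda>e. \<phi> ` e) ` {e \<in> edges G. e \<subseteq> ?V}"
    unfolding E by auto
  ultimately show ?thesis
    using inj by (auto simp: graph_iso_def bij_betw_def gball_def induced_def inj_on_def)
qed

lemma ugraph_gball: "ugraph G \<Longrightarrow> ugraph (gball G S r)"
  by (fastforce simp: ugraph_def gball_def induced_def)

lemma inj_on_edges_iso:
  assumes "graph_iso \<phi> G H" "ugraph G"
  shows "inj_on (\<lambda>e. \<phi> ` e) (edges G)"
  by (rule inj_on_inverseI[where g = "\<lambda>e. inv_into (verts G) \<phi> ` e"]) (rule inv_into_edge[OF assms])


section \<open>The space of rooted graphs\<close>

text \<open>A connected locally finite graph is countable, so \<open>nat\<close> as vertex type yields all isomorphism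
  classes. Both relations are partial: only connected locally finite graphs with a root
  among their vertices represent a class.\<close>

definition rooted_equiv :: "nat graph \<times> nat \<Rightarrow> nat graph \<times> nat \<Rightarrow> bool" where
  "rooted_equiv g h \<longleftrightarrow>
     rooted_graph (fst g) (snd g) \<and> rooted_graph (fst h) (snd h) \<and> (\<exists>\<phi>. rooted_iso \<phi> g h)"

definition trivial_graph :: "nat graph" where
  "trivial_graph = Graph {0} {}"

lemma rooted_graph_trivial: "rooted_graph trivial_graph 0"
proof -
  have "gdist trivial_graph 0 0 \<le> enat 0"
    unfolding gdist_def by (rule INF_lower) simp
  then have "gdist trivial_graph 0 0 < \<infinity>" by (rule order_le_less_trans) simp
  then show ?thesis
    by (auto simp: rooted_graph_def trivial_graph_def ugraph_def locally_finite_def connected_graph_def)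
qed

lemma rooted_iso_refl: "rooted_iso (\<lambda>v. v) g g"
  by (auto simp: rooted_iso_def graph_iso_id split: prod.splits)

lemma rooted_iso_trans: "rooted_iso \<phi> g h \<Longrightarrow> rooted_iso \<psi> h k \<Longrightarrow> rooted_iso (\<lambda>v. \<psi> (\<phi> v)) g k"
  by (auto simp: rooted_iso_def dest: graph_iso_comp split: prod.splits)

lemma rooted_iso_sym:
  assumes "rooted_iso \<phi> g h" "ugraph (fst g)" "snd g \<in> verts (fst g)"
  shows "rooted_iso (inv_into (verts (fst g)) \<phi>) h g"
  using assms graph_iso_inv[of \<phi> "fst g" "fst h"]
  by (auto simp: rooted_iso_def graph_iso_def bij_betw_def inv_into_f_f split: prod.splits)

lemma part_equivp_rooted_equiv: "part_equivp rooted_equiv"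
proof (rule part_equivpI)
  show "\<exists>x. rooted_equiv x x"
    using rooted_graph_trivial rooted_iso_refl by (fastforce simp: rooted_equiv_def)
  show "symp rooted_equiv"
    by (rule sympI) (auto simp: rooted_equiv_def rooted_graph_def dest: rooted_iso_sym)
  show "transp rooted_equiv"
    by (rule transpI) (auto simp: rooted_equiv_def dest: rooted_iso_trans)
qed

quotient_type rooted_class = "nat graph \<times> nat" / partial: rooted_equiv
  by (rule part_equivp_rooted_equiv)

definition rooted_ball :: "nat graph \<times> nat \<Rightarrow> nat \<Rightarrow> nat graph \<times> nat" where
  "rooted_ball = (\<lambda>(G, x) r. (gball G {x} r, x))"

lemma rooted_ball_iso:
  assumes "rooted_iso \<phi> g h" "rooted_graph (fst g) (snd g)"
  shows "rooted_iso \<phi> (rooted_ball g r) (rooted_ball h r)"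
  using assms gball_iso[of \<phi> "fst g" "fst h" "snd g" r]
  by (auto simp: rooted_iso_def rooted_ball_def rooted_graph_def split: prod.splits)

lemma rooted_ball_iso_ex_trans:
  assumes "rooted_equiv g g'" "rooted_equiv h h'" "\<exists>\<phi>. rooted_iso \<phi> (rooted_ball g r) (rooted_ball h r)"
  shows "\<exists>\<phi>. rooted_iso \<phi> (rooted_ball g' r) (rooted_ball h' r)"
proof -
  obtain \<alpha> where "rooted_iso \<alpha> (rooted_ball g' r) (rooted_ball g r)"
    using part_equivp_symp[OF part_equivp_rooted_equiv assms(1)]
    unfolding rooted_equiv_def by (blast intro: rooted_ball_iso)
  moreover obtain \<beta> where "rooted_iso \<beta> (rooted_ball h r) (rooted_ball h' r)"
    using assms(2) unfolding rooted_equiv_def by (blast intro: rooted_ball_iso)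
  ultimately show ?thesis using assms(3) by (blast intro: rooted_iso_trans)
qed

text \<open>The supremum is taken in \<^typ>\<open>ereal\<close>, so that isomorphic graphs get distance \<open>1 / \<infinity> = 0\<close>.\<close>

lift_definition d_loc :: "rooted_class \<Rightarrow> rooted_class \<Rightarrow> real" is
  "\<lambda>g h. real_of_ereal
     (1 / ((SUP r\<in>{r. \<exists>\<phi>. rooted_iso \<phi> (rooted_ball g r) (rooted_ball h r)}. ereal (real r)) + 1))"
proof -
  fix g g' h h' assume *: "rooted_equiv g g'" "rooted_equiv h h'"
  then have **: "rooted_equiv g' g" "rooted_equiv h' h"
    using part_equivp_symp[OF part_equivp_rooted_equiv] by auto
  let ?S = "\<lambda>g h. {r. \<exists>\<phi>. rooted_iso \<phi> (rooted_ball g r) (rooted_ball h r)}"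
  have "?S g h = ?S g' h'"
    using rooted_ball_iso_ex_trans[OF *] rooted_ball_iso_ex_trans[OF **] by blast
  then show "real_of_ereal (1 / ((SUP r\<in>?S g h. ereal (real r)) + 1)) =
      real_of_ereal (1 / ((SUP r\<in>?S g' h'. ereal (real r)) + 1))" by simp
qed

instantiation rooted_class :: topological_space
begin

definition open_rooted_class :: "rooted_class set \<Rightarrow> bool" where
  "open_rooted_class U \<longleftrightarrow> (\<forall>x\<in>U. \<exists>\<epsilon>>0. \<forall>y. d_loc x y < \<epsilon> \<longrightarrow> y \<in> U)"

instance
proof
  show "open (UNIV :: rooted_class set)"
    by (auto simp: open_rooted_class_def intro: zero_less_one)
next
  fix S T :: "rooted_class set"
  assume *: "open S" "open T"
  show "open (S \<inter> T)"
    unfolding open_rooted_class_def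
  proof
    fix x assume "x \<in> S \<inter> T"
    then obtain \<delta> \<epsilon> where "\<delta> > 0" "\<forall>y. d_loc x y < \<delta> \<longrightarrow> y \<in> S" "\<epsilon> > 0" "\<forall>y. d_loc x y < \<epsilon> \<longrightarrow> y \<in> T"
      using * unfolding open_rooted_class_def by blast
    then show "\<exists>\<epsilon>>0. \<forall>y. d_loc x y < \<epsilon> \<longrightarrow> y \<in> S \<inter> T"
      by (intro exI[of _ "min \<delta> \<epsilon>"]) auto
  qed
next
  fix K :: "rooted_class set set"
  assume "\<forall>S\<in>K. open S"
  then show "open (\<Union>K)"
    unfolding open_rooted_class_def by (meson Union_iff)
qed

end


section \<open>The space of rooted graphs with edge marks\<close>

definition marked_equiv :: "nat graph \<times> nat \<times> (nat set \<Rightarrow> 'm) \<Rightarrow>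
    nat graph \<times> nat \<times> (nat set \<Rightarrow> 'm) \<Rightarrow> bool" where
  "marked_equiv g h \<longleftrightarrow>
     rooted_graph (fst g) (fst (snd g)) \<and> rooted_graph (fst h) (fst (snd h)) \<and> (\<exists>\<phi>. marked_iso \<phi> g h)"

lemma marked_iso_trans:
  "marked_iso \<phi> g h \<Longrightarrow> marked_iso \<psi> h k \<Longrightarrow> marked_iso (\<lambda>v. \<psi> (\<phi> v)) g k"
  unfolding marked_iso_def
  by (auto dest: rooted_iso_trans split: prod.splits)
     (auto simp: rooted_iso_def graph_iso_def image_image)

lemma marked_iso_sym:
  assumes "marked_iso \<phi> g h" "ugraph (fst g)" "fst (snd g) \<in> verts (fst g)"
  shows "marked_iso (inv_into (verts (fst g)) \<phi>) h g"
proof -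
  obtain G x a H y b where gh: "g = (G, x, a)" "h = (H, y, b)" by (metis prod_cases3)
  have iso: "rooted_iso \<phi> (G, x) (H, y)" and marks: "\<forall>e\<in>edges G. b (\<phi> ` e) = a e"
    using assms(1) by (auto simp: gh marked_iso_def)
  have "\<forall>e\<in>edges H. a (inv_into (verts G) \<phi> ` e) = b e"
    using iso marks assms(2) inv_into_edge[of \<phi> G H] by (auto simp: gh rooted_iso_def graph_iso_def)
  moreover have "rooted_iso (inv_into (verts G) \<phi>) (H, y) (G, x)"
    using rooted_iso_sym[OF iso] assms(2,3) by (simp add: gh)
  ultimately show ?thesis by (simp add: gh marked_iso_def)
qed

lemma part_equivp_marked_equiv: "part_equivp marked_equiv"
proof (rule part_equivpI)
  have "marked_equiv (trivial_graph, 0, \<lambda>_. undefined) (trivial_graph, 0, \<lambda>_. undefined)"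
    using rooted_graph_trivial rooted_iso_refl[of "(trivial_graph, 0)"]
    by (auto simp: marked_equiv_def marked_iso_def trivial_graph_def)
  then show "\<exists>x. marked_equiv x x" by blast
  show "symp marked_equiv"
    by (rule sympI) (auto simp: marked_equiv_def rooted_graph_def dest: marked_iso_sym)
  show "transp marked_equiv"
    by (rule transpI) (auto simp: marked_equiv_def dest: marked_iso_trans)
qed

quotient_type 'm marked_class = "nat graph \<times> nat \<times> (nat set \<Rightarrow> 'm)" / partial: marked_equiv
  by (rule part_equivp_marked_equiv)

definition marked_conv :: "(nat \<Rightarrow> nat graph \<times> nat \<times> (nat set \<Rightarrow> 'm :: metric_space)) \<Rightarrow>
    nat graph \<times> nat \<times> (nat set \<Rightarrow> 'm) \<Rightarrow> bool" where
  "marked_conv X = (\<lambda>(G, x, a). \<forall>r. \<exists>\<phi>.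
     (\<forall>\<^sub>F n in sequentially. case X n of (Gn, xn, an) \<Rightarrow>
        rooted_iso (\<phi> n) (rooted_ball (G, x) r) (rooted_ball (Gn, xn) r)) \<and>
     (\<lambda>n. case X n of (Gn, xn, an) \<Rightarrow>
        \<Sum>e\<in>edges (gball G {x} r). (dist (an (\<phi> n ` e)) (a e))\<^sup>2) \<longlonglongrightarrow> 0)"

lemma marked_conv_respects:
  assumes X: "\<And>n. marked_equiv (X n) (X' n)" and x: "marked_equiv g g'" and conv: "marked_conv X g"
  shows "marked_conv X' g'"
proof -
  define G x a where "G = fst g" and "x = fst (snd g)" and "a = snd (snd g)"
  define G' x' a' where "G' = fst g'" and "x' = fst (snd g')" and "a' = snd (snd g')"
  define K k c where "K n = fst (X n)" and "k n = fst (snd (X n))" and "c n = snd (snd (X n))" for n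
  define K' k' c' where "K' n = fst (X' n)" and "k' n = fst (snd (X' n))" and "c' n = snd (snd (X' n))"
    for n
  have g: "g = (G, x, a)" "g' = (G', x', a')" "\<And>n. X n = (K n, k n, c n)" "\<And>n. X' n = (K' n, k' n, c' n)"
    by (auto simp: G_def x_def a_def G'_def x'_def a'_def K_def k_def c_def K'_def k'_def c'_def)
  have "\<forall>n. \<exists>\<psi>. marked_iso \<psi> (K n, k n, c n) (K' n, k' n, c' n)"
    using X by (auto simp: marked_equiv_def g)
  then obtain \<psi> where \<psi>: "\<And>n. marked_iso (\<psi> n) (K n, k n, c n) (K' n, k' n, c' n)" by metis
  obtain \<theta> where \<theta>: "marked_iso \<theta> (G', x', a') (G, x, a)"
    using part_equivp_symp[OF part_equivp_marked_equiv x] by (auto simp: marked_equiv_def g)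
  have vG: "rooted_graph G x" "rooted_graph G' x'" "\<And>n. rooted_graph (K n) (k n)"
    using x X by (auto simp: marked_equiv_def g)
  have ball_\<theta>: "rooted_iso \<theta> (rooted_ball (G', x') r) (rooted_ball (G, x) r)" for r
    using \<theta> vG by (intro rooted_ball_iso) (auto simp: marked_iso_def)
  have ball_\<psi>: "rooted_iso (\<psi> n) (rooted_ball (K n, k n) r) (rooted_ball (K' n, k' n) r)" for r n
    using \<psi> vG by (intro rooted_ball_iso) (auto simp: marked_iso_def)
  show ?thesis
    unfolding marked_conv_def g prod.case
  proof
    fix r
    let ?B = "edges (gball G {x} r)" and ?B' = "edges (gball G' {x'} r)"
    obtain \<phi> where
      \<phi>: "\<forall>\<^sub>F n in sequentially. rooted_iso (\<phi> n) (rooted_ball (G, x) r) (rooted_ball (K n, k n) r)"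
      and lim: "(\<lambda>n. \<Sum>e\<in>?B. (dist (c n (\<phi> n ` e)) (a e))\<^sup>2) \<longlonglongrightarrow> 0"
      using conv unfolding marked_conv_def g prod.case by blast
    define \<phi>' where "\<phi>' n = (\<lambda>v. \<psi> n (\<phi> n (\<theta> v)))" for n
    have ev: "\<forall>\<^sub>F n in sequentially. rooted_iso (\<phi>' n) (rooted_ball (G', x') r) (rooted_ball (K' n, k' n) r)"
      using \<phi>
    proof eventually_elim
      case (elim n)
      show ?case
        unfolding \<phi>'_def by (rule rooted_iso_trans[OF rooted_iso_trans[OF ball_\<theta> elim] ball_\<psi>])
    qed
    have iso\<theta>: "graph_iso \<theta> (gball G' {x'} r) (gball G {x} r)"
      using ball_\<theta>[of r] by (simp add: rooted_iso_def rooted_ball_def)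
    have inj: "inj_on (\<lambda>e. \<theta> ` e) ?B'"
      using vG by (intro inj_on_edges_iso[OF iso\<theta>] ugraph_gball) (simp add: rooted_graph_def)
    have B: "?B = (\<lambda>e. \<theta> ` e) ` ?B'"
      using iso\<theta> by (simp add: graph_iso_def)
    have "\<forall>\<^sub>F n in sequentially. (\<Sum>e\<in>?B. (dist (c n (\<phi> n ` e)) (a e))\<^sup>2) =
            (\<Sum>e\<in>?B'. (dist (c' n (\<phi>' n ` e)) (a' e))\<^sup>2)"
      using \<phi>
    proof eventually_elim
      case (elim n)
      have "(dist (c n (\<phi> n ` \<theta> ` e)) (a (\<theta> ` e)))\<^sup>2 = (dist (c' n (\<phi>' n ` e)) (a' e))\<^sup>2"
        if e: "e \<in> ?B'" for e
      proof -
        have "e \<in> edges G'" using e by (simp add: gball_def induced_def)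
        then have 1: "a (\<theta> ` e) = a' e" using \<theta> by (simp add: marked_iso_def)
        have "\<phi> n ` \<theta> ` e \<in> edges (gball (K n) {k n} r)"
          using elim e B by (auto simp: rooted_iso_def rooted_ball_def graph_iso_def)
        then have "\<phi> n ` \<theta> ` e \<in> edges (K n)" by (simp add: gball_def induced_def)
        then have "c' n (\<psi> n ` \<phi> n ` \<theta> ` e) = c n (\<phi> n ` \<theta> ` e)"
          using \<psi>[of n] by (simp add: marked_iso_def)
        moreover have "\<psi> n ` \<phi> n ` \<theta> ` e = \<phi>' n ` e" by (simp add: \<phi>'_def image_image)
        ultimately show ?thesis using 1 by simp
      qed
      then show ?case unfolding B by (simp add: sum.reindex[OF inj])
    qed
    then have "(\<lambda>n. \<Sum>e\<in>?B'. (dist (c' n (\<phi>' n ` e)) (a' e))\<^sup>2) \<longlonglongrightarrow> 0"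
      using lim by (rule Lim_transform_eventually[rotated])
    with ev show "\<exists>\<phi>. (\<forall>\<^sub>F n in sequentially. rooted_iso (\<phi> n) (rooted_ball (G', x') r) (rooted_ball (K' n, k' n) r)) \<and>
        (\<lambda>n. \<Sum>e\<in>?B'. (dist (c' n (\<phi> n ` e)) (a' e))\<^sup>2) \<longlonglongrightarrow> 0"
      by blast
  qed
qed

lift_definition class_conv :: "(nat \<Rightarrow> 'm :: metric_space marked_class) \<Rightarrow> 'm marked_class \<Rightarrow> bool"
  is marked_conv
proof -
  fix X X' :: "nat \<Rightarrow> nat graph \<times> nat \<times> (nat set \<Rightarrow> 'm)" and g g' :: "nat graph \<times> nat \<times> (nat set \<Rightarrow> 'm)"
  assume *: "\<And>n. marked_equiv (X n) (X' n)" "marked_equiv g g'"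
  then have "\<And>n. marked_equiv (X' n) (X n)" "marked_equiv g' g"
    using part_equivp_symp[OF part_equivp_marked_equiv] by metis+
  then show "marked_conv X g = marked_conv X' g'"
    using * marked_conv_respects by metis
qed

text \<open>The topology is prescribed through its convergent sequences. A Polish topology is sequential, so
  the open sets of one with these convergent sequences are exactly the sequentially open ones.\<close>

instantiation marked_class :: (metric_space) topological_space
begin

definition open_marked_class :: "'a marked_class set \<Rightarrow> bool" where
  "open_marked_class U \<longleftrightarrow>
     (\<forall>X x. class_conv X x \<and> x \<in> U \<longrightarrow> (\<forall>\<^sub>F n in sequentially. X n \<in> U))"

instance
proof
  show "open (UNIV :: 'a marked_class set)"
    by (simp add: open_marked_class_def)
next
  fix S T :: "'a marked_class set"
  assume "open S" "open T"
  then show "open (S \<inter> T)"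
    unfolding open_marked_class_def Int_iff eventually_conj_iff by blast
next
  fix K :: "'a marked_class set set"
  assume K: "\<forall>S\<in>K. open S"
  show "open (\<Union>K)"
    unfolding open_marked_class_def
  proof (intro allI impI)
    fix X :: "nat \<Rightarrow> 'a marked_class" and x
    assume "class_conv X x \<and> x \<in> \<Union>K"
    then obtain S where "S \<in> K" "class_conv X x" "x \<in> S" by blast
    then have "\<forall>\<^sub>F n in sequentially. X n \<in> S"
      using K by (auto simp: open_marked_class_def)
    then show "\<forall>\<^sub>F n in sequentially. X n \<in> \<Union>K"
      by eventually_elim (use \<open>S \<in> K\<close> in blast)
  qed
qed

end

definition graph_class :: "nat graph \<Rightarrow> nat \<Rightarrow> rooted_class" where
  "graph_class G x = abs_rooted_class (component G x, x)"

definition marked_graph_class :: "nat graph \<Rightarrow> nat \<Rightarrow> (nat set \<Rightarrow> 'm) \<Rightarrow> 'm marked_class" where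
  "marked_graph_class G x a = abs_marked_class (component G x, x, a)"


section \<open>Random graphs and local weak convergence\<close>

definition graph_space :: "nat graph measure" where
  "graph_space = sigma UNIV
     (range (\<lambda>v. {G. v \<in> verts G}) \<union> range (\<lambda>e. {G. e \<in> edges G}))"

definition converges_in_distribution ::
    "(nat \<Rightarrow> 'a measure) \<Rightarrow> (nat \<Rightarrow> 'a \<Rightarrow> 'c :: topological_space) \<Rightarrow> 'b measure \<Rightarrow> ('b \<Rightarrow> 'c) \<Rightarrow> bool"
  where
  "converges_in_distribution M X N Y \<longleftrightarrow>
     (\<forall>n. X n \<in> borel_measurable (M n)) \<and> Y \<in> borel_measurable N \<and>
     (\<forall>f :: 'c \<Rightarrow> real. continuous_on UNIV f \<and> bounded (range f) \<longrightarrow>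
        (\<lambda>n. \<integral>\<omega>. f (X n \<omega>) \<partial>M n) \<longlonglongrightarrow> (\<integral>\<omega>. f (Y \<omega>) \<partial>N))"

text \<open>Conditional probability of an event given the random variable \<open>X\<close> with values in \<open>N\<close>.\<close>

definition cond_prob_given :: "'a measure \<Rightarrow> 'b measure \<Rightarrow> ('a \<Rightarrow> 'b) \<Rightarrow> ('a \<Rightarrow> bool) \<Rightarrow> 'a \<Rightarrow> real" where
  "cond_prob_given M N X P =
     real_cond_exp M (vimage_algebra (space M) X N) (\<lambda>\<omega>. of_bool (P \<omega>))"

definition uniform_root :: "'a measure \<Rightarrow> ('a \<Rightarrow> nat graph) \<Rightarrow> ('a \<Rightarrow> nat) \<Rightarrow> bool" where
  "uniform_root M G x \<longleftrightarrow>
     (\<forall>v. AE \<omega> in M. cond_prob_given M graph_space G (\<lambda>\<omega>'. x \<omega>' = v) \<omega> =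
            of_bool (v \<in> verts (G \<omega>)) / real (card (verts (G \<omega>))))"

text \<open>Random weights are defined on all sets of vertices, but only their values on the
  edges are constrained (beyond measurability) or matter.\<close>

definition iid_weights ::
    "real measure \<Rightarrow> 'a measure \<Rightarrow> ('a \<Rightarrow> nat graph) \<Rightarrow> ('a \<Rightarrow> nat) \<Rightarrow> ('a \<Rightarrow> nat set \<Rightarrow> real) \<Rightarrow> bool"
  where
  "iid_weights F M G x w \<longleftrightarrow>
     (\<forall>e. (\<lambda>\<omega>. w \<omega> e) \<in> borel_measurable M) \<and>
     (\<forall>S B. finite S \<and> (\<forall>e\<in>S. B e \<in> sets borel) \<longrightarrow>
        (AE \<omega> in M. S \<subseteq> edges (G \<omega>) \<longrightarrow>
           cond_prob_given M (graph_space \<Otimes>\<^sub>M count_space UNIV) (\<lambda>\<omega>. (G \<omega>, x \<omega>))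
             (\<lambda>\<omega>'. \<forall>e\<in>S. w \<omega>' e \<in> B e) \<omega> = (\<Prod>e\<in>S. measure F (B e))))"

end

theory Submission
  imports Defs
begin

text \<open>Every open set \<open>U\<close> of marked classes is a countable union of cylinders determined by a finite
  marked ball. Given \<open>R\<close>, call the ball of radius \<open>R\<close> about the root good if its weights alone force
  the limiting object into \<open>U\<close>: the marks computed inside the ball lie in such a cylinder of radius
  \<open>r \<le> R\<close>, and the matching on the edges of the \<open>r\<close>-ball does not change when any set of vertices on
  the sphere of radius \<open>R\<close> is deleted. Since an optimal matching of a larger graph restricts to the
  optimal matching of the ball minus the vertices matched to the outside, goodness gives membership
  in \<open>U\<close> whatever surrounds the ball. The probability of goodness is a continuous function of the
  rooted graph, so it converges along \<open>G\<^sub>n\<close>, and by correlation decay it tends almost surely to the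
  indicator of \<open>U\<close> in the limit graph as \<open>R \<rightarrow> \<infinity>\<close>. This yields \<open>liminf P(Y\<^sub>n \<in> U) \<ge> P(Y \<in> U)\<close> for
  all open \<open>U\<close>, which is convergence in distribution.\<close>

section \<open>Distances and balls\<close>

text \<open>Correlation decay is assumed for the limit graph only, so the condition transported to
  the finite graphs must be readable from a finite ball and must control every graph around it.
  Hence the sphere instead of the boundary: the boundary depends on the surrounding graph, while the
  sphere is read off the ball and contains every vertex of it with a neighbour outside. A second
  obstacle is tie-breaking, which isomorphisms and restriction to a ball need not respect. Goodness
  therefore includes that all edge sets of the ball have different weights, an event of probability
  one under atomless \<open>F\<close>. The weights are not coordinates of a product space; their law
  is known only through conditional probabilities given graph and root, for fixed finite edge sets.
  Vertices are natural numbers, so there are countably many finite balls, and probabilities are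
  computed by summing over the ball that occurs. Finally, the topology of marked classes is given by
  convergent sequences, not by a metric. The bounds on open sets are therefore pulled back along a
  bounded continuous \<open>f\<close> to half-lines, and the distribution functions of real
  variables are compared.\<close>

lemma gdist_le_iff: "gdist G u v \<le> enat r \<longleftrightarrow> (\<exists>k\<le>r. (u, v) \<in> adj G ^^ k)"
proof
  assume "gdist G u v \<le> enat r"
  then have "gdist G u v < enat (Suc r)" by (simp add: order_le_less_trans)
  then show "\<exists>k\<le>r. (u, v) \<in> adj G ^^ k"
    unfolding gdist_def INF_less_iff by (auto simp: less_Suc_eq_le)
next
  assume "\<exists>k\<le>r. (u, v) \<in> adj G ^^ k"
  then obtain k where k: "k \<le> r" "(u, v) \<in> adj G ^^ k" by blast
  then have "gdist G u v \<le> enat k"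
    unfolding gdist_def by (intro INF_lower) simp
  with k(1) show "gdist G u v \<le> enat r" by (meson enat_ord_simps(1) order_trans)
qed

lemma gdist_finite_iff: "gdist G u v < \<infinity> \<longleftrightarrow> (\<exists>k. (u, v) \<in> adj G ^^ k)"
  unfolding gdist_def INF_less_iff by auto

lemma gdist_finite_le_iff: "gdist G u v < \<infinity> \<longleftrightarrow> (\<exists>k. gdist G u v \<le> enat k)"
  unfolding gdist_finite_iff gdist_le_iff by auto

lemma gdist_le_finite: "gdist G u v \<le> enat r \<Longrightarrow> gdist G u v < \<infinity>"
  unfolding gdist_finite_le_iff by blast

lemma gdist_self_le: "gdist G u u \<le> enat r"
  unfolding gdist_le_iff by (rule exI[of _ 0]) simp

lemma gdist_edge: "{u, v} \<in> edges G \<Longrightarrow> gdist G u v \<le> enat 1"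
  unfolding gdist_le_iff by (rule exI[of _ 1]) (simp add: adj_def)

lemma gdist_mono: "gdist G u v \<le> enat a \<Longrightarrow> a \<le> b \<Longrightarrow> gdist G u v \<le> enat b"
  by (meson enat_ord_simps(1) order_trans)

lemma gdist_triangle:
  assumes "gdist G u v \<le> enat a" "gdist G v z \<le> enat b"
  shows "gdist G u z \<le> enat (a + b)"
proof -
  obtain k l where "k \<le> a" "(u, v) \<in> adj G ^^ k" "l \<le> b" "(v, z) \<in> adj G ^^ l"
    using assms unfolding gdist_le_iff by blast
  then have "(u, z) \<in> adj G ^^ (k + l)" "k + l \<le> a + b" by (auto simp: relpow_add)
  then show ?thesis unfolding gdist_le_iff by blast
qed

lemma gdist_step:
  assumes "gdist G u v \<le> enat a" "{v, z} \<in> edges G"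
  shows "gdist G u z \<le> enat (Suc a)"
  using gdist_triangle[OF assms(1) gdist_edge[OF assms(2)]] by simp

lemma adj_pow_sym: "(u, v) \<in> adj G ^^ k \<Longrightarrow> (v, u) \<in> adj G ^^ k"
proof (induction k arbitrary: v)
  case (Suc k)
  then obtain z where z: "(u, z) \<in> adj G ^^ k" "(z, v) \<in> adj G" by auto
  then have "(v, z) \<in> adj G" by (simp add: adj_def insert_commute)
  with Suc.IH[OF z(1)] show ?case by (rule relpow_Suc_I2[rotated])
qed simp

lemma adj_pow_induced_le: "(u, v) \<in> adj (induced G S) ^^ k \<Longrightarrow> (u, v) \<in> adj G ^^ k"
  by (induction k arbitrary: v) (auto simp: adj_def induced_def)

text \<open>Every prefix of a walk of length at most \<open>r\<close> from \<open>x\<close> is again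
  such a walk, so all vertices on it lie in the ball and hence in \<open>S\<close>.\<close>

lemma adj_pow_induced:
  assumes "{v. gdist G x v \<le> enat r} \<subseteq> S" "k \<le> r" "(x, v) \<in> adj G ^^ k"
  shows "(x, v) \<in> adj (induced G S) ^^ k"
  using assms(2,3)
proof (induction k arbitrary: v)
  case (Suc k)
  then obtain z where z: "(x, z) \<in> adj G ^^ k" "(z, v) \<in> adj G" by auto
  have "gdist G x z \<le> enat r" "gdist G x v \<le> enat r"
    using z(1) Suc.prems unfolding gdist_le_iff by (meson Suc_leD, blast)
  then have "z \<in> S" "v \<in> S" using assms(1) by auto
  with z(2) have "(z, v) \<in> adj (induced G S)" by (simp add: adj_def induced_def)
  with Suc.IH[OF _ z(1)] Suc.prems(1) show ?case by auto
qed auto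

lemma gdist_induced:
  assumes "{v. gdist G x v \<le> enat r} \<subseteq> S" "j \<le> r"
  shows "gdist (induced G S) x v \<le> enat j \<longleftrightarrow> gdist G x v \<le> enat j"
  unfolding gdist_le_iff
  using adj_pow_induced_le adj_pow_induced[OF assms(1)] assms(2) by (meson order_trans)

lemma gball_induced:
  assumes "{v. gdist G x v \<le> enat r} \<subseteq> S"
  shows "gball (induced G S) {x} r = gball G {x} r"
  using assms gdist_induced[OF assms order_refl] by (auto simp: gball_def) (auto simp: induced_def)

lemma gball_gball: "r \<le> R \<Longrightarrow> gball (gball G {x} R) {x} r = gball G {x} r"
  unfolding gball_def[of G _ R] by (rule gball_induced) (auto intro: gdist_mono)

lemma gdist_gball:
  "j \<le> R \<Longrightarrow> gdist (gball G {x} R) x v \<le> enat j \<longleftrightarrow> gdist G x v \<le> enat j"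
  unfolding gball_def by (rule gdist_induced) auto

lemma gball_component: "gball (component G x) {x} r = gball G {x} r"
  unfolding component_def by (rule gball_induced) (blast dest: gdist_le_finite)

section \<open>Membership in balls, finiteness of balls, the component of the root\<close>

lemma verts_gball: "v \<in> verts (gball G S r) \<longleftrightarrow> v \<in> verts G \<and> (\<exists>u\<in>S. gdist G u v \<le> enat r)"
  by (simp add: gball_def induced_def)

lemma edges_gball:
  "e \<in> edges (gball G S r) \<longleftrightarrow> e \<in> edges G \<and> (\<forall>v\<in>e. \<exists>u\<in>S. gdist G u v \<le> enat r)"
  by (auto simp: gball_def induced_def)

lemma ugraph_induced: "ugraph G \<Longrightarrow> ugraph (induced G S)"
  by (fastforce simp: ugraph_def induced_def)

lemma ugraph_delete_verts: "ugraph G \<Longrightarrow> ugraph (delete_verts G A)"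
  by (simp add: delete_verts_def ugraph_induced)

lemma ugraph_edge_verts: "ugraph G \<Longrightarrow> {u, v} \<in> edges G \<Longrightarrow> u \<in> verts G \<and> v \<in> verts G"
  using edge_subset_verts[of G "{u, v}"] by auto

lemma finite_neighbours:
  assumes "ugraph G" "locally_finite G"
  shows "finite {v. {u, v} \<in> edges G}"
proof (cases "u \<in> verts G")
  case False
  then have "{v. {u, v} \<in> edges G} = {}" using ugraph_edge_verts[OF assms(1)] by blast
  then show ?thesis by simp
qed (use assms(2) in \<open>simp add: locally_finite_def\<close>)

lemma finite_adj_pow:
  assumes "ugraph G" "locally_finite G"
  shows "finite {v. (u, v) \<in> adj G ^^ k}"
proof (induction k)
  case (Suc k)
  have "{v. (u, v) \<in> adj G ^^ Suc k} = (\<Union>z\<in>{z. (u, z) \<in> adj G ^^ k}. {v. {z, v} \<in> edges G})"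
    by (auto simp: adj_def)
  then show ?case using Suc finite_neighbours[OF assms] by simp
qed simp

lemma finite_verts_gball:
  assumes "ugraph G" "locally_finite G" "finite S"
  shows "finite (verts (gball G S r))"
proof (rule finite_subset)
  show "verts (gball G S r) \<subseteq> (\<Union>u\<in>S. \<Union>k\<le>r. {v. (u, v) \<in> adj G ^^ k})"
    unfolding subset_iff verts_gball gdist_le_iff by blast
qed (use assms finite_adj_pow in auto)

lemma finite_edges: "ugraph G \<Longrightarrow> finite (verts G) \<Longrightarrow> finite (edges G)"
  by (rule finite_subset[of _ "Pow (verts G)"]) (auto dest: edge_subset_verts)

lemma ugraph_doubleton_cases:
  assumes "ugraph G" "e \<in> edges G"
  obtains u v where "e = {u, v}" "u \<noteq> v" "u \<in> verts G" "v \<in> verts G"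
  using assms by (auto simp: ugraph_def)

lemma finite_edge: "ugraph G \<Longrightarrow> e \<in> edges G \<Longrightarrow> finite e"
  by (auto simp: ugraph_def)

lemma locally_finite_finite:
  assumes "ugraph G" "finite (verts G)"
  shows "locally_finite G"
  unfolding locally_finite_def
proof
  fix u
  have "{v. {u, v} \<in> edges G} \<subseteq> verts G" using ugraph_edge_verts[OF assms(1)] by blast
  then show "finite {v. {u, v} \<in> edges G}" using assms(2) finite_subset by blast
qed

text \<open>Distances from \<open>x\<close> are unchanged in the component, because every ball about
  \<open>x\<close> lies inside it; two other vertices are joined by a walk through
  \<open>x\<close>.\<close>

lemma rooted_graph_component:
  assumes "ugraph G" "locally_finite G" "x \<in> verts G"
  shows "rooted_graph (component G x) x"
proof -
  let ?S = "{v. gdist G x v < \<infinity>}"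
  have fin: "gdist (component G x) x v < \<infinity>" if "v \<in> ?S" for v
  proof -
    have "\<exists>r. gdist G x v \<le> enat r" using that gdist_finite_le_iff[of G x v] by blast
    then obtain r where "gdist G x v \<le> enat r" by blast
    moreover have "gdist (component G x) x v \<le> enat r \<longleftrightarrow> gdist G x v \<le> enat r"
      unfolding component_def by (rule gdist_induced[of _ _ r]) (blast dest: gdist_le_finite, simp)
    ultimately show ?thesis unfolding gdist_finite_le_iff by auto
  qed
  have "gdist (component G x) u v < \<infinity>" if "u \<in> verts (component G x)" "v \<in> verts (component G x)" for u v
  proof -
    from that have "u \<in> ?S" "v \<in> ?S" by (auto simp: component_def induced_def)
    then obtain k l where "(x, u) \<in> adj (component G x) ^^ k" "(x, v) \<in> adj (component G x) ^^ l"
      using fin unfolding gdist_finite_iff by blast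
    then have "(u, v) \<in> adj (component G x) ^^ (k + l)"
      using adj_pow_sym by (fastforce simp: relpow_add)
    then show ?thesis unfolding gdist_finite_iff by blast
  qed
  moreover have "locally_finite (component G x)"
    using assms(2) unfolding locally_finite_def component_def induced_def
    by (auto intro: rev_finite_subset)
  moreover have "x \<in> verts (component G x)"
    using assms(3) gdist_le_finite[OF gdist_self_le[of G x 0]] by (simp add: component_def induced_def)
  ultimately show ?thesis
    using assms(1) by (simp add: rooted_graph_def connected_graph_def component_def ugraph_induced)
qed

section \<open>Maximum weight matchings of finite graphs\<close>

text \<open>Stronger than uniqueness of the optimal matching, and unlike it inherited by subgraphs:
  one condition on the ball serves all graphs obtained from it by deleting vertices.\<close>

definition generic :: "'v graph \<Rightarrow> ('v set \<Rightarrow> real) \<Rightarrow> bool" where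
  "generic H w \<longleftrightarrow> inj_on (sum w) (Pow (edges H))"

text \<open>With \<open>S\<close> the boundary of the ball, this is the event that the supremum in
  \<open>corr_decay_coeff\<close> vanishes. \<open>S\<close> is a parameter because the sphere about
  the root takes its place later.\<close>

definition stable :: "'v graph \<Rightarrow> 'v set \<Rightarrow> 'v set \<Rightarrow> ('v set \<Rightarrow> real) \<Rightarrow> bool" where
  "stable B S e w \<longleftrightarrow> (\<forall>A\<subseteq>S. e \<in> finite_mwm B w \<longleftrightarrow> e \<in> finite_mwm (delete_verts B A) w)"

lemma matching_subset: "matching H M \<Longrightarrow> M \<subseteq> edges H"
  by (simp add: matching_def)

lemma finite_mwm_maximal:
  assumes "finite (edges H)"
  shows "matching H (finite_mwm H w)" "matching H N \<Longrightarrow> sum w N \<le> sum w (finite_mwm H w)"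
proof -
  let ?S = "{M. matching H M}"
  have fin: "finite ?S"
    by (rule finite_subset[of _ "Pow (edges H)"]) (use assms in \<open>auto simp: matching_def\<close>)
  have "{} \<in> ?S" by (simp add: matching_def)
  then have "Max (sum w ` ?S) \<in> sum w ` ?S" using fin by (intro Max_in) auto
  then obtain M where M: "matching H M" "sum w M = Max (sum w ` ?S)" by auto
  have "is_arg_max (sum w) (matching H) M"
    using M fin by (auto simp: is_arg_max_def not_less)
  then have "is_arg_max (sum w) (matching H) (finite_mwm H w)"
    unfolding finite_mwm_def arg_max_def by (rule someI)
  then show "matching H (finite_mwm H w)" "matching H N \<Longrightarrow> sum w N \<le> sum w (finite_mwm H w)"
    by (auto simp: is_arg_max_def not_less)
qed

lemma finite_mwm_eqI:
  assumes "finite (edges H)" "generic H w" "matching H M" "\<And>N. matching H N \<Longrightarrow> sum w N \<le> sum w M"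
  shows "finite_mwm H w = M"
proof -
  note max = finite_mwm_maximal[OF assms(1), where w = w]
  have "sum w (finite_mwm H w) = sum w M"
    using max(2)[OF assms(3)] assms(4)[OF max(1)] by simp
  then show ?thesis
    using assms(2) matching_subset[OF max(1)] matching_subset[OF assms(3)]
    by (auto simp: generic_def inj_on_def)
qed

lemma generic_mono: "generic B w \<Longrightarrow> edges D \<subseteq> edges B \<Longrightarrow> generic D w"
  unfolding generic_def by (rule inj_on_subset) auto

lemma finite_mwm_cong:
  assumes "\<And>e. e \<in> edges H \<Longrightarrow> w e = w' e"
  shows "finite_mwm H w = finite_mwm H w'"
proof -
  have sum: "sum w M = sum w' M" if "matching H M" for M
    using matching_subset[OF that] assms by (intro sum.cong) auto
  have "is_arg_max (sum w) (matching H) = is_arg_max (sum w') (matching H)"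
    by (auto simp: is_arg_max_def sum fun_eq_iff)
  then show ?thesis by (simp add: finite_mwm_def arg_max_def)
qed

lemma generic_cong:
  assumes "\<And>e. e \<in> edges H \<Longrightarrow> w e = w' e"
  shows "generic H w \<longleftrightarrow> generic H w'"
proof -
  have "sum w M = sum w' M" if "M \<in> Pow (edges H)" for M
    using that assms by (intro sum.cong) auto
  then show ?thesis unfolding generic_def by (rule inj_on_cong)
qed

lemma edges_delete_verts_subset: "edges (delete_verts B A) \<subseteq> edges B"
  by (auto simp: delete_verts_def induced_def)

lemma stable_cong:
  assumes "\<And>e. e \<in> edges B \<Longrightarrow> w e = w' e"
  shows "stable B S e w \<longleftrightarrow> stable B S e w'"
  using finite_mwm_cong[of B w w'] finite_mwm_cong[of "delete_verts B _" w w'] assms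
    edges_delete_verts_subset[of B] unfolding stable_def by (metis subsetD)

text \<open>The trace on \<open>W\<close> of the optimal matching of \<open>H\<close> is the optimal matching of what remains of
  \<open>W\<close> once the vertices matched to the outside of \<open>W\<close> are removed, since any better matching of the
  remainder could be exchanged for the trace.\<close>

lemma finite_mwm_local:
  assumes "ugraph H" "finite (edges H)" "B = induced H W" "generic B w"
    and S: "\<And>f v. f \<in> edges H \<Longrightarrow> \<not> f \<subseteq> W \<Longrightarrow> v \<in> f \<Longrightarrow> v \<in> W \<Longrightarrow> v \<in> S"
    and st: "stable B S e w" and e: "e \<in> edges B"
  shows "e \<in> finite_mwm H w \<longleftrightarrow> e \<in> finite_mwm B w"
proof -
  define M where "M = finite_mwm H w"
  define A where "A = {v \<in> W. \<exists>f\<in>M. \<not> f \<subseteq> W \<and> v \<in> f}"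
  define D where "D = delete_verts B A"
  define M1 where "M1 = {f \<in> M. f \<subseteq> W}"
  have M: "matching H M" "\<And>N. matching H N \<Longrightarrow> sum w N \<le> sum w M"
    using finite_mwm_maximal[OF assms(2)] by (auto simp: M_def)
  have "A \<subseteq> S" using S matching_subset[OF M(1)] unfolding A_def by blast
  have edges_D: "f \<in> edges D \<longleftrightarrow> f \<in> edges H \<and> f \<subseteq> W \<and> f \<inter> A = {}" for f
    using edge_subset_verts[OF assms(1), of f]
    by (auto simp: D_def delete_verts_def assms(3) induced_def)
  have fin: "finite M" "finite (edges D)"
    using assms(2) matching_subset[OF M(1)] by (auto intro: finite_subset simp: edges_D)
  have pw: "f \<inter> g = {}" if "f \<in> M" "g \<in> M" "f \<noteq> g" for f g
    using M(1) that by (auto simp: matching_def pairwise_def disjnt_def)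
  have "matching D M1"
    unfolding matching_def
  proof
    show "M1 \<subseteq> edges D"
    proof
      fix f assume f: "f \<in> M1"
      have "v \<notin> A" if v: "v \<in> f" for v
      proof
        assume "v \<in> A"
        then obtain g where "g \<in> M" "\<not> g \<subseteq> W" "v \<in> g" by (auto simp: A_def)
        then show False using pw[of f g] f v by (auto simp: M1_def)
      qed
      then show "f \<in> edges D"
        using f matching_subset[OF M(1)] by (auto simp: edges_D M1_def)
    qed
    show "pairwise disjnt M1" using M(1) by (auto simp: matching_def M1_def pairwise_def)
  qed
  moreover have "sum w N \<le> sum w M1" if N: "matching D N" for N
  proof -
    have "N \<subseteq> edges D" by (rule matching_subset[OF N])
    then have NW: "f \<subseteq> W \<and> f \<inter> A = {} \<and> f \<in> edges H" if "f \<in> N" for f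
      using that edges_D by blast
    \<comment> \<open>Edges of \<open>M - M1\<close> leave \<open>W\<close> and so meet it only in
      \<open>A\<close>, which the edges of \<open>N\<close> avoid.\<close>
    have cross: "f \<inter> g = {}" if "f \<in> N" "g \<in> M - M1" for f g
      using NW[OF that(1)] that(2) by (auto simp: A_def M1_def)
    have "matching H (N \<union> (M - M1))"
      unfolding matching_def
    proof
      show "N \<union> (M - M1) \<subseteq> edges H" using NW matching_subset[OF M(1)] by blast
      show "pairwise disjnt (N \<union> (M - M1))"
        unfolding pairwise_def disjnt_def
      proof (intro ballI impI)
        fix f g assume "f \<in> N \<union> (M - M1)" "g \<in> N \<union> (M - M1)" "f \<noteq> g"
        then consider "f \<in> N" "g \<in> N" | "f \<in> N" "g \<in> M - M1" | "g \<in> N" "f \<in> M - M1" | "f \<in> M" "g \<in> M"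
          by blast
        then show "f \<inter> g = {}"
        proof cases
          case 1
          then show ?thesis using N \<open>f \<noteq> g\<close> by (auto simp: matching_def pairwise_def disjnt_def)
        next
          case 2
          then show ?thesis by (rule cross)
        next
          case 3
          then show ?thesis using cross[of g f] by blast
        next
          case 4
          then show ?thesis using pw \<open>f \<noteq> g\<close> by blast
        qed
      qed
    qed
    then have "sum w (N \<union> (M - M1)) \<le> sum w M" by (rule M(2))
    \<comment> \<open>Disjointness lets the weight of the common part \<open>M - M1\<close> cancel,
      which leaves a comparison of \<open>N\<close> with \<open>M1\<close>.\<close>
    moreover have "N \<inter> (M - M1) = {}" using NW by (auto simp: M1_def)
    moreover have "finite N" using \<open>N \<subseteq> edges D\<close> fin(2) finite_subset by blast
    moreover have "sum w M = sum w M1 + sum w (M - M1)"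
      using fin(1) sum.subset_diff[of M1 M w] by (auto simp: M1_def)
    ultimately show ?thesis using fin(1) by (simp add: sum.union_disjoint)
  qed
  moreover have "generic D w"
    by (rule generic_mono[OF assms(4)]) (simp add: D_def edges_delete_verts_subset)
  ultimately have "finite_mwm D w = M1" by (intro finite_mwm_eqI fin)
  moreover have "e \<subseteq> W" using e by (simp add: assms(3) induced_def)
  ultimately have "e \<in> M \<longleftrightarrow> e \<in> finite_mwm D w" by (simp add: M1_def)
  then show ?thesis using st \<open>A \<subseteq> S\<close> unfolding stable_def M_def D_def by blast
qed

section \<open>Stable balls decide the matching of every larger graph, finite or infinite\<close>

lemma edges_gball_edge: "e \<in> edges G \<Longrightarrow> e \<in> edges (gball G e s)"
  unfolding edges_gball by (blast intro: gdist_self_le)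

lemma subgraph_trans: "subgraph H K \<Longrightarrow> subgraph K G \<Longrightarrow> subgraph H G"
  by (auto simp: subgraph_def)

lemma subgraph_gball: "ugraph G \<Longrightarrow> subgraph (gball G S r) G"
  by (auto simp: subgraph_def ugraph_gball verts_gball edges_gball)

lemma subgraph_induced: "ugraph G \<Longrightarrow> subgraph (induced G S) G"
  by (auto simp: subgraph_def ugraph_induced) (auto simp: induced_def)

definition graph_union :: "'v graph \<Rightarrow> 'v graph \<Rightarrow> 'v graph" where
  "graph_union H K = Graph (verts H \<union> verts K) (edges H \<union> edges K)"

lemma graph_union_sel [simp]:
  "verts (graph_union H K) = verts H \<union> verts K" "edges (graph_union H K) = edges H \<union> edges K"
  by (simp_all add: graph_union_def)

lemma ugraphI:
  assumes "\<And>e. e \<in> edges G \<Longrightarrow> \<exists>u v. u \<in> verts G \<and> v \<in> verts G \<and> u \<noteq> v \<and> e = {u, v}"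
  shows "ugraph G"
  using assms unfolding ugraph_def by meson

lemma ugraph_graph_union: "ugraph H \<Longrightarrow> ugraph K \<Longrightarrow> ugraph (graph_union H K)"
  by (rule ugraphI) (auto elim!: ugraph_doubleton_cases)

lemma subgraph_graph_union:
  assumes "subgraph H G" "subgraph K G"
  shows "subgraph (graph_union H K) G" "subgraph H (graph_union H K)" "subgraph K (graph_union H K)"
  using assms ugraph_graph_union[of H K] by (auto simp: subgraph_def)

text \<open>\<open>H\<close> may miss edges of \<open>G\<close> between its vertices. Since it
  contains the whole ball, the ball is still an induced subgraph of \<open>H\<close>, and an edge of
  \<open>H\<close> leaving the ball meets it in the boundary taken in \<open>G\<close>.\<close>

lemma finite_mwm_gball:
  assumes G: "ugraph G" "locally_finite G" and e: "e \<in> edges G"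
    and gen: "generic (gball G e s) w"
    and st: "stable (gball G e s) (boundary G (gball G e s)) e w"
    and H: "subgraph H G" "finite (verts H)" "subgraph (gball G e s) H"
  shows "e \<in> finite_mwm H w \<longleftrightarrow> e \<in> finite_mwm (gball G e s) w"
proof (rule finite_mwm_local[OF _ _ _ gen _ st])
  let ?B = "gball G e s"
  show "ugraph H" using H(1) by (simp add: subgraph_def)
  then show "finite (edges H)" using H(2) finite_edges by blast
  show "?B = induced H (verts ?B)"
  proof (rule graph.expand, intro conjI)
    show "verts ?B = verts (induced H (verts ?B))"
      using H(3) by (auto simp: subgraph_def induced_def)
    show "edges ?B = edges (induced H (verts ?B))"
    proof (intro equalityI subsetI)
      fix f assume "f \<in> edges ?B"
      then show "f \<in> edges (induced H (verts ?B))"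
        using H(3) edge_subset_verts[of ?B f] ugraph_gball[OF G(1)]
        by (auto simp: subgraph_def induced_def)
    next
      fix f assume "f \<in> edges (induced H (verts ?B))"
      then have "f \<in> edges G" "f \<subseteq> verts ?B" using H(1) by (auto simp: subgraph_def induced_def)
      then show "f \<in> edges ?B" by (auto simp: edges_gball verts_gball)
    qed
  qed
  show "e \<in> edges ?B" by (rule edges_gball_edge[OF e])
  fix f v assume f: "f \<in> edges H" "\<not> f \<subseteq> verts ?B" "v \<in> f" "v \<in> verts ?B"
  then have "f \<in> edges G" using H(1) by (auto simp: subgraph_def)
  moreover obtain u where u: "u \<in> f" "u \<notin> verts ?B" using f(2) by blast
  ultimately have "f = {u, v}" "u \<in> verts G"
    using f(3,4) by (auto elim!: ugraph_doubleton_cases[OF G(1)])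
  then show "v \<in> boundary G ?B"
    using u f(4) \<open>f \<in> edges G\<close> by (auto simp: boundary_def)
qed

text \<open>A countable index set, because vertices are natural numbers. Quantifying over it keeps
  events measurable.\<close>

definition fin_graphs :: "nat graph set" where
  "fin_graphs = {K. ugraph K \<and> finite (verts K)}"

lemma countable_fin_graphs: "countable fin_graphs"
proof (rule countable_subset)
  have "countable {A :: nat set. finite A}" by (rule countable_Collect_finite)
  then show "countable ((\<lambda>(V, E). Graph V E) ` ({A. finite A} \<times> {E. finite E \<and> E \<subseteq> {A :: nat set. finite A}}))"
    by (intro countable_image countable_SIGMA countable_Collect_finite_subset)
  show "fin_graphs \<subseteq> (\<lambda>(V, E). Graph V E) ` ({A. finite A} \<times> {E. finite E \<and> E \<subseteq> {A. finite A}})"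
  proof
    fix K assume "K \<in> fin_graphs"
    then have "K = (\<lambda>(V, E). Graph V E) (verts K, edges K)"
      "(verts K, edges K) \<in> {A. finite A} \<times> {E. finite E \<and> E \<subseteq> {A. finite A}}"
      using finite_edges finite_edge by (auto simp: fin_graphs_def)
    then show "K \<in> (\<lambda>(V, E). Graph V E) ` ({A. finite A} \<times> {E. finite E \<and> E \<subseteq> {A. finite A}})"
      by (rule image_eqI)
  qed
qed

text \<open>Each of the finitely many vertices and edges of \<open>K\<close> enters the increasing
  sequence at some stage and stays.\<close>

lemma exhaustion_eventually:
  assumes "exhaustion H G" "subgraph K G" "finite (verts K)"
  shows "\<forall>\<^sub>F n in sequentially. subgraph K (H n)"
proof -
  have mono: "subgraph (H m) (H n)" if "m \<le> n" for m n
    using that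
  proof (induction n rule: dec_induct)
    case base
    then show ?case using assms(1) by (auto simp: exhaustion_def subgraph_def)
  next
    case (step n)
    then show ?case using assms(1) subgraph_trans by (auto simp: exhaustion_def)
  qed
  have v: "\<forall>\<^sub>F n in sequentially. v \<in> verts (H n)" if v: "v \<in> verts K" for v
  proof -
    have "v \<in> (\<Union>n. verts (H n))" using v assms(1,2) by (auto simp: exhaustion_def subgraph_def)
    then obtain m where "v \<in> verts (H m)" by blast
    then show ?thesis
      using mono unfolding eventually_sequentially subgraph_def by blast
  qed
  have e: "\<forall>\<^sub>F n in sequentially. e \<in> edges (H n)" if e: "e \<in> edges K" for e
  proof -
    have "e \<in> (\<Union>n. edges (H n))" using e assms(1,2) by (auto simp: exhaustion_def subgraph_def)
    then obtain m where "e \<in> edges (H m)" by blast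
    then show ?thesis
      using mono unfolding eventually_sequentially subgraph_def by blast
  qed
  have "ugraph K" using assms(2) by (simp add: subgraph_def)
  have "\<forall>\<^sub>F n in sequentially. \<forall>v\<in>verts K. v \<in> verts (H n)"
    using v assms(3) by (simp add: eventually_ball_finite)
  moreover have "\<forall>\<^sub>F n in sequentially. \<forall>e\<in>edges K. e \<in> edges (H n)"
    using e finite_edges[OF \<open>ugraph K\<close> assms(3)] by (simp add: eventually_ball_finite)
  ultimately show ?thesis
    by eventually_elim (use \<open>ugraph K\<close> in \<open>auto simp: subgraph_def\<close>)
qed

text \<open>If every finite subgraph can be enlarged to a finite one whose optimal matching avoids \<open>e\<close>,
  then these enlargements can be chained into an exhaustion along which the indicator stays \<open>0\<close>.
  This replaces the uncountable quantification over exhaustions by countable ones.\<close>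

lemma mwm_infinite_iff:
  assumes G: "ugraph G" and inf: "infinite (verts G)"
  shows "e \<in> mwm G w \<longleftrightarrow> e \<in> edges G \<and> (\<exists>K\<in>fin_graphs. subgraph K G \<and>
    (\<forall>H\<in>fin_graphs. subgraph H G \<and> subgraph K H \<longrightarrow> e \<in> finite_mwm H w))"
proof (intro iffI conjI)
  assume L: "e \<in> mwm G w"
  then show "e \<in> edges G" using inf by (simp add: mwm_def)
  show "\<exists>K\<in>fin_graphs. subgraph K G \<and>
    (\<forall>H\<in>fin_graphs. subgraph H G \<and> subgraph K H \<longrightarrow> e \<in> finite_mwm H w)"
  proof (rule ccontr)
    assume "\<not> ?thesis"
    \<comment> \<open>The premise on \<open>K\<close> stands inside the existential so that the
      choice function \<open>bad\<close> is total.\<close>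
    then have "\<forall>K. \<exists>H. K \<in> fin_graphs \<and> subgraph K G \<longrightarrow>
        H \<in> fin_graphs \<and> subgraph H G \<and> subgraph K H \<and> e \<notin> finite_mwm H w" by blast
    then obtain bad where bad: "\<And>K. K \<in> fin_graphs \<Longrightarrow> subgraph K G \<Longrightarrow>
        bad K \<in> fin_graphs \<and> subgraph (bad K) G \<and> subgraph K (bad K) \<and> e \<notin> finite_mwm (bad K) w"
      by metis
    \<comment> \<open>The subgraphs on initial segments of the natural numbers exhaust
      \<open>G\<close>: a vertex \<open>v\<close> appears in \<open>T v\<close> and an edge
      \<open>f\<close> in \<open>T (Max f)\<close>. Uniting with them forces the chain of bad
      enlargements to cover \<open>G\<close>.\<close>
    define T where "T n = induced G {..n}" for n :: nat
    have T: "T n \<in> fin_graphs" "subgraph (T n) G" for n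
      using G by (auto simp: T_def fin_graphs_def ugraph_induced subgraph_induced) (simp add: induced_def)
    define H where "H = rec_nat (bad (T 0)) (\<lambda>n K. bad (graph_union K (T (Suc n))))"
    have H0: "H 0 = bad (T 0)" and HS: "H (Suc n) = bad (graph_union (H n) (T (Suc n)))" for n
      by (simp_all add: H_def)
    have H: "H n \<in> fin_graphs \<and> subgraph (H n) G \<and> subgraph (T n) (H n) \<and> e \<notin> finite_mwm (H n) w" for n
    proof (induction n)
      case 0
      then show ?case using bad[OF T[of 0]] by (simp add: H0)
    next
      case (Suc n)
      let ?K = "graph_union (H n) (T (Suc n))"
      have "?K \<in> fin_graphs" "subgraph ?K G" "subgraph (T (Suc n)) ?K"
        using Suc T[of "Suc n"] subgraph_graph_union[of "H n" G "T (Suc n)"]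
        by (auto simp: fin_graphs_def ugraph_graph_union)
      then show ?case using bad[of ?K] subgraph_trans[of "T (Suc n)" ?K "bad ?K"] by (simp add: HS)
    qed
    have HSuc: "subgraph (H n) (H (Suc n))" for n
    proof -
      let ?K = "graph_union (H n) (T (Suc n))"
      have "?K \<in> fin_graphs" "subgraph ?K G" "subgraph (H n) ?K"
        using H[of n] T[of "Suc n"] subgraph_graph_union[of "H n" G "T (Suc n)"]
        by (auto simp: fin_graphs_def ugraph_graph_union)
      then show ?thesis using bad[of ?K] subgraph_trans[of "H n" ?K "bad ?K"] by (simp add: HS)
    qed
    have "exhaustion H G"
      unfolding exhaustion_def
    proof (intro conjI allI)
      show "finite (verts (H n))" "subgraph (H n) G" "subgraph (H n) (H (Suc n))" for n
        using H[of n] HSuc by (auto simp: fin_graphs_def)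
      have "v \<in> verts (H v)" if "v \<in> verts G" for v
        using H[of v] that by (auto simp: subgraph_def T_def induced_def)
      then show "(\<Union>n. verts (H n)) = verts G"
        using H by (fastforce simp: subgraph_def)
      have "f \<in> edges (H (Max f))" if f: "f \<in> edges G" for f
      proof -
        have "f \<subseteq> {..Max f}" using finite_edge[OF G f] by auto
        then show ?thesis using H[of "Max f"] f by (auto simp: subgraph_def T_def induced_def)
      qed
      then show "(\<Union>n. edges (H n)) = edges G"
        using H by (fastforce simp: subgraph_def)
    qed
    then have "(\<lambda>n. of_bool (e \<in> finite_mwm (H n) w) :: real) \<longlonglongrightarrow> 1"
      using L inf by (simp add: mwm_def)
    then show False using H by (simp add: LIMSEQ_const_iff)
  qed
next
  assume R: "e \<in> edges G \<and> (\<exists>K\<in>fin_graphs. subgraph K G \<and>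
    (\<forall>H\<in>fin_graphs. subgraph H G \<and> subgraph K H \<longrightarrow> e \<in> finite_mwm H w))"
  then obtain K where K: "K \<in> fin_graphs" "subgraph K G"
    "\<And>H. H \<in> fin_graphs \<Longrightarrow> subgraph H G \<Longrightarrow> subgraph K H \<Longrightarrow> e \<in> finite_mwm H w" by blast
  have "(\<lambda>n. of_bool (e \<in> finite_mwm (H n) w) :: real) \<longlonglongrightarrow> 1" if H: "exhaustion H G" for H
  proof (rule tendsto_eventually)
    have "\<forall>\<^sub>F n in sequentially. subgraph K (H n)"
      using exhaustion_eventually[OF H K(2)] K(1) by (simp add: fin_graphs_def)
    then show "\<forall>\<^sub>F n in sequentially. (of_bool (e \<in> finite_mwm (H n) w) :: real) = 1"
    proof eventually_elim
      case (elim n)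
      have "H n \<in> fin_graphs" "subgraph (H n) G"
        using H by (auto simp: exhaustion_def fin_graphs_def subgraph_def)
      then show ?case using K(3) elim by simp
    qed
  qed
  then show "e \<in> mwm G w" using R inf by (simp add: mwm_def)
qed

lemma mwm_gball:
  fixes G :: "nat graph"
  assumes G: "ugraph G" "locally_finite G" and e: "e \<in> edges G"
    and gen: "generic (gball G e s) w"
    and st: "stable (gball G e s) (boundary G (gball G e s)) e w"
  shows "e \<in> mwm G w \<longleftrightarrow> e \<in> finite_mwm (gball G e s) w"
proof -
  let ?B = "gball G e s"
  note local = finite_mwm_gball[OF assms]
  have B: "subgraph ?B G" "?B \<in> fin_graphs"
    using G finite_verts_gball[OF G finite_edge[OF G(1) e]]
    by (auto simp: subgraph_gball fin_graphs_def ugraph_gball)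
  show ?thesis
  proof (cases "finite (verts G)")
    case True
    moreover have "subgraph G G" using G by (simp add: subgraph_def)
    ultimately show ?thesis using local[of G] B by (simp add: mwm_def)
  next
    case False
    show ?thesis
    proof
      assume "e \<in> mwm G w"
      then obtain K where K: "K \<in> fin_graphs" "subgraph K G"
        "\<And>H. H \<in> fin_graphs \<Longrightarrow> subgraph H G \<Longrightarrow> subgraph K H \<Longrightarrow> e \<in> finite_mwm H w"
        unfolding mwm_infinite_iff[OF G(1) False] by blast
      \<comment> \<open>The witness \<open>K\<close> need not contain the ball. The union contains
        both, so there the matching is described by \<open>K\<close> and by the ball at
        once.\<close>
      note u = subgraph_graph_union[OF K(2) B(1)]
      have fin: "graph_union K ?B \<in> fin_graphs"
        using K(1) B(2) by (auto simp: fin_graphs_def ugraph_graph_union)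
      then have "e \<in> finite_mwm (graph_union K ?B) w" by (intro K(3) u)
      then show "e \<in> finite_mwm ?B w"
        using local[OF u(1) _ u(3)] fin by (simp add: fin_graphs_def)
    next
      assume "e \<in> finite_mwm ?B w"
      then have "\<forall>H\<in>fin_graphs. subgraph H G \<and> subgraph ?B H \<longrightarrow> e \<in> finite_mwm H w"
        using local by (auto simp: fin_graphs_def)
      then show "e \<in> mwm G w"
        unfolding mwm_infinite_iff[OF G(1) False] using B e by blast
    qed
  qed
qed

section \<open>Invariance under isomorphisms\<close>

text \<open>The choice among several optimal matchings need not commute with \<open>\<phi>\<close>.
  Genericity passes to \<open>H'\<close> first; then the image of the optimum, being optimal in
  \<open>H'\<close>, is the only candidate.\<close>

lemma finite_mwm_iso:
  assumes iso: "graph_iso \<phi> H H'" and H: "ugraph H" "finite (verts H)" and gen: "generic H w"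
    and w: "\<And>e. e \<in> edges H \<Longrightarrow> w' (\<phi> ` e) = w e"
  shows "generic H' w'" "finite_mwm H' w' = (\<lambda>e. \<phi> ` e) ` finite_mwm H w"
proof -
  let ?\<Phi> = "\<lambda>e. \<phi> ` e"
  have inj: "inj_on ?\<Phi> (edges H)" by (rule inj_on_edges_iso[OF iso H(1)])
  have E: "edges H' = ?\<Phi> ` edges H" and inj\<phi>: "inj_on \<phi> (verts H)"
    using iso by (auto simp: graph_iso_def bij_betw_def)
  have fin: "finite (edges H)" by (rule finite_edges[OF H])
  have sum: "sum w' (?\<Phi> ` S) = sum w S" if S: "S \<subseteq> edges H" for S
  proof -
    have "sum w' (?\<Phi> ` S) = (\<Sum>e\<in>S. w' (\<phi> ` e))"
      using inj_on_subset[OF inj S] by (subst sum.reindex) auto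
    also have "\<dots> = sum w S" using S w by (intro sum.cong) auto
    finally show ?thesis .
  qed
  show gen': "generic H' w'"
    unfolding generic_def
  proof (rule inj_onI)
    fix S' T' assume "S' \<in> Pow (edges H')" "T' \<in> Pow (edges H')" and eq: "sum w' S' = sum w' T'"
    then obtain S T where ST: "S \<subseteq> edges H" "S' = ?\<Phi> ` S" "T \<subseteq> edges H" "T' = ?\<Phi> ` T"
      unfolding E by (auto elim!: subset_imageE)
    then have "S = T" using gen eq by (auto simp: sum generic_def inj_on_def)
    then show "S' = T'" by (simp add: ST)
  qed
  have disj: "disjnt (\<phi> ` f) (\<phi> ` g) \<longleftrightarrow> disjnt f g" if "f \<in> edges H" "g \<in> edges H" for f g
    using inj_on_image_Int[OF inj\<phi>, of f g] edge_subset_verts[OF H(1)] that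
    by (auto simp: disjnt_def)
  have match: "matching H' (?\<Phi> ` N) \<longleftrightarrow> matching H N" if N: "N \<subseteq> edges H" for N
  proof -
    have "pairwise disjnt (?\<Phi> ` N) \<longleftrightarrow> pairwise (\<lambda>f g. disjnt (\<phi> ` f) (\<phi> ` g)) N"
      using inj_on_eq_iff[OF inj_on_subset[OF inj N]] unfolding pairwise_image by (simp add: pairwise_def)
    also have "\<dots> \<longleftrightarrow> pairwise disjnt N"
      using disj N unfolding pairwise_def by blast
    finally show ?thesis using N by (auto simp: matching_def E)
  qed
  note max = finite_mwm_maximal[OF fin, where w = w]
  have sub: "finite_mwm H w \<subseteq> edges H" by (rule matching_subset[OF max(1)])
  show "finite_mwm H' w' = ?\<Phi> ` finite_mwm H w"
  proof (rule finite_mwm_eqI[OF _ gen'])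
    show "finite (edges H')" using fin by (simp add: E)
    show "matching H' (?\<Phi> ` finite_mwm H w)" using match[OF sub] max(1) by simp
    fix N' assume N': "matching H' N'"
    then obtain N where N: "N \<subseteq> edges H" "N' = ?\<Phi> ` N"
      using matching_subset[OF N'] unfolding E by (auto elim!: subset_imageE)
    then show "sum w' N' \<le> sum w' (?\<Phi> ` finite_mwm H w)"
      using max(2)[of N] match[OF N(1)] N' by (simp add: sum sub)
  qed
qed

lemma mem_finite_mwm_iso:
  assumes iso: "graph_iso \<phi> H H'" and H: "ugraph H" "finite (verts H)" and gen: "generic H w"
    and w: "\<And>e. e \<in> edges H \<Longrightarrow> w' (\<phi> ` e) = w e" and e: "e \<subseteq> verts H"
  shows "\<phi> ` e \<in> finite_mwm H' w' \<longleftrightarrow> e \<in> finite_mwm H w"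
proof -
  have sub: "finite_mwm H w \<subseteq> edges H"
    using finite_mwm_maximal(1)[OF finite_edges[OF H]] by (rule matching_subset)
  have "f = e" if "\<phi> ` f = \<phi> ` e" "f \<in> edges H" for f
    using that e iso edge_subset_verts[OF H(1)] inj_on_image_eq_iff[of \<phi> "verts H" f e]
    by (auto simp: graph_iso_def bij_betw_def)
  then show ?thesis using sub by (auto simp: finite_mwm_iso(2)[OF assms(1-5)])
qed

lemma induced_iso:
  assumes "graph_iso \<phi> H H'" "ugraph H" "S \<subseteq> verts H"
  shows "graph_iso \<phi> (induced H S) (induced H' (\<phi> ` S))"
proof -
  have inj: "inj_on \<phi> (verts H)" and V: "verts H' = \<phi> ` verts H" and E: "edges H' = (\<lambda>e. \<phi> ` e) ` edges H"
    using assms(1) by (auto simp: graph_iso_def bij_betw_def)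
  have "\<phi> ` e \<subseteq> \<phi> ` S \<longleftrightarrow> e \<subseteq> S" if "e \<in> edges H" for e
    using inj_on_image_subset_iff[OF inj edge_subset_verts[OF assms(2) that] assms(3)] .
  then have "edges (induced H' (\<phi> ` S)) = (\<lambda>e. \<phi> ` e) ` edges (induced H S)"
    by (auto simp: induced_def E)
  moreover have "bij_betw \<phi> (verts (induced H S)) (verts (induced H' (\<phi> ` S)))"
    using inj assms(3) inj_on_subset[OF inj, of "verts H \<inter> S"] by (auto simp: bij_betw_def induced_def V)
  ultimately show ?thesis by (simp add: graph_iso_def)
qed

lemma delete_verts_iso:
  assumes "graph_iso \<phi> H H'" "ugraph H" "A \<subseteq> verts H"
  shows "graph_iso \<phi> (delete_verts H A) (delete_verts H' (\<phi> ` A))"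
proof -
  have "verts H' - \<phi> ` A = \<phi> ` (verts H - A)"
    using assms(1,3) inj_on_image_set_diff[of \<phi> "verts H" "verts H" A]
    by (auto simp: graph_iso_def bij_betw_def)
  then show ?thesis
    unfolding delete_verts_def using induced_iso[OF assms(1,2), of "verts H - A"] by simp
qed

lemma stable_iso:
  assumes iso: "graph_iso \<phi> H H'" and H: "ugraph H" "finite (verts H)" and gen: "generic H w"
    and w: "\<And>e. e \<in> edges H \<Longrightarrow> w' (\<phi> ` e) = w e"
    and st: "stable H S e w" and e: "e \<in> edges H" and S: "S \<subseteq> verts H"
  shows "stable H' (\<phi> ` S) (\<phi> ` e) w'"
  unfolding stable_def
proof (intro allI impI)
  fix A' assume "A' \<subseteq> \<phi> ` S"
  then obtain A where A: "A \<subseteq> S" "A' = \<phi> ` A" by (auto elim!: subset_imageE)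
  have ev: "e \<subseteq> verts H" by (rule edge_subset_verts[OF H(1) e])
  let ?D = "delete_verts H A"
  have sub: "edges ?D \<subseteq> edges H" "verts ?D \<subseteq> verts H"
    by (auto simp: delete_verts_def induced_def)
  have 1: "\<phi> ` e \<in> finite_mwm H' w' \<longleftrightarrow> e \<in> finite_mwm H w"
    by (rule mem_finite_mwm_iso[OF iso H gen w ev])
  have iso': "graph_iso \<phi> ?D (delete_verts H' A')"
    unfolding A(2) using A S by (intro delete_verts_iso[OF iso H(1)]) auto
  have D: "ugraph ?D" "finite (verts ?D)" "generic ?D w"
    using H sub finite_subset ugraph_delete_verts generic_mono[OF gen] by blast+
  have 2: "\<phi> ` e \<in> finite_mwm (delete_verts H' A') w' \<longleftrightarrow> e \<in> finite_mwm ?D w"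
  proof (cases "e \<subseteq> verts ?D")
    case True
    then show ?thesis using sub by (intro mem_finite_mwm_iso[OF iso' D w]) auto
  next
    case False
    have eq: "finite_mwm (delete_verts H' A') w' = (\<lambda>e. \<phi> ` e) ` finite_mwm ?D w"
      using sub by (intro finite_mwm_iso(2)[OF iso' D w]) auto
    have "finite_mwm ?D w \<subseteq> edges ?D"
      using finite_mwm_maximal(1)[OF finite_edges[OF D(1,2)]] by (rule matching_subset)
    then have "e \<notin> finite_mwm ?D w" using False edge_subset_verts[OF D(1)] by blast
    moreover have "\<phi> ` e \<notin> finite_mwm (delete_verts H' A') w'"
    proof
      assume "\<phi> ` e \<in> finite_mwm (delete_verts H' A') w'"
      then obtain f where f: "f \<in> finite_mwm ?D w" "\<phi> ` f = \<phi> ` e"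
        using eq by auto
      then have "f \<in> edges H" using \<open>finite_mwm ?D w \<subseteq> edges ?D\<close> sub by blast
      \<comment> \<open>Here \<open>e\<close> has lost an endpoint and is no edge of
        \<open>?D\<close>, so injectivity is taken from the edges of the whole graph
        \<open>H\<close>.\<close>
      then have "f = e"
        using f(2) e inj_on_edges_iso[OF iso H(1)] by (auto simp: inj_on_def)
      with f \<open>e \<notin> finite_mwm ?D w\<close> show False by simp
    qed
    ultimately show ?thesis by simp
  qed
  show "\<phi> ` e \<in> finite_mwm H' w' \<longleftrightarrow> \<phi> ` e \<in> finite_mwm (delete_verts H' A') w'"
    using st A(1) unfolding 1 2 stable_def by blast
qed

section \<open>Cylinder neighbourhoods\<close>

lemma rooted_ball_le:
  assumes "rooted_iso \<phi> (rooted_ball (G, x) n) (rooted_ball (H, y) n)" "r \<le> n" "ugraph G" "x \<in> verts G"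
  shows "rooted_iso \<phi> (rooted_ball (G, x) r) (rooted_ball (H, y) r)"
proof -
  have iso: "graph_iso \<phi> (gball G {x} n) (gball H {y} n)" "\<phi> x = y"
    using assms(1) by (auto simp: rooted_iso_def rooted_ball_def)
  have "x \<in> verts (gball G {x} n)" using assms(4) gdist_self_le by (auto simp: verts_gball)
  from gball_iso[OF iso(1) ugraph_gball[OF assms(3)] this, of r] show ?thesis
    using assms(2) iso(2) by (simp add: rooted_iso_def rooted_ball_def gball_gball)
qed

lemma marked_equiv_refl: "rooted_graph G x \<Longrightarrow> marked_equiv (G, x, a) (G, x, a)"
  using rooted_iso_refl by (fastforce simp: marked_equiv_def marked_iso_def)

text \<open>The lifted \<open>class_conv\<close> inspects chosen representatives, which are only
  equivalent to the given ones.\<close>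

lemma class_conv_abs:
  assumes "\<And>n. rooted_graph (Gs n) (xs n)" "rooted_graph G x"
    and "marked_conv (\<lambda>n. (Gs n, xs n, as n)) (G, x, a)"
  shows "class_conv (\<lambda>n. abs_marked_class (Gs n, xs n, as n)) (abs_marked_class (G, x, a))"
proof -
  have rep: "marked_equiv (H, y, c) (rep_marked_class (abs_marked_class (H, y, c)))"
    if "rooted_graph H y" for H y and c :: "nat set \<Rightarrow> 'a"
    by (rule part_equivp_symp[OF part_equivp_marked_equiv])
      (rule Quotient3_rep_abs[OF Quotient3_marked_class marked_equiv_refl[OF that]])
  show ?thesis
    unfolding class_conv_def
    using marked_conv_respects[OF rep[OF assms(1)] rep[OF assms(2)] assms(3)]
    by (simp add: map_fun_def comp_def)
qed

text \<open>Depends on the graph and its marks only through the \<open>r\<close>-ball about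
  \<open>x\<close>, so it can be evaluated inside any finite ball of radius at least
  \<open>r\<close>.\<close>

definition cylinder_in ::
    "'m :: metric_space marked_class set \<Rightarrow> nat \<Rightarrow> real \<Rightarrow> nat graph \<Rightarrow> nat \<Rightarrow> (nat set \<Rightarrow> 'm) \<Rightarrow> bool"
  where
  "cylinder_in U r \<epsilon> G x a \<longleftrightarrow> (\<forall>H y b \<phi>. rooted_graph H y \<longrightarrow>
     rooted_iso \<phi> (rooted_ball (G, x) r) (rooted_ball (H, y) r) \<longrightarrow>
     (\<forall>e\<in>edges (gball G {x} r). dist (b (\<phi> ` e)) (a e) < \<epsilon>) \<longrightarrow> abs_marked_class (H, y, b) \<in> U)"

lemma cylinder_in_cong:
  assumes "gball G {x} r = gball G' {x} r" "\<And>e. e \<in> edges (gball G {x} r) \<Longrightarrow> a e = a' e"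
  shows "cylinder_in U r \<epsilon> G x a \<longleftrightarrow> cylinder_in U r \<epsilon> G' x a'"
  unfolding cylinder_in_def rooted_ball_def using assms by simp

lemma cylinder_in_mem:
  assumes "cylinder_in U r \<epsilon> G x a" "rooted_graph G x" "0 < \<epsilon>"
  shows "abs_marked_class (G, x, a) \<in> U"
  using assms(1)[unfolded cylinder_in_def, rule_format, OF assms(2) rooted_iso_refl] assms(3) by simp

text \<open>The triangle inequality: moving the marks costs part of the tolerance. This serves to
  replace real marks by rational ones and back.\<close>

lemma cylinder_in_perturb:
  assumes "cylinder_in U r \<epsilon> G x a" "\<And>e. e \<in> edges (gball G {x} r) \<Longrightarrow> dist (a' e) (a e) \<le> \<epsilon> - \<delta>"
  shows "cylinder_in U r \<delta> G x a'"
  unfolding cylinder_in_def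
proof (intro allI impI)
  fix H y b \<phi>
  assume *: "rooted_graph H y" "rooted_iso \<phi> (rooted_ball (G, x) r) (rooted_ball (H, y) r)"
    "\<forall>e\<in>edges (gball G {x} r). dist (b (\<phi> ` e)) (a' e) < \<delta>"
  have "dist (b (\<phi> ` e)) (a e) < \<epsilon>" if "e \<in> edges (gball G {x} r)" for e
    using dist_triangle[of "b (\<phi> ` e)" "a e" "a' e"] assms(2)[OF that] *(3) that by fastforce
  then show "abs_marked_class (H, y, b) \<in> U"
    using assms(1) * unfolding cylinder_in_def by blast
qed

lemma cylinder_in_iso:
  assumes iso: "graph_iso \<phi> G H" and G: "ugraph G" "x \<in> verts G"
    and b: "\<And>e. e \<in> edges G \<Longrightarrow> b (\<phi> ` e) = a e" and cyl: "cylinder_in U r \<epsilon> G x a"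
  shows "cylinder_in U r \<epsilon> H (\<phi> x) b"
  unfolding cylinder_in_def
proof (intro allI impI)
  fix K z c \<psi>
  assume *: "rooted_graph K z" "rooted_iso \<psi> (rooted_ball (H, \<phi> x) r) (rooted_ball (K, z) r)"
    "\<forall>e\<in>edges (gball H {\<phi> x} r). dist (c (\<psi> ` e)) (b e) < \<epsilon>"
  have ball: "graph_iso \<phi> (gball G {x} r) (gball H {\<phi> x} r)" by (rule gball_iso[OF iso G])
  then have "rooted_iso \<phi> (rooted_ball (G, x) r) (rooted_ball (H, \<phi> x) r)"
    by (simp add: rooted_iso_def rooted_ball_def)
  then have "rooted_iso (\<lambda>v. \<psi> (\<phi> v)) (rooted_ball (G, x) r) (rooted_ball (K, z) r)"
    using *(2) by (rule rooted_iso_trans)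
  moreover have "dist (c ((\<lambda>v. \<psi> (\<phi> v)) ` e)) (a e) < \<epsilon>" if e: "e \<in> edges (gball G {x} r)" for e
  proof -
    have "\<phi> ` e \<in> edges (gball H {\<phi> x} r)" using ball e by (auto simp: graph_iso_def)
    then have "dist (c (\<psi> ` \<phi> ` e)) (b (\<phi> ` e)) < \<epsilon>" using *(3) by blast
    then show ?thesis using b e by (simp add: image_image edges_gball)
  qed
  ultimately show "abs_marked_class (K, z, c) \<in> U"
    using cyl *(1) unfolding cylinder_in_def by blast
qed

text \<open>If no cylinder about a point of the sequentially open set \<open>U\<close> were contained in \<open>U\<close>, then points
  outside \<open>U\<close> chosen from shrinking cylinders would converge to a point of \<open>U\<close>.\<close>

lemma cylinder_in_ex:
  assumes U: "open U" and G: "rooted_graph G x" and mem: "abs_marked_class (G, x, a) \<in> U"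
  shows "\<exists>r k. cylinder_in U r (1 / real (Suc k)) G x a"
proof (rule ccontr)
  assume "\<not> ?thesis"
  then have "\<forall>n. \<exists>H y b \<phi>. rooted_graph H y \<and> rooted_iso \<phi> (rooted_ball (G, x) n) (rooted_ball (H, y) n) \<and>
     (\<forall>e\<in>edges (gball G {x} n). dist (b (\<phi> ` e)) (a e) < 1 / real (Suc n)) \<and> abs_marked_class (H, y, b) \<notin> U"
    unfolding cylinder_in_def by blast
  then obtain H y b \<phi> where H: "\<And>n. rooted_graph (H n) (y n)"
    and \<phi>: "\<And>n. rooted_iso (\<phi> n) (rooted_ball (G, x) n) (rooted_ball (H n, y n) n)"
    and d: "\<And>n e. e \<in> edges (gball G {x} n) \<Longrightarrow> dist (b n (\<phi> n ` e)) (a e) < 1 / real (Suc n)"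
    and out: "\<And>n. abs_marked_class (H n, y n, b n) \<notin> U"
    by metis
  have uG: "ugraph G" "x \<in> verts G" "locally_finite G" using G by (auto simp: rooted_graph_def)
  have "marked_conv (\<lambda>n. (H n, y n, b n)) (G, x, a)"
    unfolding marked_conv_def prod.case
  proof (intro allI exI conjI)
    fix r
    let ?E = "edges (gball G {x} r)"
    show "\<forall>\<^sub>F n in sequentially. rooted_iso (\<phi> n) (rooted_ball (G, x) r) (rooted_ball (H n, y n) r)"
      \<comment> \<open>An isomorphism of \<open>n\<close>-balls restricts to \<open>r\<close>-balls
        once \<open>n\<close> is at least \<open>r\<close>.\<close>
      using eventually_ge_at_top[of r] by eventually_elim (rule rooted_ball_le[OF \<phi> _ uG(1,2)])
    show "(\<lambda>n. \<Sum>e\<in>?E. (dist (b n (\<phi> n ` e)) (a e))\<^sup>2) \<longlonglongrightarrow> 0"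
    proof (rule tendsto_null_sum)
      fix e assume e: "e \<in> ?E"
      have "(\<lambda>n. dist (b n (\<phi> n ` e)) (a e)) \<longlonglongrightarrow> 0"
      proof (rule real_tendsto_sandwich[OF _ _ tendsto_const])
        show "(\<lambda>n. 1 / real (Suc n)) \<longlonglongrightarrow> 0" by (rule LIMSEQ_Suc[OF lim_1_over_n])
        show "\<forall>\<^sub>F n in sequentially. dist (b n (\<phi> n ` e)) (a e) \<le> 1 / real (Suc n)"
          using eventually_ge_at_top[of r]
        proof eventually_elim
          case (elim n)
          have "e \<in> edges (gball G {x} n)"
            using e elim by (auto simp: edges_gball intro: gdist_mono)
          then show ?case using d by (simp add: less_imp_le)
        qed
      qed simp
      then show "(\<lambda>n. (dist (b n (\<phi> n ` e)) (a e))\<^sup>2) \<longlonglongrightarrow> 0"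
        using tendsto_power[of _ 0 _ 2] by fastforce
    qed
  qed
  then have "class_conv (\<lambda>n. abs_marked_class (H n, y n, b n)) (abs_marked_class (G, x, a))"
    by (intro class_conv_abs H G)
  then have "\<forall>\<^sub>F n in sequentially. abs_marked_class (H n, y n, b n) \<in> U"
    using U mem by (auto simp: open_marked_class_def)
  then show False using out by simp
qed

section \<open>Balls that determine the matching near the root\<close>

text \<open>Distances are measured inside \<open>B\<close>, so the sphere is determined by the
  rooted ball. In whatever graph \<open>B\<close> is the \<open>R\<close>-ball about
  \<open>x\<close>, an edge leaving \<open>B\<close> meets it in this set.\<close>

definition sphere_verts :: "'v graph \<Rightarrow> 'v \<Rightarrow> nat \<Rightarrow> 'v set" where
  "sphere_verts B x R = {v \<in> verts B. gdist B x v = enat R}"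

definition mwm_marks :: "'v set set \<Rightarrow> ('v set \<Rightarrow> real) \<Rightarrow> 'v set \<Rightarrow> real \<times> real" where
  "mwm_marks M w e = (w e, of_bool (e \<in> M))"

text \<open>\<open>r\<close> and \<open>k\<close> are existential because the size of a cylinder
  inside \<open>U\<close> depends on the object. Both range over countable sets, which keeps
  goodness measurable.\<close>

definition good_ball ::
    "(real \<times> real) marked_class set \<Rightarrow> nat \<Rightarrow> nat graph \<Rightarrow> nat \<Rightarrow> (nat set \<Rightarrow> real) \<Rightarrow> bool" where
  "good_ball U R B x w \<longleftrightarrow> generic B w \<and>
     (\<exists>r\<le>R. (\<forall>e\<in>edges (gball B {x} r). stable B (sphere_verts B x R) e w) \<and>
       (\<exists>k. cylinder_in U r (1 / real (Suc k)) B x (mwm_marks (finite_mwm B w) w)))"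

lemma good_ball_cong:
  assumes "\<And>e. e \<in> edges B \<Longrightarrow> w e = w' e"
  shows "good_ball U R B x w \<longleftrightarrow> good_ball U R B x w'"
proof -
  have "cylinder_in U r \<epsilon> B x (mwm_marks (finite_mwm B w) w) \<longleftrightarrow>
      cylinder_in U r \<epsilon> B x (mwm_marks (finite_mwm B w') w')" for r \<epsilon>
    using assms by (intro cylinder_in_cong) (auto simp: mwm_marks_def edges_gball finite_mwm_cong[of B w w'])
  then show ?thesis
    unfolding good_ball_def using generic_cong[of B w w'] stable_cong[of B w w'] assms by simp
qed

lemma good_ball_iso:
  assumes iso: "graph_iso \<phi> B B'" and B: "ugraph B" "finite (verts B)" "x \<in> verts B"
    and w: "\<And>e. e \<in> edges B \<Longrightarrow> w' (\<phi> ` e) = w e" and good: "good_ball U R B x w"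
  shows "good_ball U R B' (\<phi> x) w'"
proof -
  obtain r k where gen: "generic B w" and r: "r \<le> R"
    and st: "\<And>e. e \<in> edges (gball B {x} r) \<Longrightarrow> stable B (sphere_verts B x R) e w"
    and cyl: "cylinder_in U r (1 / real (Suc k)) B x (mwm_marks (finite_mwm B w) w)"
    using good unfolding good_ball_def by blast
  have "verts B' = \<phi> ` verts B" using iso by (auto simp: graph_iso_def bij_betw_def)
  then have sphere: "sphere_verts B' (\<phi> x) R = \<phi> ` sphere_verts B x R"
    using gdist_iso[OF iso B(1,3)] by (auto simp: sphere_verts_def)
  have "stable B' (sphere_verts B' (\<phi> x) R) e' w'" if e': "e' \<in> edges (gball B' {\<phi> x} r)" for e'
  proof -
    obtain e where "e \<in> edges (gball B {x} r)" "e' = \<phi> ` e"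
      using gball_iso[OF iso B(1,3), of r] e' by (auto simp: graph_iso_def)
    then show ?thesis
      unfolding sphere using stable_iso[OF iso B(1,2) gen w st] by (auto simp: edges_gball sphere_verts_def)
  qed
  moreover have "cylinder_in U r (1 / real (Suc k)) B' (\<phi> x) (mwm_marks (finite_mwm B' w') w')"
  proof (rule cylinder_in_iso[OF iso B(1,3) _ cyl])
    fix e assume e: "e \<in> edges B"
    show "mwm_marks (finite_mwm B' w') w' (\<phi> ` e) = mwm_marks (finite_mwm B w) w e"
      using mem_finite_mwm_iso[OF iso B(1,2) gen w edge_subset_verts[OF B(1) e]] w[OF e]
      by (simp add: mwm_marks_def)
  qed
  ultimately show ?thesis
    using finite_mwm_iso(1)[OF iso B(1,2) gen w] r unfolding good_ball_def by blast
qed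

text \<open>The matching is that of all of \<open>G\<close>, although the class sees only the
  component of the root. The local comparison is made in \<open>G\<close> itself, so other
  components do no harm.\<close>

lemma good_ball_imp_mem:
  assumes G: "ugraph G" "finite (verts G)" "x \<in> verts G" and good: "good_ball U R (gball G {x} R) x w"
  shows "marked_graph_class G x (mwm_marks (mwm G w) w) \<in> U"
proof -
  let ?B = "gball G {x} R"
  obtain r k where gen: "generic ?B w" and r: "r \<le> R"
    and st: "\<And>e. e \<in> edges (gball ?B {x} r) \<Longrightarrow> stable ?B (sphere_verts ?B x R) e w"
    and cyl: "cylinder_in U r (1 / real (Suc k)) ?B x (mwm_marks (finite_mwm ?B w) w)"
    using good unfolding good_ball_def by blast
  have "e \<in> finite_mwm G w \<longleftrightarrow> e \<in> finite_mwm ?B w" if e: "e \<in> edges (gball ?B {x} r)" for e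
  proof (rule finite_mwm_local[OF G(1) _ _ gen _ st[OF e]])
    show "finite (edges G)" by (rule finite_edges[OF G(1,2)])
    show "?B = induced G {v. gdist G x v \<le> enat R}" by (simp add: gball_def)
    show "e \<in> edges ?B" using e by (simp add: edges_gball)
    fix f v assume f: "f \<in> edges G" "\<not> f \<subseteq> {v. gdist G x v \<le> enat R}" "v \<in> f" "v \<in> {v. gdist G x v \<le> enat R}"
    then obtain u where u: "u \<in> f" "\<not> gdist G x u \<le> enat R" by blast
    then have fe: "f = {v, u}" using f by (auto elim!: ugraph_doubleton_cases[OF G(1)])
    \<comment> \<open>An endpoint at distance \<open>j < R\<close> would put \<open>u\<close> at
      distance at most \<open>Suc j\<close>, still inside the ball.\<close>
    have "\<not> gdist ?B x v \<le> enat j" if "j < R" for j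
      using gdist_step[of G x v j u] u(2) f(1) that gdist_mono[of G x u "Suc j" R]
      by (auto simp: gdist_gball fe)
    moreover have "gdist ?B x v \<le> enat R" using f(4) by (simp add: gdist_gball)
    ultimately have "gdist ?B x v = enat R"
      by (cases "gdist ?B x v") (auto simp: not_le dest: le_neq_implies_less)
    then show "v \<in> sphere_verts ?B x R"
      using f ugraph_edge_verts[OF G(1), of v u] by (simp add: sphere_verts_def verts_gball fe)
  qed
  then have "cylinder_in U r (1 / real (Suc k)) (component G x) x (mwm_marks (mwm G w) w)"
    using cyl r G(2)
    by (subst cylinder_in_cong[where G' = ?B and a' = "mwm_marks (finite_mwm ?B w) w"])
      (auto simp: gball_component gball_gball mwm_marks_def mwm_def)
  then show ?thesis
    unfolding marked_graph_class_def
    by (rule cylinder_in_mem) (auto intro: rooted_graph_component locally_finite_finite G)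
qed

text \<open>Converts stability about edges into stability about the root. Deleting vertices of a
  remote sphere leaves the stable ball about \<open>e\<close> intact, and that ball decides
  \<open>e\<close> both in the deleted graph and in all of \<open>G\<close>. Only finitely many
  edges of the \<open>r\<close>-ball have to be served.\<close>

lemma eventually_good_ball:
  assumes G: "rooted_graph G x"
    and gen: "\<And>B. B \<in> fin_graphs \<Longrightarrow> subgraph B G \<Longrightarrow> generic B w"
    and st: "\<And>e. e \<in> edges G \<Longrightarrow> \<exists>s. stable (gball G e s) (boundary G (gball G e s)) e w"
    and U: "open U" and mem: "marked_graph_class G x (mwm_marks (mwm G w) w) \<in> U"
  shows "\<forall>\<^sub>F R in sequentially. good_ball U R (gball G {x} R) x w"
proof -
  have uG: "ugraph G" "locally_finite G" "x \<in> verts G" using G by (auto simp: rooted_graph_def)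
  obtain r k where cyl: "cylinder_in U r (1 / real (Suc k)) (component G x) x (mwm_marks (mwm G w) w)"
    using cylinder_in_ex[OF U rooted_graph_component[OF uG]] mem unfolding marked_graph_class_def by blast
  have ball: "gball G {x} R \<in> fin_graphs" "subgraph (gball G {x} R) G" for R
    using uG finite_verts_gball[OF uG(1,2)] by (auto simp: fin_graphs_def ugraph_gball subgraph_gball)
  let ?E = "edges (gball G {x} r)"
  have fin: "finite ?E" using ball[of r] finite_edges by (auto simp: fin_graphs_def)
  have "\<forall>\<^sub>F R in sequentially. stable (gball G {x} R) (sphere_verts (gball G {x} R) x R) e w \<and>
      (e \<in> mwm G w \<longleftrightarrow> e \<in> finite_mwm (gball G {x} R) w)" if e: "e \<in> ?E" for e
  proof -
    have eG: "e \<in> edges G" using e by (simp add: edges_gball)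
    obtain s where s: "stable (gball G e s) (boundary G (gball G e s)) e w" using st[OF eG] by blast
    let ?Be = "gball G e s"
    have Be: "generic ?Be w"
      using uG finite_verts_gball[OF uG(1,2) finite_edge[OF uG(1) eG]]
      by (intro gen) (auto simp: fin_graphs_def ugraph_gball subgraph_gball)
    have near: "gdist G x v \<le> enat (r + s)" if "\<exists>u\<in>e. gdist G u v \<le> enat s" for v
      using that e gdist_triangle[of G x _ r v s] by (auto simp: edges_gball)
    \<comment> \<open>The ball about \<open>e\<close> lies within distance \<open>r + s\<close> of
      the root; the strict inequality keeps it off the sphere of radius \<open>R\<close>.\<close>
    have "stable (gball G {x} R) (sphere_verts (gball G {x} R) x R) e w \<and>
      (e \<in> mwm G w \<longleftrightarrow> e \<in> finite_mwm (gball G {x} R) w)" if R: "r + s < R" for R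
    proof -
      let ?B = "gball G {x} R"
      have B: "finite (verts ?B)" "subgraph ?B G" using ball[of R] by (auto simp: fin_graphs_def)
      have nearB: "v \<in> verts ?B - A" if "v \<in> verts ?Be" "A \<subseteq> sphere_verts ?B x R" for v A
      proof -
        have v: "gdist G x v \<le> enat (r + s)" using that near by (auto simp: verts_gball)
        then have "gdist ?B x v \<le> enat (r + s)" using R by (simp add: gdist_gball)
        then have "v \<notin> A" using R that(2) by (auto simp: sphere_verts_def)
        then show ?thesis using v R that(1) gdist_mono[OF v, of R] by (auto simp: verts_gball)
      qed
      have sub: "subgraph ?Be (delete_verts ?B A)" if A: "A \<subseteq> sphere_verts ?B x R" for A
        unfolding subgraph_def
      proof (intro conjI subsetI)
        show "ugraph ?Be" by (rule ugraph_gball[OF uG(1)])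
        show "v \<in> verts (delete_verts ?B A)" if "v \<in> verts ?Be" for v
          using nearB[OF that A] by (simp add: delete_verts_def induced_def)
        show "f \<in> edges (delete_verts ?B A)" if f: "f \<in> edges ?Be" for f
        proof -
          have "f \<subseteq> verts ?B - A" using edge_subset_verts[OF ugraph_gball[OF uG(1)] f] nearB A by blast
          moreover have "f \<in> edges G" using f by (simp add: edges_gball)
          ultimately show ?thesis by (auto simp: delete_verts_def induced_def edges_gball verts_gball)
        qed
      qed
      have del: "e \<in> finite_mwm (delete_verts ?B A) w \<longleftrightarrow> e \<in> finite_mwm ?Be w"
        if A: "A \<subseteq> sphere_verts ?B x R" for A
      proof (rule finite_mwm_gball[OF uG(1,2) eG Be s _ _ sub[OF A]])
        show "finite (verts (delete_verts ?B A))"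
          using B(1) by (simp add: delete_verts_def induced_def)
        show "subgraph (delete_verts ?B A) G"
          unfolding delete_verts_def
          by (rule subgraph_trans[OF subgraph_induced B(2)]) (rule ugraph_gball[OF uG(1)])
      qed
      \<comment> \<open>The empty deletion compares the root ball itself with the ball about
        \<open>e\<close>; all other deletions are compared with the same ball.\<close>
      have "delete_verts ?B {} = ?B"
        using edge_subset_verts[OF ugraph_gball[OF uG(1)]]
        by (auto simp: delete_verts_def induced_def intro!: graph.expand)
      then have B0: "e \<in> finite_mwm ?B w \<longleftrightarrow> e \<in> finite_mwm ?Be w" using del[of "{}"] by simp
      then show ?thesis
        using del mwm_gball[OF uG(1,2) eG Be s] by (simp add: stable_def)
    qed
    then show ?thesis
      using eventually_gt_at_top[of "r + s"] by (rule eventually_mono[rotated])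
  qed
  then have "\<forall>\<^sub>F R in sequentially. \<forall>e\<in>?E. stable (gball G {x} R) (sphere_verts (gball G {x} R) x R) e w \<and>
      (e \<in> mwm G w \<longleftrightarrow> e \<in> finite_mwm (gball G {x} R) w)"
    using fin by (simp add: eventually_ball_finite)
  with eventually_ge_at_top[of r] show ?thesis
  proof eventually_elim
    case (elim R)
    let ?B = "gball G {x} R"
    have "cylinder_in U r (1 / real (Suc k)) ?B x (mwm_marks (finite_mwm ?B w) w)"
      using cyl elim
      by (subst cylinder_in_cong[where G' = "component G x" and a' = "mwm_marks (mwm G w) w"])
        (auto simp: gball_component gball_gball mwm_marks_def)
    then show ?case
      unfolding good_ball_def using elim gen[OF ball] by (auto simp: gball_gball)
  qed
qed

section \<open>Measurability\<close>

lemma pred_countable_Ex: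
  assumes "countable I" "\<And>i. i \<in> I \<Longrightarrow> Measurable.pred N (P i)"
  shows "Measurable.pred N (\<lambda>\<omega>. \<exists>i\<in>I. P i \<omega>)"
  using assms unfolding pred_def by (intro sets.sets_Collect_countable_Ex')

lemma pred_countable_All:
  assumes "countable I" "\<And>i. i \<in> I \<Longrightarrow> Measurable.pred N (P i)"
  shows "Measurable.pred N (\<lambda>\<omega>. \<forall>i\<in>I. P i \<omega>)"
  using assms unfolding pred_def by (intro sets.sets_Collect_countable_All')

text \<open>There are uncountably many sets of natural numbers. Testing edges on pairs of vertices
  makes equality with a fixed graph a countable conjunction of events.\<close>

lemma ugraph_eq_iff:
  assumes "ugraph H" "ugraph K"
  shows "H = K \<longleftrightarrow> (\<forall>v. v \<in> verts H \<longleftrightarrow> v \<in> verts K) \<and> (\<forall>u v. {u, v} \<in> edges H \<longleftrightarrow> {u, v} \<in> edges K)"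
proof
  assume *: "(\<forall>v. v \<in> verts H \<longleftrightarrow> v \<in> verts K) \<and> (\<forall>u v. {u, v} \<in> edges H \<longleftrightarrow> {u, v} \<in> edges K)"
  have "e \<in> edges H \<longleftrightarrow> e \<in> edges K" for e
    using * ugraph_doubleton_cases[OF assms(1), of e] ugraph_doubleton_cases[OF assms(2), of e] by metis
  with * show "H = K" by (intro graph.expand) auto
qed auto

text \<open>Breaking ties by choice does no harm: the matching selected is a function
  of the set of optimal matchings, which takes finitely many values.\<close>

lemma pred_finite_mwm:
  assumes fin: "finite (edges K)" and w: "\<And>e. e \<in> edges K \<Longrightarrow> (\<lambda>\<omega>. w \<omega> e) \<in> borel_measurable N"
  shows "Measurable.pred N (\<lambda>\<omega>. e \<in> finite_mwm K (w \<omega> :: 'v set \<Rightarrow> real))"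
proof -
  define \<M> where "\<M> = {M. matching K M}"
  have \<M>: "finite \<M>"
    unfolding \<M>_def by (rule finite_subset[of _ "Pow (edges K)"]) (use fin in \<open>auto simp: matching_def\<close>)
  have sum: "(\<lambda>\<omega>. sum (w \<omega>) M) \<in> borel_measurable N" if "M \<in> \<M>" for M
    using that w by (intro borel_measurable_sum) (auto simp: \<M>_def dest: matching_subset)
  let ?opt = "\<lambda>\<omega> M. M \<in> \<M> \<and> (\<forall>M'\<in>\<M>. sum (w \<omega>) M' \<le> sum (w \<omega>) M)"
  have eq: "e \<in> finite_mwm K (w \<omega>) \<longleftrightarrow>
      (\<exists>\<A>\<in>Pow \<M>. (\<forall>M\<in>\<M>. (\<forall>M'\<in>\<M>. sum (w \<omega>) M' \<le> sum (w \<omega>) M) \<longleftrightarrow> M \<in> \<A>) \<and> e \<in> (SOME M. M \<in> \<A>))"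
    (is "_ \<longleftrightarrow> ?R \<omega>") for \<omega>
  proof -
    have am: "is_arg_max (sum (w \<omega>)) (matching K) M \<longleftrightarrow> ?opt \<omega> M" for M
      by (auto simp: is_arg_max_def \<M>_def not_less)
    have fm: "finite_mwm K (w \<omega>) = (SOME M. M \<in> {M. ?opt \<omega> M})"
      by (simp add: finite_mwm_def arg_max_def am)
    show ?thesis
    proof
      assume "e \<in> finite_mwm K (w \<omega>)"
      then show "?R \<omega>" unfolding fm by (intro bexI[of _ "{M. ?opt \<omega> M}"]) auto
    next
      assume "?R \<omega>"
      then obtain \<A> where \<A>: "\<A> \<subseteq> \<M>" "e \<in> (SOME M. M \<in> \<A>)"
        "\<forall>M\<in>\<M>. (\<forall>M'\<in>\<M>. sum (w \<omega>) M' \<le> sum (w \<omega>) M) \<longleftrightarrow> M \<in> \<A>" by blast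
      then have "\<A> = {M. ?opt \<omega> M}" by blast
      with \<A>(2) show "e \<in> finite_mwm K (w \<omega>)" unfolding fm by simp
    qed
  qed
  have [measurable]: "Measurable.pred N (\<lambda>\<omega>. sum (w \<omega>) M' \<le> sum (w \<omega>) M)" if "M \<in> \<M>" "M' \<in> \<M>" for M M'
    using sum[OF that(1)] sum[OF that(2)] by simp
  have "Measurable.pred N (\<lambda>\<omega>. ?R \<omega>)"
    using \<M> by (intro pred_intros_finite pred_intros_logic) auto
  then show ?thesis by (simp add: eq)
qed

lemma pred_stable:
  assumes "finite (edges K)" "finite S"
    and "\<And>e. e \<in> edges K \<Longrightarrow> (\<lambda>\<omega>. w \<omega> e) \<in> borel_measurable N"
  shows "Measurable.pred N (\<lambda>\<omega>. stable K S e (w \<omega>))"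
proof -
  have "Measurable.pred N (\<lambda>\<omega>. \<forall>A\<in>Pow S. e \<in> finite_mwm K (w \<omega>) \<longleftrightarrow> e \<in> finite_mwm (delete_verts K A) (w \<omega>))"
    using assms(1,2) finite_subset[OF edges_delete_verts_subset]
    by (intro pred_intros_finite pred_intros_logic pred_finite_mwm)
      (auto intro: assms(3) subsetD[OF edges_delete_verts_subset])
  then show ?thesis by (simp add: stable_def Ball_def)
qed

lemma pred_generic:
  assumes "finite (edges K)" and w: "\<And>e. e \<in> edges K \<Longrightarrow> (\<lambda>\<omega>. w \<omega> e) \<in> borel_measurable N"
  shows "Measurable.pred N (\<lambda>\<omega>. generic K (w \<omega>))"
proof -
  have [measurable]: "(\<lambda>\<omega>. sum (w \<omega>) S) \<in> borel_measurable N" if "S \<in> Pow (edges K)" for S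
    using that w by (intro borel_measurable_sum) auto
  have "Measurable.pred N (\<lambda>\<omega>. \<forall>S\<in>Pow (edges K). \<forall>T\<in>Pow (edges K). sum (w \<omega>) S = sum (w \<omega>) T \<longrightarrow> S = T)"
    using assms(1) by (intro pred_intros_finite) auto
  then show ?thesis by (simp add: generic_def inj_on_def)
qed

lemma rational_pair_approx:
  fixes p :: "real \<times> real"
  assumes "0 < \<epsilon>"
  shows "\<exists>q\<in>\<rat> \<times> \<rat>. dist p q < \<epsilon>"
proof -
  obtain a b where p: "p = (a, b)" by (cases p)
  have h: "0 < \<epsilon> / 2" using assms by simp
  obtain a' where "a' \<in> \<rat>" "\<bar>a' - a\<bar> < \<epsilon> / 2" by (rule rational_approximation[OF h])
  moreover obtain b' where "b' \<in> \<rat>" "\<bar>b' - b\<bar> < \<epsilon> / 2" by (rule rational_approximation[OF h])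
  moreover have "dist p (a', b') \<le> \<bar>a - a'\<bar> + \<bar>b - b'\<bar>"
    using norm_Pair_le[of "a - a'" "b - b'"] by (simp add: p dist_norm)
  ultimately have "dist p (a', b') < \<epsilon>" "(a', b') \<in> \<rat> \<times> \<rat>" by (auto simp: abs_minus_commute)
  then show ?thesis by blast
qed

text \<open>The union over all tolerances is open in the marks, so it is a countable union of boxes
  about rational marks. For each such \<open>c\<close> the condition \<open>cylinder_in\<close> is a
  constant truth value, and nothing about its dependence on marks has to be measurable.\<close>

lemma pred_cylinder_in:
  fixes a :: "'a \<Rightarrow> nat set \<Rightarrow> real \<times> real"
  assumes K: "finite (edges K)"
    and a: "\<And>e. e \<in> edges K \<Longrightarrow> (\<lambda>\<omega>. a \<omega> e) \<in> borel_measurable N"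
  shows "Measurable.pred N (\<lambda>\<omega>. \<exists>k. cylinder_in U r (1 / real (Suc k)) K x (a \<omega>))"
proof -
  define E where "E = edges (gball K {x} r)"
  define C where "C = PiE E (\<lambda>_. \<rat> \<times> \<rat> :: (real \<times> real) set)"
  have E: "finite E" "E \<subseteq> edges K" using K by (auto simp: E_def edges_gball intro: finite_subset)
  have "countable C"
    unfolding C_def by (intro countable_PiE E countable_SIGMA countable_rat)
  have eq: "(\<exists>k. cylinder_in U r (1 / real (Suc k)) K x b) \<longleftrightarrow>
      (\<exists>k. \<exists>c\<in>C. cylinder_in U r (1 / real (Suc k)) K x c \<and> (\<forall>e\<in>E. dist (b e) (c e) < 1 / real (Suc k)))" for b
  proof
    assume "\<exists>k. cylinder_in U r (1 / real (Suc k)) K x b"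
    then obtain k where k: "cylinder_in U r (1 / real (Suc k)) K x b" by blast
    \<comment> \<open>\<open>Suc ?k\<close> is twice \<open>Suc k\<close>: half of the tolerance
      pays for moving to rational marks and the other half remains.\<close>
    let ?k = "2 * k + 1"
    have half: "1 / real (Suc k) - 1 / real (Suc ?k) = 1 / real (Suc ?k)" by (simp add: field_simps)
    have "\<forall>e. \<exists>q\<in>\<rat> \<times> \<rat>. dist (b e) q < 1 / real (Suc ?k)" by (intro allI rational_pair_approx) simp
    then obtain q where q: "\<And>e. q e \<in> \<rat> \<times> \<rat>" "\<And>e. dist (b e) (q e) < 1 / real (Suc ?k)" by metis
    define c where "c = restrict q E"
    have "c \<in> C" using q by (auto simp: C_def c_def)
    moreover have d: "dist (b e) (c e) < 1 / real (Suc ?k)" if "e \<in> E" for e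
      using q that by (simp add: c_def)
    moreover have "cylinder_in U r (1 / real (Suc ?k)) K x c"
    proof (rule cylinder_in_perturb[OF k])
      fix e assume "e \<in> edges (gball K {x} r)"
      then show "dist (c e) (b e) \<le> 1 / real (Suc k) - 1 / real (Suc ?k)"
        using d[of e] unfolding half by (simp add: E_def dist_commute)
    qed
    ultimately show "\<exists>k. \<exists>c\<in>C. cylinder_in U r (1 / real (Suc k)) K x c \<and> (\<forall>e\<in>E. dist (b e) (c e) < 1 / real (Suc k))"
      by blast
  next
    assume "\<exists>k. \<exists>c\<in>C. cylinder_in U r (1 / real (Suc k)) K x c \<and> (\<forall>e\<in>E. dist (b e) (c e) < 1 / real (Suc k))"
    then obtain k c where c: "cylinder_in U r (1 / real (Suc k)) K x c"
      and d: "\<And>e. e \<in> E \<Longrightarrow> dist (b e) (c e) < 1 / real (Suc k)" by blast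
    have "\<forall>\<^sub>F m in sequentially. 1 / real (Suc m) < 1 / real (Suc k) - dist (b e) (c e)" if "e \<in> E" for e
      by (rule order_tendstoD(2)[OF LIMSEQ_Suc[OF lim_1_over_n]]) (use d[OF that] in simp)
    then have "\<forall>\<^sub>F m in sequentially. \<forall>e\<in>E. 1 / real (Suc m) < 1 / real (Suc k) - dist (b e) (c e)"
      using E(1) by (intro eventually_ball_finite) auto
    \<comment> \<open>Each of the finitely many edges has strict slack, so one \<open>m\<close>
      leaves room for all of them.\<close>
    then obtain m where m: "\<And>e. e \<in> E \<Longrightarrow> 1 / real (Suc m) < 1 / real (Suc k) - dist (b e) (c e)"
      unfolding eventually_sequentially by blast
    have "cylinder_in U r (1 / real (Suc m)) K x b"
    proof (rule cylinder_in_perturb[OF c])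
      fix e assume "e \<in> edges (gball K {x} r)"
      then show "dist (b e) (c e) \<le> 1 / real (Suc k) - 1 / real (Suc m)"
        using m[of e] by (simp add: E_def)
    qed
    then show "\<exists>k. cylinder_in U r (1 / real (Suc k)) K x b" by blast
  qed
  have [measurable]: "(\<lambda>\<omega>. a \<omega> e) \<in> borel_measurable N" if "e \<in> E" for e using a that E(2) by blast
  have "Measurable.pred N (\<lambda>\<omega>. \<exists>k. \<exists>c\<in>C. cylinder_in U r (1 / real (Suc k)) K x c \<and>
      (\<forall>e\<in>E. dist (a \<omega> e) (c e) < 1 / real (Suc k)))"
    using \<open>countable C\<close> E(1)
    by (intro pred_intros_countable pred_countable_Ex pred_intros_conj1' pred_intros_finite) auto
  then show ?thesis by (simp only: eq)
qed

lemma borel_measurable_mwm_marks: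
  assumes "Measurable.pred N (\<lambda>\<omega>. e \<in> M \<omega>)" "(\<lambda>\<omega>. w \<omega> e) \<in> borel_measurable N"
  shows "(\<lambda>\<omega>. mwm_marks (M \<omega>) (w \<omega>) e) \<in> borel_measurable N"
proof -
  have [measurable]: "Measurable.pred N (\<lambda>\<omega>. e \<in> M \<omega>)" "(\<lambda>\<omega>. w \<omega> e) \<in> borel_measurable N" by fact+
  have "(\<lambda>\<omega>. (w \<omega> e, of_bool (e \<in> M \<omega>) :: real)) \<in> borel_measurable N"
    unfolding of_bool_def borel_prod[symmetric] by measurable
  then show ?thesis by (simp add: mwm_marks_def)
qed

lemma pred_good_ball:
  assumes K: "ugraph K" "finite (verts K)"
    and w: "\<And>e. e \<in> edges K \<Longrightarrow> (\<lambda>\<omega>. w \<omega> e) \<in> borel_measurable N"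
  shows "Measurable.pred N (\<lambda>\<omega>. good_ball U R K x (w \<omega>))"
proof -
  have fin: "finite (edges K)" by (rule finite_edges[OF K])
  have S: "finite (sphere_verts K x R)" "finite (edges (gball K {x} r))" for r
    using K(2) fin by (auto simp: sphere_verts_def edges_gball intro: finite_subset)
  show ?thesis
    unfolding good_ball_def Bex_def[symmetric] atMost_iff[symmetric]
    by (intro pred_intros_logic(3) pred_generic pred_countable_Ex pred_intros_finite pred_stable
        pred_cylinder_in borel_measurable_mwm_marks pred_finite_mwm fin S w) auto
qed

text \<open>Abstract in \<open>N\<close> because the facts are applied to \<open>M\<close> and also
  to the smaller sigma-algebra generated by graph and root, on which the weights are
  conditioned.\<close>

locale measurable_graph =
  fixes N :: "'a measure" and G :: "'a \<Rightarrow> nat graph" and x :: "'a \<Rightarrow> nat"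
  assumes G_measurable: "G \<in> measurable N graph_space"
    and x_measurable: "x \<in> measurable N (count_space UNIV)"
    and ugraph: "\<omega> \<in> space N \<Longrightarrow> ugraph (G \<omega>)"
    and locally_finite: "\<omega> \<in> space N \<Longrightarrow> locally_finite (G \<omega>)"
    and root: "\<omega> \<in> space N \<Longrightarrow> x \<omega> \<in> verts (G \<omega>)"
begin

lemma pred_verts: "Measurable.pred N (\<lambda>\<omega>. v \<in> verts (G \<omega>))"
proof -
  have "{G. v \<in> verts G} \<in> sets graph_space"
    unfolding graph_space_def by (subst sets_measure_of) auto
  from measurable_sets[OF G_measurable this] show ?thesis
    by (simp add: pred_def vimage_def Int_def conj_commute)
qed

lemma pred_edges: "Measurable.pred N (\<lambda>\<omega>. e \<in> edges (G \<omega>))"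
proof -
  have "{G. e \<in> edges G} \<in> sets graph_space"
    unfolding graph_space_def by (subst sets_measure_of) auto
  from measurable_sets[OF G_measurable this] show ?thesis
    by (simp add: pred_def vimage_def Int_def conj_commute)
qed

lemma pred_adj_pow: "Measurable.pred N (\<lambda>\<omega>. (u, v) \<in> adj (G \<omega>) ^^ k)"
proof (induction k arbitrary: v)
  case (Suc k)
  have "(u, v) \<in> adj (G \<omega>) ^^ Suc k \<longleftrightarrow> (\<exists>z. (u, z) \<in> adj (G \<omega>) ^^ k \<and> {z, v} \<in> edges (G \<omega>))" for \<omega>
    by (auto simp: adj_def)
  then show ?case
    by (simp only:) (intro pred_intros_countable pred_intros_logic Suc pred_edges)
qed simp

lemma pred_gdist: "Measurable.pred N (\<lambda>\<omega>. gdist (G \<omega>) u v \<le> enat r)"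
  unfolding gdist_le_iff by (intro pred_intros_countable pred_intros_conj1' pred_adj_pow)

lemma pred_gball_eq:
  assumes "ugraph K"
  shows "Measurable.pred N (\<lambda>\<omega>. gball (G \<omega>) S r = K)"
proof -
  have "Measurable.pred N (\<lambda>\<omega>. (\<forall>v. (v \<in> verts (G \<omega>) \<and> (\<exists>u\<in>S. gdist (G \<omega>) u v \<le> enat r)) \<longleftrightarrow> v \<in> verts K) \<and>
    (\<forall>u v. ({u, v} \<in> edges (G \<omega>) \<and> (\<forall>v\<in>{u, v}. \<exists>u\<in>S. gdist (G \<omega>) u v \<le> enat r)) \<longleftrightarrow> {u, v} \<in> edges K))"
    by (intro pred_intros_logic pred_intros_countable pred_intros_countable_bounded
        pred_verts pred_edges pred_gdist) auto
  then show ?thesis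
    by (subst measurable_cong) (simp_all add: ugraph_eq_iff assms ugraph ugraph_gball verts_gball edges_gball)
qed

lemma pred_root_ball_eq:
  assumes "ugraph K"
  shows "Measurable.pred N (\<lambda>\<omega>. gball (G \<omega>) {x \<omega>} r = K)"
  by (rule measurable_compose_countable[OF pred_gball_eq[OF assms] x_measurable, of "\<lambda>v. {v}"])

lemma pred_boundary_eq: "Measurable.pred N (\<lambda>\<omega>. boundary (G \<omega>) K = A)"
proof -
  have "boundary (G \<omega>) K = A \<longleftrightarrow>
      (\<forall>v. v \<in> A \<longleftrightarrow> v \<in> verts K \<and> (\<exists>u. u \<in> verts (G \<omega>) \<and> u \<notin> verts K \<and> {u, v} \<in> edges (G \<omega>)))" for \<omega>
    by (auto simp: boundary_def)
  then show ?thesis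
    by (simp only:) (intro pred_intros_countable pred_intros_logic pred_verts pred_edges, auto)
qed

lemma pred_subgraph:
  assumes "K \<in> fin_graphs"
  shows "Measurable.pred N (\<lambda>\<omega>. subgraph K (G \<omega>))"
proof -
  have K: "ugraph K" "finite (verts K)" "finite (edges K)" using assms finite_edges by (auto simp: fin_graphs_def)
  then have "subgraph K (G \<omega>) \<longleftrightarrow> (\<forall>v\<in>verts K. v \<in> verts (G \<omega>)) \<and> (\<forall>e\<in>edges K. e \<in> edges (G \<omega>))" for \<omega>
    by (auto simp: subgraph_def)
  then show ?thesis
    by (simp only:) (intro pred_intros_finite pred_intros_logic pred_verts pred_edges K)
qed

lemma ball_fin_graphs:
  "\<omega> \<in> space N \<Longrightarrow> finite S \<Longrightarrow> gball (G \<omega>) S r \<in> fin_graphs"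
  using finite_verts_gball[OF ugraph locally_finite] ugraph_gball[OF ugraph] by (simp add: fin_graphs_def)

lemma pred_mwm:
  assumes w: "\<And>e. (\<lambda>\<omega>. w \<omega> e) \<in> borel_measurable N"
  shows "Measurable.pred N (\<lambda>\<omega>. e \<in> mwm (G \<omega>) (w \<omega>))"
proof -
  have fin: "finite (edges K)" "ugraph K" if "K \<in> fin_graphs" for K
    using that finite_edges by (auto simp: fin_graphs_def)
  have m: "Measurable.pred N (\<lambda>\<omega>. e \<in> finite_mwm K (w \<omega>))" if "K \<in> fin_graphs" for K
    using fin[OF that] w by (intro pred_finite_mwm)
  \<comment> \<open>A finite graph is one of countably many fixed graphs, so its matching is handled
    case by case; \<open>?I\<close> is the countable description for infinite graphs.\<close>
  let ?F = "\<lambda>\<omega>. \<exists>K\<in>fin_graphs. G \<omega> = K \<and> e \<in> finite_mwm K (w \<omega>)"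
  let ?I = "\<lambda>\<omega>. e \<in> edges (G \<omega>) \<and> (\<exists>K\<in>fin_graphs. subgraph K (G \<omega>) \<and>
    (\<forall>H\<in>fin_graphs. subgraph H (G \<omega>) \<and> subgraph K H \<longrightarrow> e \<in> finite_mwm H (w \<omega>)))"
  have geq: "Measurable.pred N (\<lambda>\<omega>. G \<omega> = K)" if "K \<in> fin_graphs" for K
  proof -
    have "Measurable.pred N (\<lambda>\<omega>. (\<forall>v. v \<in> verts (G \<omega>) \<longleftrightarrow> v \<in> verts K) \<and>
        (\<forall>u v. {u, v} \<in> edges (G \<omega>) \<longleftrightarrow> {u, v} \<in> edges K))"
      by (intro pred_intros_logic pred_intros_countable pred_verts pred_edges) auto
    then show ?thesis by (subst measurable_cong) (simp_all add: ugraph_eq_iff ugraph fin[OF that])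
  qed
  have "Measurable.pred N ?F"
    by (intro pred_countable_Ex countable_fin_graphs pred_intros_logic geq m)
  moreover have "Measurable.pred N ?I"
    by (intro pred_countable_Ex pred_countable_All countable_fin_graphs pred_intros_logic(3,4)
        pred_edges pred_subgraph m) auto
  moreover have "Measurable.pred N (\<lambda>\<omega>. finite (verts (G \<omega>)))"
    by (intro measurable_finite predE pred_verts)
  ultimately have "Measurable.pred N (\<lambda>\<omega>. if finite (verts (G \<omega>)) then ?F \<omega> else ?I \<omega>)"
    by measurable
  moreover have "e \<in> mwm (G \<omega>) (w \<omega>) \<longleftrightarrow> (if finite (verts (G \<omega>)) then ?F \<omega> else ?I \<omega>)" if "\<omega> \<in> space N" for \<omega>
    using ugraph[OF that] mwm_infinite_iff[OF ugraph[OF that]]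
    by (auto simp: mwm_def[of "G \<omega>"] fin_graphs_def)
  ultimately show ?thesis by (subst measurable_cong)
qed

lemma borel_measurable_marked_graph_class:
  fixes a :: "'a \<Rightarrow> nat set \<Rightarrow> real \<times> real"
  assumes a: "\<And>e. (\<lambda>\<omega>. a \<omega> e) \<in> borel_measurable N"
  shows "(\<lambda>\<omega>. marked_graph_class (G \<omega>) (x \<omega>) (a \<omega>)) \<in> borel_measurable N"
proof (rule borel_measurableI)
  fix U :: "(real \<times> real) marked_class set" assume U: "open U"
  have cyl: "Measurable.pred N (\<lambda>\<omega>. \<exists>k. cylinder_in U r (1 / real (Suc k)) K (x \<omega>) (a \<omega>))"
    if "K \<in> fin_graphs" for K r
    using finite_edges that a
    by (intro measurable_compose_countable[OF pred_cylinder_in x_measurable]) (auto simp: fin_graphs_def)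
  have "Measurable.pred N (\<lambda>\<omega>. \<exists>r. \<exists>K\<in>fin_graphs. gball (G \<omega>) {x \<omega>} r = K \<and>
      (\<exists>k. cylinder_in U r (1 / real (Suc k)) K (x \<omega>) (a \<omega>)))" (is "Measurable.pred N ?P")
    by (intro pred_intros_countable(2) pred_countable_Ex countable_fin_graphs pred_intros_logic(3)
        pred_root_ball_eq cyl) (auto simp: fin_graphs_def)
  moreover have "marked_graph_class (G \<omega>) (x \<omega>) (a \<omega>) \<in> U \<longleftrightarrow> ?P \<omega>" if \<omega>: "\<omega> \<in> space N" for \<omega>
  proof -
    have rooted: "rooted_graph (component (G \<omega>) (x \<omega>)) (x \<omega>)"
      by (intro rooted_graph_component ugraph locally_finite root \<omega>)
    \<comment> \<open>The component and its \<open>r\<close>-ball have the same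
      \<open>r\<close>-ball, so the condition can be read off one of countably many finite
      graphs.\<close>
    have cong: "cylinder_in U r \<epsilon> (component (G \<omega>) (x \<omega>)) (x \<omega>) (a \<omega>) \<longleftrightarrow>
        cylinder_in U r \<epsilon> (gball (G \<omega>) {x \<omega>} r) (x \<omega>) (a \<omega>)" for r \<epsilon>
      by (rule cylinder_in_cong) (simp_all add: gball_component gball_gball)
    have "?P \<omega> \<longleftrightarrow> (\<exists>r k. cylinder_in U r (1 / real (Suc k)) (component (G \<omega>) (x \<omega>)) (x \<omega>) (a \<omega>))"
      unfolding cong using ball_fin_graphs[OF \<omega>, of "{x \<omega>}"] by auto
    also have "\<dots> \<longleftrightarrow> marked_graph_class (G \<omega>) (x \<omega>) (a \<omega>) \<in> U"
      unfolding marked_graph_class_def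
      using cylinder_in_ex[OF U rooted] cylinder_in_mem[OF _ rooted] by fastforce
    finally show ?thesis by simp
  qed
  ultimately have "Measurable.pred N (\<lambda>\<omega>. marked_graph_class (G \<omega>) (x \<omega>) (a \<omega>) \<in> U)"
    by (subst measurable_cong)
  then show "(\<lambda>\<omega>. marked_graph_class (G \<omega>) (x \<omega>) (a \<omega>)) -` U \<inter> space N \<in> sets N"
    by (simp add: pred_def vimage_def Int_def conj_commute)
qed

end

section \<open>The conditional law of the weights\<close>

locale weighted_graph = prob_space M + measurable_graph M G x + F: prob_space F
  for M :: "'a measure" and G :: "'a \<Rightarrow> nat graph" and x :: "'a \<Rightarrow> nat"
    and F :: "real measure" +
  fixes w :: "'a \<Rightarrow> nat set \<Rightarrow> real"
  assumes sets_F: "sets F = sets borel"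
    and iid: "iid_weights F M G x w"
begin

text \<open>The sigma-algebra on which \<open>iid_weights\<close> conditions.\<close>

definition graph_algebra :: "'a measure" where
  "graph_algebra = vimage_algebra (space M) (\<lambda>\<omega>. (G \<omega>, x \<omega>)) (graph_space \<Otimes>\<^sub>M count_space UNIV)"

lemma weight_measurable: "(\<lambda>\<omega>. w \<omega> e) \<in> borel_measurable M"
  using iid by (simp add: iid_weights_def)

lemma space_graph_algebra: "space graph_algebra = space M"
  by (simp add: graph_algebra_def)

lemma graph_root_measurable: "(\<lambda>\<omega>. (G \<omega>, x \<omega>)) \<in> measurable M (graph_space \<Otimes>\<^sub>M count_space UNIV)"
  using G_measurable x_measurable by measurable

lemma sets_graph_algebra_subset: "sets graph_algebra \<subseteq> sets M"
  unfolding graph_algebra_def by (rule sets_image_in_sets[OF refl graph_root_measurable])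

lemma measurable_graph_graph_algebra: "measurable_graph graph_algebra G x"
proof -
  have "(\<lambda>\<omega>. (G \<omega>, x \<omega>)) \<in> measurable graph_algebra (graph_space \<Otimes>\<^sub>M count_space UNIV)"
    unfolding graph_algebra_def
    by (rule measurable_vimage_algebra1) (auto simp: space_pair_measure graph_space_def space_measure_of_conv)
  from measurable_compose[OF this measurable_fst] measurable_compose[OF this measurable_snd]
  show ?thesis
    by unfold_locales (auto simp: space_graph_algebra ugraph locally_finite root)
qed

lemma weights_box:
  assumes A: "A \<in> sets graph_algebra" "\<And>\<omega>. \<omega> \<in> A \<Longrightarrow> E \<subseteq> edges (G \<omega>)" and E: "finite E"
    and B: "\<And>e. e \<in> E \<Longrightarrow> B e \<in> sets borel"
  shows "measure M {\<omega> \<in> A. \<forall>e\<in>E. w \<omega> e \<in> B e} = measure M A * (\<Prod>e\<in>E. measure F (B e))"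
proof -
  interpret S: finite_measure_subalgebra M graph_algebra
    by unfold_locales (simp add: subalgebra_def space_graph_algebra sets_graph_algebra_subset)
  define f where "f \<omega> = (of_bool (\<forall>e\<in>E. w \<omega> e \<in> B e) :: real)" for \<omega>
  let ?c = "\<Prod>e\<in>E. measure F (B e)"
  have AM: "A \<in> sets M" using A sets_graph_algebra_subset by blast
  have [measurable]: "Measurable.pred M (\<lambda>\<omega>. \<forall>e\<in>E. w \<omega> e \<in> B e)"
    using E B weight_measurable by (intro pred_intros_finite) auto
  have [measurable]: "f \<in> borel_measurable M" unfolding f_def of_bool_def by measurable
  have int: "integrable M f"
    by (rule integrable_const_bound[where B = 1]) (auto simp: f_def)
  \<comment> \<open>The hypothesis speaks only where \<open>E\<close> consists of edges. This is so
    on \<open>A\<close>, and off \<open>A\<close> both sides vanish.\<close>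
  have cond: "AE \<omega> in M. indicator A \<omega> *\<^sub>R real_cond_exp M graph_algebra f \<omega> = indicator A \<omega> *\<^sub>R ?c"
  proof -
    have "AE \<omega> in M. E \<subseteq> edges (G \<omega>) \<longrightarrow> real_cond_exp M graph_algebra f \<omega> = ?c"
      using iid E B unfolding iid_weights_def cond_prob_given_def graph_algebra_def f_def by blast
    then show ?thesis by eventually_elim (use A(2) in \<open>auto simp: indicator_def\<close>)
  qed
  have "measure M {\<omega> \<in> A. \<forall>e\<in>E. w \<omega> e \<in> B e} = (\<integral>\<omega>. indicator {\<omega> \<in> A. \<forall>e\<in>E. w \<omega> e \<in> B e} \<omega> \<partial>M)"
    using sets.sets_into_space[OF AM] by (simp add: Int_absorb2 subset_iff)
  also have "\<dots> = (\<integral>\<omega>\<in>A. f \<omega> \<partial>M)"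
    unfolding set_lebesgue_integral_def by (intro Bochner_Integration.integral_cong) (auto simp: f_def indicator_def)
  also have "\<dots> = (\<integral>\<omega>\<in>A. real_cond_exp M graph_algebra f \<omega> \<partial>M)"
    by (rule S.real_cond_exp_intA[OF int A(1)])
  also have "\<dots> = (\<integral>\<omega>. indicator A \<omega> *\<^sub>R ?c \<partial>M)"
    unfolding set_lebesgue_integral_def using cond AM by (intro integral_cong_AE) auto
  also have "\<dots> = measure M A * ?c" using sets.sets_into_space[OF AM] by (simp add: Int_absorb2)
  finally show ?thesis .
qed

lemma restrict_weights_measurable: "(\<lambda>\<omega>. restrict (w \<omega>) E) \<in> measurable M (PiM E (\<lambda>_. F))"
  using weight_measurable measurable_cong_sets[OF refl sets_F] by (intro measurable_restrict) blast

lemma product_prob_space_F: "product_prob_space (\<lambda>_. F)"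
  by (intro product_prob_spaceI F.prob_space_axioms)

text \<open>Boxes determine a product measure. Conditioning on \<open>A\<close> turns the left side
  into a probability measure on the product space to which this applies, hence the separate case of
  a null \<open>A\<close>.\<close>

lemma weights_law:
  assumes A: "A \<in> sets graph_algebra" "\<And>\<omega>. \<omega> \<in> A \<Longrightarrow> E \<subseteq> edges (G \<omega>)" and E: "finite E"
    and T: "T \<in> sets (PiM E (\<lambda>_. F))"
  shows "emeasure M {\<omega> \<in> A. restrict (w \<omega>) E \<in> T} = emeasure M A * emeasure (PiM E (\<lambda>_. F)) T"
proof -
  interpret P: product_prob_space "\<lambda>_. F" by (rule product_prob_space_F)
  let ?W = "\<lambda>\<omega>. restrict (w \<omega>) E"
  have AM: "A \<in> sets M" using A sets_graph_algebra_subset by blast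
  note W = restrict_weights_measurable[of E]
  have eq: "{\<omega> \<in> A. ?W \<omega> \<in> T} = A \<inter> (?W -` T \<inter> space M)" for T
    using sets.sets_into_space[OF AM] by auto
  show ?thesis
  proof (cases "emeasure M A = 0")
    case True
    have "emeasure M {\<omega> \<in> A. ?W \<omega> \<in> T} \<le> emeasure M A" by (rule emeasure_mono[OF _ AM]) auto
    with True show ?thesis by simp
  next
    case False
    define P where "P = distr (uniform_measure M A) (PiM E (\<lambda>_. F)) ?W"
    have em: "emeasure P T = emeasure M {\<omega> \<in> A. ?W \<omega> \<in> T} / emeasure M A" if "T \<in> sets (PiM E (\<lambda>_. F))" for T
      using W that AM unfolding P_def eq by (subst emeasure_distr) (auto simp: measurable_sets)
    have "P = PiM E (\<lambda>_. F)"
    proof (rule P.PiM_eqI[OF E])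
      fix B assume B: "\<And>e. e \<in> E \<Longrightarrow> B e \<in> sets F"
      have "{\<omega> \<in> A. ?W \<omega> \<in> Pi\<^sub>E E B} = {\<omega> \<in> A. \<forall>e\<in>E. w \<omega> e \<in> B e}"
        by (auto simp: PiE_iff)
      then have "emeasure M {\<omega> \<in> A. ?W \<omega> \<in> Pi\<^sub>E E B} = ennreal (measure M A * (\<Prod>e\<in>E. measure F (B e)))"
        using weights_box[OF A E, of B] B by (simp add: emeasure_eq_measure sets_F)
      also have "\<dots> = (\<Prod>e\<in>E. emeasure F (B e)) * emeasure M A"
        by (simp add: F.emeasure_eq_measure emeasure_eq_measure prod_ennreal ennreal_mult' prod_nonneg mult.commute)
      finally show "emeasure P (Pi\<^sub>E E B) = (\<Prod>e\<in>E. emeasure F (B e))"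
        using False B E by (subst em) (auto intro!: sets_PiM_I_finite mult_divide_eq_ennreal)
    qed (simp add: P_def)
    then have "emeasure M A * emeasure (PiM E (\<lambda>_. F)) T = emeasure M A * (emeasure M {\<omega> \<in> A. ?W \<omega> \<in> T} / emeasure M A)"
      using em[OF T] by simp
    also have "\<dots> = emeasure M {\<omega> \<in> A. ?W \<omega> \<in> T}"
      using False by (subst mult.commute) (simp add: ennreal_divide_times less_top[symmetric])
    finally show ?thesis by simp
  qed
qed

text \<open>The weights sit on a random set of edges. The key \<open>\<kappa>\<close> records the
  finite data that determine this set and the event; where the key is constant
  \<open>weights_law\<close> applies, and summing over keys gives the integral.\<close>

lemma weights_law_key:
  fixes \<kappa> :: "'a \<Rightarrow> 'k"
  assumes C: "countable C" "\<And>\<omega>. \<omega> \<in> space M \<Longrightarrow> \<kappa> \<omega> \<in> C"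
    and \<kappa>: "\<And>k. k \<in> C \<Longrightarrow> Measurable.pred graph_algebra (\<lambda>\<omega>. \<kappa> \<omega> = k)"
    and E: "\<And>\<omega>. \<omega> \<in> space M \<Longrightarrow> E (\<kappa> \<omega>) \<subseteq> edges (G \<omega>)" "\<And>k. k \<in> C \<Longrightarrow> finite (E k)"
    and T: "\<And>k. k \<in> C \<Longrightarrow> T k \<in> sets (PiM (E k) (\<lambda>_. F))"
    and Q: "\<And>\<omega>. \<omega> \<in> space M \<Longrightarrow> Q \<omega> \<longleftrightarrow> restrict (w \<omega>) (E (\<kappa> \<omega>)) \<in> T (\<kappa> \<omega>)"
  shows "(\<lambda>\<omega>. measure (PiM (E (\<kappa> \<omega>)) (\<lambda>_. F)) (T (\<kappa> \<omega>))) \<in> borel_measurable M"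
    and "Measurable.pred M Q"
    and "measure M {\<omega> \<in> space M. Q \<omega>} = (\<integral>\<omega>. measure (PiM (E (\<kappa> \<omega>)) (\<lambda>_. F)) (T (\<kappa> \<omega>)) \<partial>M)"
proof -
  interpret P: product_prob_space "\<lambda>_. F" by (rule product_prob_space_F)
  let ?A = "\<lambda>k. {\<omega> \<in> space M. \<kappa> \<omega> = k}"
  let ?p = "\<lambda>k. measure (PiM (E k) (\<lambda>_. F)) (T k)"
  have prob: "prob_space (PiM (E k) (\<lambda>_. F))" for k by (intro prob_space_PiM F.prob_space_axioms)
  have A: "?A k \<in> sets graph_algebra" if "k \<in> C" for k
    using \<kappa>[OF that] by (simp add: pred_def space_graph_algebra)
  then have AM: "?A k \<in> sets M" if "k \<in> C" for k using that sets_graph_algebra_subset by blast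
  have \<kappa>M: "\<kappa> \<in> measurable M (count_space C)"
    unfolding measurable_count_space_eq_countable[OF C(1)]
  proof (intro conjI ballI funcsetI C(2))
    fix k assume "k \<in> C"
    have "\<kappa> -` {k} \<inter> space M = ?A k" by auto
    then show "\<kappa> -` {k} \<inter> space M \<in> sets M" using AM[OF \<open>k \<in> C\<close>] by simp
  qed
  show pm: "(\<lambda>\<omega>. ?p (\<kappa> \<omega>)) \<in> borel_measurable M"
    by (rule measurable_compose[OF \<kappa>M]) simp
  define X where "X k = {\<omega> \<in> ?A k. restrict (w \<omega>) (E k) \<in> T k}" for k
  have law: "emeasure M (X k) = emeasure M (?A k) * ennreal (?p k)" if "k \<in> C" for k
  proof -
    have "emeasure M (X k) = emeasure M (?A k) * emeasure (PiM (E k) (\<lambda>_. F)) (T k)"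
      unfolding X_def by (rule weights_law[OF A[OF that] _ E(2)[OF that] T[OF that]]) (use E(1) in auto)
    then show ?thesis using finite_measure.emeasure_eq_measure[OF prob_space.finite_measure[OF prob]] by simp
  qed
  have X: "X k \<in> sets M" if "k \<in> C" for k
  proof -
    have "X k = ?A k \<inter> ((\<lambda>\<omega>. restrict (w \<omega>) (E k)) -` T k \<inter> space M)" by (auto simp: X_def)
    then show ?thesis using AM[OF that] measurable_sets[OF restrict_weights_measurable T[OF that]] by auto
  qed
  have QX: "{\<omega> \<in> space M. Q \<omega>} = (\<Union>k\<in>C. X k)" using Q C(2) by (auto simp: X_def)
  then show "Measurable.pred M Q" using X C(1) by (auto simp: pred_def)
  \<comment> \<open>Only the summand for the actual key is nonzero. As an integral over
    \<open>count_space C\<close>, the integrand allows the two integrals to be exchanged.\<close>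
  have ind: "ennreal (?p (\<kappa> \<omega>)) = (\<integral>\<^sup>+k. indicator (?A k) \<omega> * ennreal (?p k) \<partial>count_space C)" if "\<omega> \<in> space M" for \<omega>
  proof -
    have "(\<integral>\<^sup>+k. indicator (?A k) \<omega> * ennreal (?p k) \<partial>count_space C) =
        (\<integral>\<^sup>+k. ennreal (?p k) * indicator {\<kappa> \<omega>} k \<partial>count_space C)"
      using that by (intro nn_integral_cong) (auto simp: indicator_def)
    also have "\<dots> = ennreal (?p (\<kappa> \<omega>))"
      using C(2)[OF that] by (subst nn_integral_indicator_singleton) auto
    finally show ?thesis by simp
  qed
  have "emeasure M {\<omega> \<in> space M. Q \<omega>} = (\<integral>\<^sup>+k. emeasure M (X k) \<partial>count_space C)"
    unfolding QX by (intro emeasure_UN_countable X C) (auto simp: disjoint_family_on_def X_def)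
  also have "\<dots> = (\<integral>\<^sup>+k. \<integral>\<^sup>+\<omega>. indicator (?A k) \<omega> * ennreal (?p k) \<partial>M \<partial>count_space C)"
    using AM by (intro nn_integral_cong) (auto simp: law nn_integral_multc)
  also have "\<dots> = (\<integral>\<^sup>+\<omega>. \<integral>\<^sup>+k. indicator (?A k) \<omega> * ennreal (?p k) \<partial>count_space C \<partial>M)"
    using AM C by (intro nn_integral_count_space_nn_integral[symmetric]) auto
  also have "\<dots> = (\<integral>\<^sup>+\<omega>. ennreal (?p (\<kappa> \<omega>)) \<partial>M)"
    by (intro nn_integral_cong ind[symmetric])
  also have "\<dots> = ennreal (\<integral>\<omega>. ?p (\<kappa> \<omega>) \<partial>M)"
    using pm prob_space.prob_le_1[OF prob]
    by (intro nn_integral_eq_integral integrable_const_bound[where B = 1]) auto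
  finally show "measure M {\<omega> \<in> space M. Q \<omega>} = (\<integral>\<omega>. ?p (\<kappa> \<omega>) \<partial>M)"
    by (simp add: measure_def)
qed

end

text \<open>Some edge lies in exactly one of the two sets. With all other weights fixed, equality of
  the sums prescribes the weight of that edge, which has probability 0; Fubini concludes.\<close>

lemma AE_PiM_sum_neq:
  fixes F :: "real measure"
  assumes F: "prob_space F" "sets F = sets borel" "\<And>t. measure F {t} = 0"
    and E: "finite E" "S \<subseteq> E" "T \<subseteq> E" "S \<noteq> T"
  shows "AE v in PiM E (\<lambda>_. F). sum v S \<noteq> sum v T"
proof -
  interpret F: prob_space F by fact
  interpret P: product_prob_space "\<lambda>_. F" by (intro product_prob_spaceI F)
  have main: "AE v in PiM E (\<lambda>_. F). sum v S \<noteq> sum v T"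
    if S: "S \<subseteq> E" and T: "T \<subseteq> E" and e: "e \<in> S" "e \<notin> T" for S T e
  proof -
    define E' where "E' = E - {e}"
    have E': "E = insert e E'" "finite E'" "e \<notin> E'" using e S E(1) by (auto simp: E'_def)
    let ?Z = "{v \<in> space (PiM E (\<lambda>_. F)). sum v S = sum v T}"
    have comp[measurable]: "(\<lambda>v. v i) \<in> borel_measurable (PiM E (\<lambda>_. F))" if "i \<in> E" for i
      using measurable_component_singleton[OF that, of "\<lambda>_. F"] measurable_cong_sets[OF refl F(2)] by blast
    have [measurable]: "(\<lambda>v. sum v S) \<in> borel_measurable (PiM E (\<lambda>_. F))" "(\<lambda>v. sum v T) \<in> borel_measurable (PiM E (\<lambda>_. F))"
      using S T by (auto intro!: borel_measurable_sum comp)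
    have Z: "?Z \<in> sets (PiM E (\<lambda>_. F))" by measurable
    have "emeasure (PiM E (\<lambda>_. F)) ?Z = (\<integral>\<^sup>+v. indicator ?Z v \<partial>PiM E (\<lambda>_. F))"
      using Z by simp
    also have "\<dots> = (\<integral>\<^sup>+v. (\<integral>\<^sup>+y. indicator ?Z (v(e := y)) \<partial>F) \<partial>PiM E' (\<lambda>_. F))"
      using Z unfolding E'(1) by (intro P.product_nn_integral_insert E') simp
    also have "\<dots> \<le> (\<integral>\<^sup>+v. 0 \<partial>PiM E' (\<lambda>_. F))"
    proof (rule nn_integral_mono)
      fix v assume "v \<in> space (PiM E' (\<lambda>_. F))"
      \<comment> \<open>The only value of the coordinate \<open>e\<close> at which the two sums can
        agree.\<close>
      let ?t = "sum v T - sum v (S - {e})"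
      have "indicator ?Z (v(e := y)) \<le> (indicator {?t} y :: ennreal)" for y
      proof -
        have "sum (v(e := y)) S = y + sum (v(e := y)) (S - {e})"
          using e(1) finite_subset[OF S E(1)] by (simp add: sum.remove)
        moreover have "sum (v(e := y)) (S - {e}) = sum v (S - {e})" by (intro sum.cong) auto
        moreover have "sum (v(e := y)) T = sum v T" using e(2) by (intro sum.cong) auto
        ultimately show ?thesis by (auto simp: indicator_def)
      qed
      then have "(\<integral>\<^sup>+y. indicator ?Z (v(e := y)) \<partial>F) \<le> (\<integral>\<^sup>+y. indicator {?t} y \<partial>F)"
        by (intro nn_integral_mono)
      also have "\<dots> = 0" using F(2,3) by (simp add: F.emeasure_eq_measure)
      finally show "(\<integral>\<^sup>+y. indicator ?Z (v(e := y)) \<partial>F) \<le> 0" .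
    qed
    finally have "emeasure (PiM E (\<lambda>_. F)) ?Z = 0" by simp
    then show ?thesis using Z by (intro AE_I[of _ _ ?Z]) auto
  qed
  from E(4) obtain e where "e \<in> S \<and> e \<notin> T \<or> e \<in> T \<and> e \<notin> S" by blast
  then show ?thesis
  proof
    assume "e \<in> T \<and> e \<notin> S"
    then have "AE v in PiM E (\<lambda>_. F). sum v T \<noteq> sum v S" using main[OF E(3,2)] by blast
    then show ?thesis by (simp add: eq_commute)
  qed (use main[OF E(2,3)] in blast)
qed

lemma AE_PiM_generic:
  fixes F :: "real measure"
  assumes F: "prob_space F" "sets F = sets borel" "\<And>t. measure F {t} = 0"
    and E: "finite (edges B)"
  shows "AE v in PiM (edges B) (\<lambda>_. F). generic B v"
proof -
  have "AE v in PiM (edges B) (\<lambda>_. F). \<forall>S\<in>Pow (edges B). \<forall>T\<in>Pow (edges B). S \<noteq> T \<longrightarrow> sum v S \<noteq> sum v T"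
    using E AE_PiM_sum_neq[OF F E] by (intro AE_finite_allI) (auto simp: AE_conj_iff)
  then show ?thesis
    by eventually_elim (auto simp: generic_def inj_on_def)
qed

section \<open>Correlation decay almost surely\<close>

text \<open>A supremum of values 0 and 1 over a nonempty family is an indicator, so the decay
  coefficient is the probability of instability.\<close>

lemma SUP_disagreement:
  "(SUP A\<in>Pow S. \<bar>of_bool p - of_bool (q A)\<bar> :: real) = of_bool (\<not> (\<forall>A\<subseteq>S. p \<longleftrightarrow> q A))"
proof (cases "\<forall>A\<subseteq>S. p \<longleftrightarrow> q A")
  case True
  then have "(SUP A\<in>Pow S. \<bar>of_bool p - of_bool (q A)\<bar> :: real) = (SUP A\<in>Pow S. 0)"
    by (intro SUP_cong) auto
  also have "\<dots> = 0" by (rule cSUP_const) blast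
  finally show ?thesis using True by simp
next
  case False
  then obtain A where A: "A \<in> Pow S" "p \<noteq> q A" by blast
  have le: "\<bar>of_bool p - of_bool (q B)\<bar> \<le> (1 :: real)" for B by simp
  have "1 = (\<bar>of_bool p - of_bool (q A)\<bar> :: real)" using A(2) by (cases p) auto
  also have "\<dots> \<le> (SUP A\<in>Pow S. \<bar>of_bool p - of_bool (q A)\<bar>)"
    using le by (intro cSUP_upper A(1) bdd_aboveI2)
  finally have "1 \<le> (SUP A\<in>Pow S. \<bar>of_bool p - of_bool (q A)\<bar> :: real)" .
  moreover have "(SUP A\<in>Pow S. \<bar>of_bool p - of_bool (q A)\<bar> :: real) \<le> 1"
    using le by (intro cSUP_least) auto
  ultimately have "(SUP A\<in>Pow S. \<bar>of_bool p - of_bool (q A)\<bar> :: real) = 1" by (rule antisym[rotated])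
  also have "\<dots> = of_bool (\<not> (\<forall>A\<subseteq>S. p \<longleftrightarrow> q A))" using False by simp
  finally show ?thesis .
qed

lemma component_PiM_measurable:
  fixes F :: "real measure"
  assumes "sets F = sets borel" "e \<in> E"
  shows "(\<lambda>v. v e) \<in> borel_measurable (PiM E (\<lambda>_. F))"
  using measurable_component_singleton[OF assms(2), of "\<lambda>_. F"] measurable_cong_sets[OF refl assms(1)] by blast

lemma finite_boundary: "finite (verts B) \<Longrightarrow> finite (boundary G B)"
  by (rule rev_finite_subset) (auto simp: boundary_def)

text \<open>Stability inspects only the edges of the ball, so the product over all edges of
  \<open>G\<close> projects to these finitely many coordinates.\<close>

lemma corr_decay_coeff_eq:
  fixes F :: "real measure" and G :: "nat graph"
  assumes F: "prob_space F" "sets F = sets borel" and G: "ugraph G" "locally_finite G" and e: "finite e"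
  shows "corr_decay_coeff F G e s =
    measure (PiM (edges (gball G e s)) (\<lambda>_. F))
      {v \<in> space (PiM (edges (gball G e s)) (\<lambda>_. F)). \<not> stable (gball G e s) (boundary G (gball G e s)) e v}"
proof -
  interpret P: product_prob_space "\<lambda>_. F" "edges G" by (intro product_prob_spaceI F)
  let ?B = "gball G e s" and ?J = "PiM (edges (gball G e s)) (\<lambda>_. F)" and ?I = "PiM (edges G) (\<lambda>_. F)"
  let ?S = "boundary G ?B"
  have B: "finite (verts ?B)" "finite (edges ?B)" "edges ?B \<subseteq> edges G"
    using finite_verts_gball[OF G e] finite_edges[OF ugraph_gball[OF G(1)]] by (auto simp: edges_gball)
  have J: "{v \<in> space ?J. \<not> stable ?B ?S e v} \<in> sets ?J"
    by (intro predE pred_intros_logic pred_stable B(2) finite_boundary[OF B(1)] component_PiM_measurable[OF F(2)])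
  have "corr_decay_coeff F G e s = (\<integral>v. of_bool (\<not> stable ?B ?S e v) \<partial>?I)"
    by (simp add: corr_decay_coeff_def Let_def SUP_disagreement stable_def)
  also have "\<dots> = (\<integral>v. indicator {v \<in> space ?I. \<not> stable ?B ?S e v} v \<partial>?I)"
    by (intro Bochner_Integration.integral_cong) (auto simp: indicator_def)
  also have "\<dots> = measure ?I {v \<in> space ?I. \<not> stable ?B ?S e v}" by (simp add: Int_absorb2 subset_iff)
  also have "{v \<in> space ?I. \<not> stable ?B ?S e v} =
      (\<lambda>v. restrict v (edges ?B)) -` {v \<in> space ?J. \<not> stable ?B ?S e v} \<inter> space ?I"
  proof -
    have "stable ?B ?S e (restrict v (edges ?B)) \<longleftrightarrow> stable ?B ?S e v" for v by (rule stable_cong) simp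
    then show ?thesis using B(3) by (auto simp: space_PiM)
  qed
  also have "measure ?I \<dots> = measure (distr ?I ?J (\<lambda>v. restrict v (edges ?B))) {v \<in> space ?J. \<not> stable ?B ?S e v}"
    using J measurable_restrict_subset[OF B(3), of "\<lambda>_. F"] by (subst measure_distr) auto
  also have "distr ?I ?J (\<lambda>v. restrict v (edges ?B)) = ?J"
    by (rule P.distr_PiM_restrict_finite[OF B(2,3)])
  finally show ?thesis .
qed

context weighted_graph
begin

text \<open>One stable radius per edge is enough. Instability at all radii is contained in each
  single instability event, and the probabilities of these tend to 0 by dominated convergence of the
  coefficients.\<close>

lemma AE_stable:
  assumes decay: "AE \<omega> in M. correlation_decay F (G \<omega>)"
  shows "AE \<omega> in M. \<forall>e\<in>edges (G \<omega>). \<exists>s. stable (gball (G \<omega>) e s) (boundary (G \<omega>) (gball (G \<omega>) e s)) e (w \<omega>)"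
proof -
  let ?st = "\<lambda>\<omega> e s v. stable (gball (G \<omega>) e s) (boundary (G \<omega>) (gball (G \<omega>) e s)) e v"
  have "AE \<omega> in M. e \<in> edges (G \<omega>) \<longrightarrow> (\<exists>s. ?st \<omega> e s (w \<omega>))" if e: "finite e" for e
  proof -
    define Q where "Q s \<omega> \<longleftrightarrow> e \<in> edges (G \<omega>) \<and> \<not> ?st \<omega> e s (w \<omega>)" for s \<omega>
    \<comment> \<open>The boundary belongs to the key, since the ball alone does not determine
      it.\<close>
    define \<kappa> where "\<kappa> s \<omega> = (gball (G \<omega>) e s, boundary (G \<omega>) (gball (G \<omega>) e s))" for s \<omega>
    define T where "T k = {v \<in> space (PiM (edges (fst k)) (\<lambda>_. F)). e \<in> edges (fst k) \<and> \<not> stable (fst k) (snd k) e v}" for k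
    define p where "p s \<omega> = measure (PiM (edges (fst (\<kappa> s \<omega>))) (\<lambda>_. F)) (T (\<kappa> s \<omega>))" for s \<omega>
    let ?C = "fin_graphs \<times> {A :: nat set. finite A}"
    have C: "countable ?C" by (intro countable_SIGMA countable_fin_graphs countable_Collect_finite)
    have \<kappa>C: "\<kappa> s \<omega> \<in> ?C" if "\<omega> \<in> space M" for s \<omega>
      using ball_fin_graphs[OF that e, of s] by (auto simp: \<kappa>_def fin_graphs_def intro: finite_boundary)
    have \<kappa>m: "Measurable.pred graph_algebra (\<lambda>\<omega>. \<kappa> s \<omega> = k)" if "k \<in> ?C" for s k
    proof -
      interpret A: measurable_graph graph_algebra G x by (rule measurable_graph_graph_algebra)
      have "\<kappa> s \<omega> = k \<longleftrightarrow> gball (G \<omega>) e s = fst k \<and> boundary (G \<omega>) (fst k) = snd k" for \<omega>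
        by (cases k) (auto simp: \<kappa>_def)
      then show ?thesis
        using that by (simp only:) (intro pred_intros_logic A.pred_gball_eq A.pred_boundary_eq;
          auto simp: fin_graphs_def)
    qed
    have E: "edges (fst (\<kappa> s \<omega>)) \<subseteq> edges (G \<omega>)" for s \<omega> by (auto simp: \<kappa>_def edges_gball)
    have fin: "finite (edges (fst k))" "finite (snd k)" if "k \<in> ?C" for k
      using that finite_edges by (auto simp: fin_graphs_def)
    have T: "T k \<in> sets (PiM (edges (fst k)) (\<lambda>_. F))" if "k \<in> ?C" for k
      unfolding T_def
      by (intro predE pred_intros_logic pred_stable pred_intros_conj1' fin that component_PiM_measurable[OF sets_F])
    have Q: "Q s \<omega> \<longleftrightarrow> restrict (w \<omega>) (edges (fst (\<kappa> s \<omega>))) \<in> T (\<kappa> s \<omega>)" if \<omega>: "\<omega> \<in> space M" for s \<omega>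
    proof -
      have "restrict (w \<omega>) (edges (fst (\<kappa> s \<omega>))) \<in> space (PiM (edges (fst (\<kappa> s \<omega>))) (\<lambda>_. F))"
        by (rule measurable_space[OF restrict_weights_measurable \<omega>])
      moreover have "e \<in> edges (gball (G \<omega>) e s) \<longleftrightarrow> e \<in> edges (G \<omega>)"
        using edges_gball_edge[of e "G \<omega>" s] edges_gball[of e "G \<omega>" e s] by blast
      moreover have "stable (fst (\<kappa> s \<omega>)) S e (restrict (w \<omega>) (edges (fst (\<kappa> s \<omega>)))) \<longleftrightarrow> stable (fst (\<kappa> s \<omega>)) S e (w \<omega>)" for S
        by (rule stable_cong) simp
      ultimately show ?thesis by (simp add: Q_def T_def) (simp add: \<kappa>_def)
    qed
    note law = weights_law_key[where \<kappa> = "\<kappa> s" and C = ?C and E = "\<lambda>k. edges (fst k)" and T = T and Q = "Q s" for s,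
        OF C \<kappa>C \<kappa>m E fin(1) T Q, folded p_def]
    have p0: "AE \<omega> in M. (\<lambda>s. p s \<omega>) \<longlonglongrightarrow> 0"
      using decay AE_space
    proof eventually_elim
      case (elim \<omega>)
      show ?case
      proof (cases "e \<in> edges (G \<omega>)")
        case True
        have "p s \<omega> = corr_decay_coeff F (G \<omega>) e s" for s
          unfolding corr_decay_coeff_eq[OF F.prob_space_axioms sets_F ugraph[OF elim(2)] locally_finite[OF elim(2)] e]
          using edges_gball_edge[OF True] by (simp add: p_def T_def \<kappa>_def)
        then show ?thesis using elim(1) True by (simp add: correlation_decay_def)
      next
        case False
        then have "T (\<kappa> s \<omega>) = {}" for s by (auto simp: T_def \<kappa>_def edges_gball)
        then show ?thesis by (simp add: p_def)
      qed
    qed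
    have p1: "\<bar>p s \<omega>\<bar> \<le> 1" for s \<omega>
      unfolding p_def using prob_space.prob_le_1[OF prob_space_PiM] F.prob_space_axioms by (simp add: abs_of_nonneg)
    have "(\<lambda>s. \<integral>\<omega>. p s \<omega> \<partial>M) \<longlonglongrightarrow> (\<integral>\<omega>. 0 \<partial>M)"
      using law(1) p0 p1 by (intro integral_dominated_convergence[where w = "\<lambda>_. 1"]) auto
    then have lim: "(\<lambda>s. measure M {\<omega> \<in> space M. Q s \<omega>}) \<longlonglongrightarrow> 0" by (simp add: law(3))
    let ?N = "{\<omega> \<in> space M. \<forall>s. Q s \<omega>}"
    have N: "?N \<in> sets M" by (intro predE pred_intros_countable law(2))
    have "measure M ?N \<le> measure M {\<omega> \<in> space M. Q s \<omega>}" for s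
      by (intro finite_measure_mono predE law(2)) auto
    then have "measure M ?N \<le> 0" by (intro LIMSEQ_le_const[OF lim]) blast
    then have "emeasure M ?N = 0" by (simp add: emeasure_eq_measure measure_le_0_iff)
    then show ?thesis using N by (intro AE_I[of _ _ ?N]) (auto simp: Q_def)
  qed
  \<comment> \<open>Edges are finite sets of natural numbers, so the null sets of countably many
    candidates cover every random edge.\<close>
  then have "AE \<omega> in M. \<forall>e\<in>{e. finite e}. e \<in> edges (G \<omega>) \<longrightarrow> (\<exists>s. ?st \<omega> e s (w \<omega>))"
    by (subst AE_ball_countable[OF countable_Collect_finite]) blast
  with AE_space show ?thesis
    by eventually_elim (use finite_edge[OF ugraph] in blast)
qed

text \<open>Each fixed finite graph contributes a null set, by \<open>weights_law\<close> on the
  event that it is a subgraph, and there are countably many of them.\<close>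

lemma AE_generic:
  assumes F0: "\<And>t. measure F {t} = 0"
  shows "AE \<omega> in M. \<forall>B\<in>fin_graphs. subgraph B (G \<omega>) \<longrightarrow> generic B (w \<omega>)"
proof -
  have "AE \<omega> in M. subgraph B (G \<omega>) \<longrightarrow> generic B (w \<omega>)" if B: "B \<in> fin_graphs" for B
  proof -
    have fin: "finite (edges B)" using B finite_edges by (auto simp: fin_graphs_def)
    define A where "A = {\<omega> \<in> space M. subgraph B (G \<omega>)}"
    define T where "T = {v \<in> space (PiM (edges B) (\<lambda>_. F)). \<not> generic B v}"
    have A: "A \<in> sets graph_algebra"
      using measurable_graph.pred_subgraph[OF measurable_graph_graph_algebra B]
      by (simp add: pred_def space_graph_algebra A_def)
    have AE: "edges B \<subseteq> edges (G \<omega>)" if "\<omega> \<in> A" for \<omega> using that by (auto simp: A_def subgraph_def)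
    have T: "T \<in> sets (PiM (edges B) (\<lambda>_. F))"
      unfolding T_def by (intro predE pred_intros_logic pred_generic fin component_PiM_measurable[OF sets_F])
    let ?N = "{\<omega> \<in> A. restrict (w \<omega>) (edges B) \<in> T}"
    have "emeasure (PiM (edges B) (\<lambda>_. F)) T = 0"
      using AE_PiM_generic[OF F.prob_space_axioms sets_F F0 fin] T
      by (subst (asm) AE_iff_measurable[of T]) (auto simp: T_def)
    then have "emeasure M ?N = 0" using weights_law[OF A AE fin T] by simp
    moreover have "?N \<in> sets M"
    proof -
      have "?N = A \<inter> ((\<lambda>\<omega>. restrict (w \<omega>) (edges B)) -` T \<inter> space M)" by (auto simp: A_def)
      then show ?thesis
        using A sets_graph_algebra_subset measurable_sets[OF restrict_weights_measurable T] by auto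
    qed
    moreover have "\<omega> \<in> ?N" if "\<omega> \<in> space M" "subgraph B (G \<omega>)" "\<not> generic B (w \<omega>)" for \<omega>
    proof -
      have "generic B (restrict (w \<omega>) (edges B)) \<longleftrightarrow> generic B (w \<omega>)" by (rule generic_cong) simp
      then show ?thesis
        using that measurable_space[OF restrict_weights_measurable that(1), of "edges B"] by (simp add: A_def T_def)
    qed
    ultimately show ?thesis by (intro AE_I[of _ _ ?N]) auto
  qed
  then show ?thesis by (subst AE_ball_countable[OF countable_fin_graphs]) blast
qed

end

section \<open>Transfer along the convergence of the graphs\<close>

definition good_prob ::
    "real measure \<Rightarrow> (real \<times> real) marked_class set \<Rightarrow> nat \<Rightarrow> nat graph \<Rightarrow> nat \<Rightarrow> real" where
  "good_prob F U R B x = measure (PiM (edges B) (\<lambda>_. F))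
     {v \<in> space (PiM (edges B) (\<lambda>_. F)). good_ball U R B x v}"

text \<open>Relabelling coordinates along an isomorphism carries the product law on
  \<open>B'\<close> to the one on \<open>B\<close>; \<open>good_ball_iso\<close>, applied in both
  directions, matches the events.\<close>

lemma good_prob_iso:
  assumes F: "prob_space F" "sets F = sets borel"
    and iso: "graph_iso \<phi> B B'" and B: "ugraph B" "finite (verts B)" "x \<in> verts B"
  shows "good_prob F U R B x = good_prob F U R B' (\<phi> x)"
proof -
  let ?P = "PiM (edges B) (\<lambda>_. F)" and ?P' = "PiM (edges B') (\<lambda>_. F)"
  let ?t = "\<lambda>v. \<lambda>e\<in>edges B. v (\<phi> ` e)"
  have E: "edges B' = (\<lambda>e. \<phi> ` e) ` edges B" and V: "\<phi> ` verts B = verts B'"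
    using iso by (auto simp: graph_iso_def bij_betw_def)
  have fin: "finite (edges B)" by (rule finite_edges[OF B(1,2)])
  have B': "ugraph B'" "finite (verts B')" "\<phi> x \<in> verts B'"
  proof -
    show "ugraph B'"
    proof (rule ugraphI)
      fix e assume "e \<in> edges B'"
      then obtain u v where "e = \<phi> ` {u, v}" "u \<noteq> v" "u \<in> verts B" "v \<in> verts B"
        unfolding E by (auto elim!: ugraph_doubleton_cases[OF B(1)])
      then show "\<exists>u v. u \<in> verts B' \<and> v \<in> verts B' \<and> u \<noteq> v \<and> e = {u, v}"
        using iso V by (intro exI[of _ "\<phi> u"] exI[of _ "\<phi> v"]) (auto simp: graph_iso_def bij_betw_def inj_on_def)
    qed
  qed (use B in \<open>simp_all add: V[symmetric]\<close>)
  let ?\<psi> = "inv_into (verts B) \<phi>"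
  have \<psi>x: "?\<psi> (\<phi> x) = x" using iso B(3) by (simp add: graph_iso_def bij_betw_def)
  have iff: "good_ball U R B x (?t v) \<longleftrightarrow> good_ball U R B' (\<phi> x) v" for v
  proof
    assume "good_ball U R B x (?t v)"
    then show "good_ball U R B' (\<phi> x) v" by (rule good_ball_iso[OF iso B, rotated]) simp
  next
    assume *: "good_ball U R B' (\<phi> x) v"
    have "good_ball U R B (?\<psi> (\<phi> x)) (?t v)"
    proof (rule good_ball_iso[OF graph_iso_inv[OF iso B(1)] B' _ *])
      fix e' assume "e' \<in> edges B'"
      then obtain e where e: "e \<in> edges B" "e' = \<phi> ` e" unfolding E by blast
      then show "?t v (?\<psi> ` e') = v e'" using inv_into_edge[OF iso B(1) e(1)] by simp
    qed
    then show "good_ball U R B x (?t v)" by (simp only: \<psi>x)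
  qed
  have sets: "{v \<in> space ?P. good_ball U R B x v} \<in> sets ?P"
    by (intro predE pred_good_ball B(1,2) component_PiM_measurable[OF F(2)])
  have t: "?t \<in> measurable ?P' ?P"
    using E by (intro measurable_restrict measurable_component_singleton) auto
  have "distr ?P' ?P ?t = ?P"
    using E inj_on_edges_iso[OF iso B(1)] F(1)
      distr_PiM_reindex[of "edges B'" "\<lambda>_. F" "\<lambda>e. \<phi> ` e" "edges B"] by auto
  then have "good_prob F U R B x = measure (distr ?P' ?P ?t) {v \<in> space ?P. good_ball U R B x v}"
    by (simp add: good_prob_def)
  also have "\<dots> = measure ?P' (?t -` {v \<in> space ?P. good_ball U R B x v} \<inter> space ?P')"
    by (rule measure_distr[OF t sets])
  also have "?t -` {v \<in> space ?P. good_ball U R B x v} \<inter> space ?P' = {v \<in> space ?P'. good_ball U R B' (\<phi> x) v}"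
    using measurable_space[OF t] iff by auto
  finally show ?thesis by (simp add: good_prob_def)
qed

lemma (in weighted_graph) prob_good_ball:
  shows "Measurable.pred M (\<lambda>\<omega>. good_ball U R (gball (G \<omega>) {x \<omega>} R) (x \<omega>) (w \<omega>))"
    and "measure M {\<omega> \<in> space M. good_ball U R (gball (G \<omega>) {x \<omega>} R) (x \<omega>) (w \<omega>)} =
      (\<integral>\<omega>. good_prob F U R (gball (G \<omega>) {x \<omega>} R) (x \<omega>) \<partial>M)"
proof -
  \<comment> \<open>No boundary in this key: goodness refers to the sphere, which the ball and its
    root determine.\<close>
  define \<kappa> where "\<kappa> \<omega> = (gball (G \<omega>) {x \<omega>} R, x \<omega>)" for \<omega>
  define T where "T k = {v \<in> space (PiM (edges (fst k)) (\<lambda>_. F)). good_ball U R (fst k) (snd k) v}" for k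
  let ?C = "fin_graphs \<times> (UNIV :: nat set)"
  have C: "countable ?C" by (intro countable_SIGMA countable_fin_graphs) auto
  have \<kappa>C: "\<kappa> \<omega> \<in> ?C" if "\<omega> \<in> space M" for \<omega>
    using ball_fin_graphs[OF that, of "{x \<omega>}" R] by (simp add: \<kappa>_def)
  have \<kappa>m: "Measurable.pred graph_algebra (\<lambda>\<omega>. \<kappa> \<omega> = k)" if "k \<in> ?C" for k
  proof -
    interpret A: measurable_graph graph_algebra G x by (rule measurable_graph_graph_algebra)
    have "ugraph (fst k)" using that by (auto simp: fin_graphs_def)
    then have "Measurable.pred graph_algebra (\<lambda>\<omega>. gball (G \<omega>) {x \<omega>} R = fst k \<and> x \<omega> = snd k)"
      by (intro pred_intros_logic A.pred_root_ball_eq pred_count_space_const1 A.x_measurable)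
    then show ?thesis by (simp add: \<kappa>_def prod_eq_iff)
  qed
  have E: "edges (fst (\<kappa> \<omega>)) \<subseteq> edges (G \<omega>)" for \<omega> by (auto simp: \<kappa>_def edges_gball)
  have fin: "ugraph (fst k)" "finite (verts (fst k))" "finite (edges (fst k))" if "k \<in> ?C" for k
    using that finite_edges by (auto simp: fin_graphs_def)
  have T: "T k \<in> sets (PiM (edges (fst k)) (\<lambda>_. F))" if "k \<in> ?C" for k
    unfolding T_def by (intro predE pred_good_ball fin that component_PiM_measurable[OF sets_F])
  have Q: "good_ball U R (gball (G \<omega>) {x \<omega>} R) (x \<omega>) (w \<omega>) \<longleftrightarrow> restrict (w \<omega>) (edges (fst (\<kappa> \<omega>))) \<in> T (\<kappa> \<omega>)"
    if \<omega>: "\<omega> \<in> space M" for \<omega>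
  proof -
    have "good_ball U R (fst (\<kappa> \<omega>)) (x \<omega>) (restrict (w \<omega>) (edges (fst (\<kappa> \<omega>)))) \<longleftrightarrow>
        good_ball U R (fst (\<kappa> \<omega>)) (x \<omega>) (w \<omega>)" by (rule good_ball_cong) simp
    then show ?thesis
      using measurable_space[OF restrict_weights_measurable \<omega>, of "edges (fst (\<kappa> \<omega>))"]
      by (simp add: T_def) (simp add: \<kappa>_def)
  qed
  note law = weights_law_key[where \<kappa> = \<kappa> and C = ?C and E = "\<lambda>k. edges (fst k)" and T = T,
      OF C \<kappa>C \<kappa>m E fin(3) T Q]
  show "Measurable.pred M (\<lambda>\<omega>. good_ball U R (gball (G \<omega>) {x \<omega>} R) (x \<omega>) (w \<omega>))" by (rule law(2))
  have "measure M {\<omega> \<in> space M. good_ball U R (gball (G \<omega>) {x \<omega>} R) (x \<omega>) (w \<omega>)} =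
      (\<integral>\<omega>. measure (PiM (edges (fst (\<kappa> \<omega>))) (\<lambda>_. F)) (T (\<kappa> \<omega>)) \<partial>M)" by (rule law(3))
  then show "measure M {\<omega> \<in> space M. good_ball U R (gball (G \<omega>) {x \<omega>} R) (x \<omega>) (w \<omega>)} =
      (\<integral>\<omega>. good_prob F U R (gball (G \<omega>) {x \<omega>} R) (x \<omega>) \<partial>M)"
    by (simp only: good_prob_def T_def \<kappa>_def fst_conv snd_conv)
qed

section \<open>The probability of goodness as a continuous function of the rooted class\<close>

definition good_class_prob ::
    "real measure \<Rightarrow> (real \<times> real) marked_class set \<Rightarrow> nat \<Rightarrow> rooted_class \<Rightarrow> real" where
  "good_class_prob F U R c = (case rep_rooted_class c of (H, y) \<Rightarrow> good_prob F U R (gball H {y} R) y)"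

lemma rooted_equiv_rep: "rooted_equiv (rep_rooted_class c) (rep_rooted_class c)"
  by (rule Quotient3_rep_reflp[OF Quotient3_rooted_class])

text \<open>\<open>good_class_prob\<close> reads off a chosen representative; this makes its value
  independent of the choice and a function of the \<open>R\<close>-ball alone.\<close>

lemma good_prob_ball_iso:
  assumes F: "prob_space F" "sets F = sets borel"
    and G: "rooted_graph G x" and iso: "rooted_iso \<phi> (rooted_ball (G, x) R) (rooted_ball (H, y) R)"
  shows "good_prob F U R (gball G {x} R) x = good_prob F U R (gball H {y} R) y"
proof -
  have G': "ugraph G" "locally_finite G" "x \<in> verts G" using G by (auto simp: rooted_graph_def)
  have "x \<in> verts (gball G {x} R)" using G'(3) gdist_self_le[of G x R] by (simp add: verts_gball)
  then show ?thesis
    using good_prob_iso[OF F, of \<phi> "gball G {x} R" "gball H {y} R" x] iso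
      ugraph_gball[OF G'(1)] finite_verts_gball[OF G'(1,2)]
    by (auto simp: rooted_iso_def rooted_ball_def)
qed

lemma good_class_prob_graph_class:
  assumes F: "prob_space F" "sets F = sets borel"
    and G: "ugraph G" "locally_finite G" "x \<in> verts G"
  shows "good_class_prob F U R (graph_class G x) = good_prob F U R (gball G {x} R) x"
proof -
  let ?g = "(component G x, x)"
  have rooted: "rooted_graph (component G x) x" by (rule rooted_graph_component[OF G])
  then have "rooted_equiv ?g ?g" using rooted_iso_refl by (fastforce simp: rooted_equiv_def)
  from part_equivp_symp[OF part_equivp_rooted_equiv Quotient3_rep_abs[OF Quotient3_rooted_class this]]
  have "rooted_equiv ?g (rep_rooted_class (graph_class G x))" by (simp only: graph_class_def)
  moreover obtain H y where Hy: "rep_rooted_class (graph_class G x) = (H, y)" by (cases "rep_rooted_class (graph_class G x)")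
  ultimately obtain \<phi> where "rooted_iso \<phi> ?g (H, y)" by (auto simp: rooted_equiv_def)
  then have "rooted_iso \<phi> (rooted_ball ?g R) (rooted_ball (H, y) R)"
    using rooted by (intro rooted_ball_iso) auto
  from good_prob_ball_iso[OF F rooted this] show ?thesis
    by (simp add: good_class_prob_def Hy gball_component)
qed

text \<open>Ensures that the supremum in \<open>d_loc\<close> runs over a nonempty set; an empty one
  would be minus infinity.\<close>

lemma rooted_iso_ball_0:
  assumes "rooted_graph G x" "rooted_graph H y"
  shows "rooted_iso (\<lambda>_. y) (rooted_ball (G, x) 0) (rooted_ball (H, y) 0)"
proof -
  have ball: "gball G {x} 0 = Graph {x} {}" if "rooted_graph G x" for G and x :: nat
  proof -
    have G: "ugraph G" "x \<in> verts G" using that by (auto simp: rooted_graph_def)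
    have d: "gdist G x v \<le> enat 0 \<longleftrightarrow> v = x" for v unfolding gdist_le_iff by auto
    have "v \<in> verts (gball G {x} 0) \<longleftrightarrow> v = x" for v using d[of v] G(2) by (auto simp: verts_gball)
    then have "verts (gball G {x} 0) = {x}" by auto
    moreover have "e \<notin> edges (gball G {x} 0)" for e
    proof
      assume "e \<in> edges (gball G {x} 0)"
      then have "e \<in> edges G" "\<forall>v\<in>e. v = x" using d by (auto simp: edges_gball)
      then show False by (auto elim!: ugraph_doubleton_cases[OF G(1)])
    qed
    ultimately show ?thesis by (intro graph.expand) auto
  qed
  show ?thesis
    by (simp add: rooted_iso_def rooted_ball_def ball[OF assms(1)] ball[OF assms(2)] graph_iso_def)
qed

text \<open>Radii of agreement are downward closed. If \<open>R\<close> is not among them, their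
  supremum is at most \<open>R\<close> and the distance is at least
  \<open>1 / (R + 1)\<close>.\<close>

lemma d_loc_less_imp_iso:
  assumes "d_loc c c' < 1 / (real R + 1)"
  shows "\<exists>\<phi>. rooted_iso \<phi> (rooted_ball (rep_rooted_class c) R) (rooted_ball (rep_rooted_class c') R)"
proof (rule ccontr)
  obtain G x H y where reps: "rep_rooted_class c = (G, x)" "rep_rooted_class c' = (H, y)"
    by (meson surj_pair)
  have G: "rooted_graph G x" "rooted_graph H y"
    using rooted_equiv_rep[of c] rooted_equiv_rep[of c'] by (auto simp: reps rooted_equiv_def)
  let ?S = "{r. \<exists>\<phi>. rooted_iso \<phi> (rooted_ball (G, x) r) (rooted_ball (H, y) r)}"
  assume *: "\<not> ?thesis"
  have "r \<le> R" if "r \<in> ?S" for r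
  proof (rule ccontr)
    assume "\<not> r \<le> R"
    then have "\<exists>\<phi>. rooted_iso \<phi> (rooted_ball (G, x) R) (rooted_ball (H, y) R)"
      using that rooted_ball_le[of _ G x r H y R] G by (auto simp: rooted_graph_def)
    with * show False by (simp add: reps)
  qed
  then have ub: "(SUP r\<in>?S. ereal (real r)) \<le> ereal (real R)" by (intro SUP_least) auto
  have "0 \<in> ?S" using rooted_iso_ball_0[OF G] by blast
  then have lb: "0 \<le> (SUP r\<in>?S. ereal (real r))" by (intro SUP_upper2[of 0]) auto
  obtain s where s: "(SUP r\<in>?S. ereal (real r)) = ereal s" "0 \<le> s" "s \<le> real R"
    using ub lb by (cases "SUP r\<in>?S. ereal (real r)") auto
  have "d_loc c c' = real_of_ereal (1 / ((SUP r\<in>?S. ereal (real r)) + 1))"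
    by (simp add: d_loc_def reps)
  also have "\<dots> = 1 / (s + 1)" using s(2) by (simp add: s(1) one_ereal_def)
  also have "\<dots> \<ge> 1 / (real R + 1)" using s(2,3) by (intro divide_left_mono) auto
  finally show False using assms by simp
qed

text \<open>The function is even locally constant: classes closer than \<open>1 / (R + 1)\<close>
  have isomorphic \<open>R\<close>-balls.\<close>

lemma continuous_good_class_prob:
  assumes F: "prob_space F" "sets F = sets borel"
  shows "continuous_on UNIV (good_class_prob F U R)"
proof -
  have "open (good_class_prob F U R -` V)" for V :: "real set"
    unfolding open_rooted_class_def
  proof
    fix c assume c: "c \<in> good_class_prob F U R -` V"
    have "good_class_prob F U R c' = good_class_prob F U R c" if d: "d_loc c c' < 1 / (real R + 1)" for c'
    proof -
      obtain G x H y where reps: "rep_rooted_class c = (G, x)" "rep_rooted_class c' = (H, y)"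
        by (meson surj_pair)
      have "rooted_graph G x" using rooted_equiv_rep[of c] by (simp add: reps rooted_equiv_def)
      then show ?thesis
        using d_loc_less_imp_iso[OF d] good_prob_ball_iso[OF F]
        by (fastforce simp: reps good_class_prob_def)
    qed
    then show "\<exists>\<epsilon>>0. \<forall>y. d_loc c y < \<epsilon> \<longrightarrow> y \<in> good_class_prob F U R -` V"
      using c by (intro exI[of _ "1 / (real R + 1)"]) auto
  qed
  then show ?thesis by (simp add: continuous_on_open_vimage)
qed

lemma good_class_prob_bounded:
  assumes "prob_space F"
  shows "bounded (range (good_class_prob F U R))"
proof (rule boundedI[of _ 1])
  fix p assume "p \<in> range (good_class_prob F U R)"
  then obtain B x where "p = good_prob F U R B x" by (auto simp: good_class_prob_def split: prod.splits)
  then show "norm p \<le> 1"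
    using prob_space.prob_le_1[OF prob_space_PiM] assms by (simp add: good_prob_def)
qed

section \<open>Weak convergence from lower bounds on open sets\<close>

text \<open>Lower bounds on open half-lines determine the limit of the distribution functions:
  \<open>X n < t\<close> bounds them from below, and the complement of \<open>t < X n\<close> from
  above.\<close>

lemma expectation_convergence:
  fixes X :: "nat \<Rightarrow> 'a \<Rightarrow> real" and X' :: "'b \<Rightarrow> real"
  assumes M: "\<And>n. prob_space (M n)" "prob_space M'"
    and X: "\<And>n. X n \<in> borel_measurable (M n)" "X' \<in> borel_measurable M'"
    and bdd: "\<And>n \<omega>. \<bar>X n \<omega>\<bar> \<le> C" "\<And>\<omega>. \<bar>X' \<omega>\<bar> \<le> C"
    and gt: "\<And>t c. c < measure M' {\<omega> \<in> space M'. t < X' \<omega>} \<Longrightarrow>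
      \<forall>\<^sub>F n in sequentially. c < measure (M n) {\<omega> \<in> space (M n). t < X n \<omega>}"
    and lt: "\<And>t c. c < measure M' {\<omega> \<in> space M'. X' \<omega> < t} \<Longrightarrow>
      \<forall>\<^sub>F n in sequentially. c < measure (M n) {\<omega> \<in> space (M n). X n \<omega> < t}"
  shows "(\<lambda>n. \<integral>\<omega>. X n \<omega> \<partial>M n) \<longlonglongrightarrow> (\<integral>\<omega>. X' \<omega> \<partial>M')"
proof -
  let ?D = "\<lambda>n. distr (M n) borel (X n)" and ?D' = "distr M' borel X'"
  have [measurable]: "X n \<in> borel_measurable (M n)" "X' \<in> borel_measurable M'" for n by fact+
  have dist: "real_distribution (?D n)" "real_distribution ?D'" for n
    using prob_space.real_distribution_distr[OF M(1) X(1)] prob_space.real_distribution_distr[OF M(2) X(2)] by auto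
  have split: "measure N {\<omega> \<in> space N. Y \<omega> \<le> t} = 1 - measure N {\<omega> \<in> space N. t < Y \<omega>}"
    if "prob_space N" "Y \<in> borel_measurable N" for N :: "'c measure" and Y :: "'c \<Rightarrow> real" and t
  proof -
    have [measurable]: "Y \<in> borel_measurable N" by fact
    have "{\<omega> \<in> space N. t < Y \<omega>} = space N - {\<omega> \<in> space N. Y \<omega> \<le> t}" by auto
    then show ?thesis using prob_space.prob_compl[OF that(1), of "{\<omega> \<in> space N. Y \<omega> \<le> t}"] by simp
  qed
  have cdf: "cdf (distr N borel Y) t = measure N {\<omega> \<in> space N. Y \<omega> \<le> t}"
    if "Y \<in> borel_measurable N" for N :: "'c measure" and Y :: "'c \<Rightarrow> real" and t
    unfolding cdf_def2 using that by (subst measure_distr) (auto simp: vimage_def Int_def conj_commute)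
  have "weak_conv_m ?D ?D'"
    unfolding weak_conv_m_def weak_conv_def
  proof (intro allI impI)
    fix t assume t: "isCont (cdf ?D') t"
    have "measure ?D' {t} = 0"
      using t finite_borel_measure.isCont_cdf[OF real_distribution.finite_borel_measure_M[OF dist(2)]] by blast
    moreover have "X' -` {t} \<inter> space M' = {\<omega> \<in> space M'. X' \<omega> = t}" by auto
    \<comment> \<open>A continuity point carries no mass, so the lower bound on the open half-line
      serves for the closed one.\<close>
    ultimately have t0: "measure M' {\<omega> \<in> space M'. X' \<omega> = t} = 0" by (simp add: measure_distr)
    have "{\<omega> \<in> space M'. X' \<omega> \<le> t} = {\<omega> \<in> space M'. X' \<omega> < t} \<union> {\<omega> \<in> space M'. X' \<omega> = t}" by auto
    then have le: "measure M' {\<omega> \<in> space M'. X' \<omega> \<le> t} \<le> measure M' {\<omega> \<in> space M'. X' \<omega> < t}"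
      using measure_Un_le[of "{\<omega> \<in> space M'. X' \<omega> < t}" M' "{\<omega> \<in> space M'. X' \<omega> = t}"] t0 by simp
    show "(\<lambda>n. cdf (?D n) t) \<longlonglongrightarrow> cdf ?D' t"
      unfolding cdf[OF X(1)] cdf[OF X(2)]
    proof (rule order_tendstoI)
      fix c assume "c < measure M' {\<omega> \<in> space M'. X' \<omega> \<le> t}"
      then have "\<forall>\<^sub>F n in sequentially. c < measure (M n) {\<omega> \<in> space (M n). X n \<omega> < t}"
        using le by (intro lt) simp
      then show "\<forall>\<^sub>F n in sequentially. c < measure (M n) {\<omega> \<in> space (M n). X n \<omega> \<le> t}"
      proof eventually_elim
        case (elim n)
        have "measure (M n) {\<omega> \<in> space (M n). X n \<omega> < t} \<le> measure (M n) {\<omega> \<in> space (M n). X n \<omega> \<le> t}"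
          using prob_space.finite_measure[OF M(1)[of n]] by (intro finite_measure.finite_measure_mono) auto
        with elim show ?case by simp
      qed
    next
      fix c assume "measure M' {\<omega> \<in> space M'. X' \<omega> \<le> t} < c"
      then have "\<forall>\<^sub>F n in sequentially. 1 - c < measure (M n) {\<omega> \<in> space (M n). t < X n \<omega>}"
        by (intro gt) (simp add: split[OF M(2) X(2)])
      then show "\<forall>\<^sub>F n in sequentially. measure (M n) {\<omega> \<in> space (M n). X n \<omega> \<le> t} < c"
        by eventually_elim (simp add: split[OF M(1) X(1)])
    qed
  qed
  \<comment> \<open>The identity is unbounded. Truncation at \<open>C\<close> makes it a bounded
    continuous test function and changes none of the values taken by the variables.\<close>
  then have "(\<lambda>n. \<integral>y. max (-C) (min C y) \<partial>?D n) \<longlonglongrightarrow> (\<integral>y. max (-C) (min C y) \<partial>?D')"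
  proof (rule weak_conv_imp_integral_bdd_continuous_conv[OF dist])
    show "isCont (\<lambda>y. max (-C) (min C y)) y" for y :: real by (intro continuous_intros)
    have "0 \<le> C" using bdd(2) abs_ge_zero order_trans by blast
    then show "norm (max (-C) (min C y)) \<le> C" for y :: real by auto
  qed
  moreover have "max (-C) (min C (X n \<omega>)) = X n \<omega>" "max (-C) (min C (X' \<omega>')) = X' \<omega>'" for n \<omega> \<omega>'
    using bdd(1)[of n \<omega>] bdd(2)[of \<omega>'] by auto
  ultimately show ?thesis by (simp add: integral_distr)
qed

lemma good_ball_lower_bound:
  fixes M :: "nat \<Rightarrow> 'a measure" and M' :: "'b measure"
  assumes wg: "\<And>n. weighted_graph (M n) (G n) (x n) F (w n)"
    and wg': "weighted_graph M' G' x' F w'"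
    and fin: "\<And>n \<omega>. \<omega> \<in> space (M n) \<Longrightarrow> finite (verts (G n \<omega>))"
    and rooted: "\<And>\<omega>. \<omega> \<in> space M' \<Longrightarrow> rooted_graph (G' \<omega>) (x' \<omega>)"
    and F0: "\<And>t. measure F {t} = 0"
    and conv: "converges_in_distribution M (\<lambda>n \<omega>. graph_class (G n \<omega>) (x n \<omega>))
       M' (\<lambda>\<omega>. graph_class (G' \<omega>) (x' \<omega>))"
    and decay: "AE \<omega> in M'. correlation_decay F (G' \<omega>)"
    and U: "open U"
    and c: "c < measure M' {\<omega> \<in> space M'. marked_graph_class (G' \<omega>) (x' \<omega>) (mwm_marks (mwm (G' \<omega>) (w' \<omega>)) (w' \<omega>)) \<in> U}"
  shows "\<forall>\<^sub>F n in sequentially. c < measure (M n)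
    {\<omega> \<in> space (M n). marked_graph_class (G n \<omega>) (x n \<omega>) (mwm_marks (mwm (G n \<omega>) (w n \<omega>)) (w n \<omega>)) \<in> U}"
proof -
  interpret W': weighted_graph M' G' x' F w' by (rule wg')
  let ?Y = "\<lambda>n \<omega>. marked_graph_class (G n \<omega>) (x n \<omega>) (mwm_marks (mwm (G n \<omega>) (w n \<omega>)) (w n \<omega>))"
  let ?Y' = "\<lambda>\<omega>. marked_graph_class (G' \<omega>) (x' \<omega>) (mwm_marks (mwm (G' \<omega>) (w' \<omega>)) (w' \<omega>))"
  let ?good = "\<lambda>R \<omega>. good_ball U R (gball (G' \<omega>) {x' \<omega>} R) (x' \<omega>) (w' \<omega>)"
  have Fp: "prob_space F" "sets F = sets borel" by (rule W'.F.prob_space_axioms W'.sets_F)+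
  \<comment> \<open>Goodness is not monotone in the radius. Requiring it from \<open>m\<close> on
    gives increasing events, so continuity from below yields a single radius \<open>R\<close> at
    which the bound \<open>c\<close> is exceeded.\<close>
  define A where "A m = {\<omega> \<in> space M'. \<forall>R\<in>{m..}. ?good R \<omega>}" for m
  have A: "A m \<in> sets M'" for m
    unfolding A_def by (intro predE pred_intros_countable_bounded W'.prob_good_ball(1))
  \<comment> \<open>Correlation decay enters at this point, for the limit graph only.\<close>
  have "AE \<omega> in M'. ?Y' \<omega> \<in> U \<longrightarrow> \<omega> \<in> (\<Union>m. A m)"
    using W'.AE_stable[OF decay] W'.AE_generic[OF F0] AE_space
  proof eventually_elim
    case (elim \<omega>)
    show ?case
    proof
      assume "?Y' \<omega> \<in> U"
      then have "\<forall>\<^sub>F R in sequentially. ?good R \<omega>"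
        using elim by (intro eventually_good_ball rooted U) auto
      then show "\<omega> \<in> (\<Union>m. A m)" using elim(3) by (auto simp: A_def eventually_sequentially)
    qed
  qed
  moreover have "(\<Union>m. A m) \<in> sets M'" using A by blast
  ultimately have "measure M' {\<omega> \<in> space M'. ?Y' \<omega> \<in> U} \<le> measure M' (\<Union>m. A m)"
    by (intro W'.finite_measure_mono_AE) auto
  with c have less: "c < measure M' (\<Union>m. A m)" by simp
  have "incseq A" by (rule monoI) (auto simp: A_def)
  then have "(\<lambda>m. measure M' (A m)) \<longlonglongrightarrow> measure M' (\<Union>m. A m)"
    using A by (intro W'.finite_Lim_measure_incseq) auto
  from order_tendstoD(1)[OF this less]
  have "\<forall>\<^sub>F m in sequentially. c < measure M' (A m)" .
  then obtain R where R: "c < measure M' (A R)" unfolding eventually_sequentially by blast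
  also have "\<dots> \<le> measure M' {\<omega> \<in> space M'. ?good R \<omega>}"
    by (intro W'.finite_measure_mono predE W'.prob_good_ball(1)) (auto simp: A_def)
  also have "\<dots> = (\<integral>\<omega>. good_class_prob F U R (graph_class (G' \<omega>) (x' \<omega>)) \<partial>M')"
    unfolding W'.prob_good_ball(2) by (intro Bochner_Integration.integral_cong refl
        good_class_prob_graph_class[OF Fp, symmetric] W'.ugraph W'.locally_finite W'.root)
  finally have less: "c < (\<integral>\<omega>. good_class_prob F U R (graph_class (G' \<omega>) (x' \<omega>)) \<partial>M')" .
  have "(\<lambda>n. \<integral>\<omega>. good_class_prob F U R (graph_class (G n \<omega>) (x n \<omega>)) \<partial>M n)
      \<longlonglongrightarrow> (\<integral>\<omega>. good_class_prob F U R (graph_class (G' \<omega>) (x' \<omega>)) \<partial>M')"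
    using conv continuous_good_class_prob[OF Fp] good_class_prob_bounded[OF Fp(1)]
    unfolding converges_in_distribution_def by blast
  from order_tendstoD(1)[OF this less]
  have "\<forall>\<^sub>F n in sequentially. c < (\<integral>\<omega>. good_class_prob F U R (graph_class (G n \<omega>) (x n \<omega>)) \<partial>M n)" .
  then show ?thesis
  proof eventually_elim
    case (elim n)
    interpret W: weighted_graph "M n" "G n" "x n" F "w n" by (rule wg)
    have "(\<integral>\<omega>. good_class_prob F U R (graph_class (G n \<omega>) (x n \<omega>)) \<partial>M n) =
        measure (M n) {\<omega> \<in> space (M n). good_ball U R (gball (G n \<omega>) {x n \<omega>} R) (x n \<omega>) (w n \<omega>)}"
      unfolding W.prob_good_ball(2) by (intro Bochner_Integration.integral_cong refl
          good_class_prob_graph_class[OF Fp] W.ugraph W.locally_finite W.root)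
    also have "\<dots> \<le> measure (M n) {\<omega> \<in> space (M n). ?Y n \<omega> \<in> U}"
    proof (rule W.finite_measure_mono)
      \<comment> \<open>For the finite graphs goodness implies membership in \<open>U\<close>, at
        every outcome. The reverse inclusion may fail, but a lower bound asks for this direction
        only.\<close>
      show "{\<omega> \<in> space (M n). good_ball U R (gball (G n \<omega>) {x n \<omega>} R) (x n \<omega>) (w n \<omega>)} \<subseteq> {\<omega> \<in> space (M n). ?Y n \<omega> \<in> U}"
        using good_ball_imp_mem[OF W.ugraph fin W.root] by blast
      have "?Y n \<in> borel_measurable (M n)"
        by (intro W.borel_measurable_marked_graph_class borel_measurable_mwm_marks W.pred_mwm W.weight_measurable)
      from measurable_sets[OF this borel_open[OF U]]
      show "{\<omega> \<in> space (M n). ?Y n \<omega> \<in> U} \<in> sets (M n)" by (simp add: vimage_def Int_def conj_commute)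
    qed
    finally show ?case using elim by simp
  qed
qed

theorem proposition1p7:
  fixes F :: "real measure"
    and M :: "nat \<Rightarrow> 'a measure" and G :: "nat \<Rightarrow> 'a \<Rightarrow> nat graph"
    and x :: "nat \<Rightarrow> 'a \<Rightarrow> nat" and w :: "nat \<Rightarrow> 'a \<Rightarrow> nat set \<Rightarrow> real"
    and M' :: "'b measure" and G' :: "'b \<Rightarrow> nat graph"
    and x' :: "'b \<Rightarrow> nat" and w' :: "'b \<Rightarrow> nat set \<Rightarrow> real"
  assumes F: "prob_space F" "sets F = sets borel" "\<And>t. measure F {t} = 0" "AE t in F. 0 \<le> t"
    and finite_graphs:
      "\<And>n. prob_space (M n)"
      "\<And>n. G n \<in> measurable (M n) graph_space"
      "\<And>n. x n \<in> measurable (M n) (count_space UNIV)"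
      "\<And>n \<omega>. \<omega> \<in> space (M n) \<Longrightarrow>
         ugraph (G n \<omega>) \<and> finite (verts (G n \<omega>)) \<and> x n \<omega> \<in> verts (G n \<omega>)"
      "\<And>n. uniform_root (M n) (G n) (x n)"
      "\<And>n. iid_weights F (M n) (G n) (x n) (w n)"
    and limit_graph:
      "prob_space M'"
      "G' \<in> measurable M' graph_space"
      "x' \<in> measurable M' (count_space UNIV)"
      "\<And>\<omega>. \<omega> \<in> space M' \<Longrightarrow> rooted_graph (G' \<omega>) (x' \<omega>)"
      "iid_weights F M' G' x' w'"
    and convergence:
      "converges_in_distribution M (\<lambda>n \<omega>. graph_class (G n \<omega>) (x n \<omega>))
         M' (\<lambda>\<omega>. graph_class (G' \<omega>) (x' \<omega>))"
    and decay: "AE \<omega> in M'. correlation_decay F (G' \<omega>)"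
  shows "converges_in_distribution
     M (\<lambda>n \<omega>. marked_graph_class (G n \<omega>) (x n \<omega>)
              (\<lambda>e. (w n \<omega> e, of_bool (e \<in> mwm (G n \<omega>) (w n \<omega>)) :: real)))
     M' (\<lambda>\<omega>. marked_graph_class (G' \<omega>) (x' \<omega>)
              (\<lambda>e. (w' \<omega> e, of_bool (e \<in> mwm (G' \<omega>) (w' \<omega>)) :: real)))"
proof -
  have wg: "weighted_graph (M n) (G n) (x n) F (w n)" for n
    by (intro weighted_graph.intro measurable_graph.intro weighted_graph_axioms.intro finite_graphs F(1,2))
      (use finite_graphs(4) locally_finite_finite in blast)+
  have wg': "weighted_graph M' G' x' F w'"
    by (intro weighted_graph.intro measurable_graph.intro weighted_graph_axioms.intro limit_graph F(1,2))
      (use limit_graph(4) in \<open>auto simp: rooted_graph_def\<close>)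
  let ?Y = "\<lambda>n \<omega>. marked_graph_class (G n \<omega>) (x n \<omega>) (mwm_marks (mwm (G n \<omega>) (w n \<omega>)) (w n \<omega>))"
  let ?Y' = "\<lambda>\<omega>. marked_graph_class (G' \<omega>) (x' \<omega>) (mwm_marks (mwm (G' \<omega>) (w' \<omega>)) (w' \<omega>))"
  have marks: "(\<lambda>e. (v e, of_bool (e \<in> N) :: real)) = mwm_marks N v" for N and v :: "nat set \<Rightarrow> real"
    by (simp add: mwm_marks_def fun_eq_iff)
  have Y: "?Y n \<in> borel_measurable (M n)" for n
  proof -
    interpret W: weighted_graph "M n" "G n" "x n" F "w n" by (rule wg)
    show ?thesis
      by (intro W.borel_measurable_marked_graph_class borel_measurable_mwm_marks W.pred_mwm W.weight_measurable)
  qed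
  interpret W': weighted_graph M' G' x' F w' by (rule wg')
  have Y': "?Y' \<in> borel_measurable M'"
    by (intro W'.borel_measurable_marked_graph_class borel_measurable_mwm_marks W'.pred_mwm W'.weight_measurable)
  have lower: "\<forall>\<^sub>F n in sequentially. c < measure (M n) {\<omega> \<in> space (M n). ?Y n \<omega> \<in> U}"
    if "open U" "c < measure M' {\<omega> \<in> space M'. ?Y' \<omega> \<in> U}" for U c
    using finite_graphs(4) by (intro good_ball_lower_bound[OF wg wg' _ limit_graph(4) F(3) convergence decay that]) auto
  show ?thesis
    unfolding converges_in_distribution_def marks
  proof (intro conjI allI impI Y Y')
    fix f :: "(real \<times> real) marked_class \<Rightarrow> real"
    assume f: "continuous_on UNIV f \<and> bounded (range f)"
    then obtain C where C: "\<bar>f y\<bar> \<le> C" for y by (auto simp: bounded_iff)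
    have f_measurable: "f \<in> borel_measurable borel" using f by (intro borel_measurable_continuous_onI) blast
    \<comment> \<open>Preimages of both kinds of open half-line are open, so the one-sided bound
      \<open>lower\<close> controls upper and lower tails alike.\<close>
    have op: "open (f -` V)" if "open V" for V using f that by (simp add: continuous_on_open_vimage)
    show "(\<lambda>n. \<integral>\<omega>. f (?Y n \<omega>) \<partial>M n) \<longlonglongrightarrow> (\<integral>\<omega>. f (?Y' \<omega>) \<partial>M')"
    proof (rule expectation_convergence[where C = C])
      show "(\<lambda>\<omega>. f (?Y n \<omega>)) \<in> borel_measurable (M n)" "(\<lambda>\<omega>. f (?Y' \<omega>)) \<in> borel_measurable M'" for n
        by (rule measurable_compose[OF Y f_measurable] measurable_compose[OF Y' f_measurable])+
      show "\<forall>\<^sub>F n in sequentially. c < measure (M n) {\<omega> \<in> space (M n). t < f (?Y n \<omega>)}"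
        if "c < measure M' {\<omega> \<in> space M'. t < f (?Y' \<omega>)}" for t c
        using lower[OF op[OF open_greaterThan[of t]], of c] that by simp
      show "\<forall>\<^sub>F n in sequentially. c < measure (M n) {\<omega> \<in> space (M n). f (?Y n \<omega>) < t}"
        if "c < measure M' {\<omega> \<in> space M'. f (?Y' \<omega>) < t}" for t c
        using lower[OF op[OF open_lessThan[of t]], of c] that by simp
    qed (simp_all add: finite_graphs(1) limit_graph(1) C)
  qed
qed

end
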